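(* Let $f\colon M^m\to\mathbb{R}\times_\rho\mathbb{Q}^n_\epsilon$ be an isometric immersion and assume that $L:=N_1+\operatorname{span}\{\eta\}$ is a subbundle of the normal bundle $TM^\perp_f$ of rank $l<n+1-m$. Then $\nabla^\perp N_1\subset L$ if and only if the following two conditions hold: (i) $\nabla^\perp R^\perp|_{L^\perp}=0$; (ii) $\nabla^\perp H\in L$, i.e. $\nabla^\perp_X H\in L$ for every $X\in TM$.
   Context: $\mathbb{Q}^n_\epsilon$ denotes the unit sphere $\mathbb{S}^n$ if $\epsilon=1$ and the hyperbolic space $\mathbb{H}^n$ (curvature $-1$) if $\epsilon=-1$. Given a smooth positive function $\rho\colon\mathbb{R}\to\mathbb{R}$, the warped product $\mathbb{R}\times_\rho\mathbb{Q}^n_\epsilon$ is the manifold $\mathbb{R}\times\mathbb{Q}^n_\epsilon$ with the metric $\langle\,,\rangle=\pi_1^*dt^2+(\rho\circ\pi_1)^2\pi_2^*\langle\,,\rangle_{\mathbb{Q}^n_\epsilon}$, where $\pi_1,\pi_2$ are the canonical projections; $\partial_t$ is the unit vector field tangent to the factor $\mathbb{R}$. Standing assumptions: regarding $\mathbb{Q}^n_\epsilon=\{x\in\mathbb{E}^{n+1}:\epsilon x_1^2+x_2^2+\dots+x_{n+1}^2=\epsilon\}$ (with $x_1>0$ if $\epsilon=-1$), where $\mathbb{E}^{k}$ is $\mathbb{R}^{k}$ with the flat metric $\epsilon dx_1^2+dx_2^2+\dots+dx_k^2$, the ambient space is a rotational hypersurface of $\mathbb{E}^{n+2}$ via $i(t,x)=(\rho(t)x,h(t))$,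 where $h\colon\mathbb{R}\to\mathbb{R}$ is smooth with $\epsilon\rho'(t)^2+h'(t)^2=1$ and $h'(t)>0$ for all $t$. The ambient space does not have constant sectional curvature, in the sense that the function $(\rho''(t)\rho(t)-\rho'(t)^2+\epsilon)/\rho(t)^2$ is nowhere zero. For an isometric immersion $f\colon M^m\to\mathbb{R}\times_\rho\mathbb{Q}^n_\epsilon$, write $\partial_t=f_*T+\eta$ along $f$, with $T$ tangent to $M$ and $\eta$ normal to $f$. Let $\alpha_f$ be the second fundamental form, $\nabla$ the Levi-Civita connection of $M$, $\nabla^\perp$ the normal connection, $R^\perp$ the normal curvature tensor, and $H=\tfrac1m\operatorname{trace}\alpha_f$ the mean curvature vector field. The first normal space $N_1(x)$ at $x$ is the subspace of the normal space $T_xM^\perp$ spanned by the values of $\alpha_f$ at $x$. $L^\perp$ is the orthogonal complement of $L$ in $TM^\perp_f$. The notation $\nabla^\perp N_1\subset L$ means $\nabla^\perp_X\xi\in L$ for every $X\in TM$ and every local smooth section $\xi$ of $TM^\perp_f$ with values in $N_1$. The notation $\nabla^\perp R^\perp|_{L^\perp}=0$ means that for all tangent fields $X,Y,Z$ and every section $\xi$ of $L^\perp$, $$(\nabla^\perp_ZR^\perp)(X,Y,\xi):=\nabla^\perp_Z\big(R^\perp(X,Y)\xi\big)-R^\perp(\nabla_ZX,Y)\xi-R^\perp(X,\nabla_ZY)\xi-R^\perp(X,Y)\nabla^\perp_Z\xi=0.$$ *)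

theory Defs
  imports "HOL-Analysis.Analysis"
begin

section \<open>Smooth manifolds\<close>

text \<open>\<open>Ck_on k S f\<close> is meant for open \<open>S\<close>: all iterated directional derivatives of order at
  most \<open>k\<close> exist and are continuous.\<close>

primrec Ck_on :: "nat \<Rightarrow> 'v::real_normed_vector set \<Rightarrow> ('v \<Rightarrow> 'w::real_normed_vector) \<Rightarrow> bool" where
  "Ck_on 0 S f \<longleftrightarrow> continuous_on S f"
| "Ck_on (Suc k) S f \<longleftrightarrow>
     (\<forall>x\<in>S. f differentiable (at x)) \<and> (\<forall>v. Ck_on k S (\<lambda>x. frechet_derivative f (at x) v))"

definition smooth_on :: "'v::real_normed_vector set \<Rightarrow> ('v \<Rightarrow> 'w::real_normed_vector) \<Rightarrow> bool" where
  "smooth_on S f \<longleftrightarrow> (\<forall>k. Ck_on k S f)"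

type_synonym ('a, 'm) chart = "'a set \<times> ('a \<Rightarrow> real ^ 'm)"

definition chart_inv :: "('a, 'm) chart \<Rightarrow> real ^ 'm \<Rightarrow> 'a" where
  "chart_inv c = inv_into (fst c) (snd c)"

text \<open>The manifold is a whole (Hausdorff, second countable) type \<open>'a\<close>; its dimension is \<open>CARD('m)\<close>.\<close>

definition smooth_atlas ::
  "('a::{t2_space,second_countable_topology}, 'm::finite) chart set \<Rightarrow> bool" where
  "smooth_atlas A \<longleftrightarrow>
     (\<Union>c\<in>A. fst c) = UNIV \<and>
     (\<forall>c\<in>A. open (fst c) \<and> open (snd c ` fst c) \<and>
        homeomorphism (fst c) (snd c ` fst c) (snd c) (chart_inv c)) \<and>
     (\<forall>c\<in>A. \<forall>d\<in>A. smooth_on (snd c ` (fst c \<inter> fst d)) (snd d \<circ> chart_inv c))"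

definition msmooth ::
  "('a::topological_space, 'm::finite) chart set \<Rightarrow> 'a set \<Rightarrow> ('a \<Rightarrow> 'w::real_normed_vector) \<Rightarrow> bool" where
  "msmooth A W F \<longleftrightarrow> (\<forall>c\<in>A. smooth_on (snd c ` (fst c \<inter> W)) (F \<circ> chart_inv c))"

text \<open>Tangent vectors at \<open>p\<close> are represented by elements of \<open>real ^ 'm\<close>, namely by their components
  in one chart at \<open>p\<close> chosen once and for all. Hence a vector field \<open>X\<close> is a
  function \<open>'a \<Rightarrow> real ^ 'm\<close> which need not be continuous as such, because the chosen chart varies
  with the point; smoothness refers to the components in the charts of the atlas.\<close>

definition chart_at :: "('a, 'm) chart set \<Rightarrow> 'a \<Rightarrow> ('a, 'm) chart" where
  "chart_at A p = (SOME c. c \<in> A \<and> p \<in> fst c)"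

definition mderiv ::
  "('a, 'm::finite) chart set \<Rightarrow> ('a \<Rightarrow> 'w::real_normed_vector) \<Rightarrow> 'a \<Rightarrow> real ^ 'm \<Rightarrow> 'w" where
  "mderiv A F p v =
     (let c = chart_at A p in frechet_derivative (F \<circ> chart_inv c) (at (snd c p)) v)"

definition vector_field ::
  "('a::topological_space, 'm::finite) chart set \<Rightarrow> 'a set \<Rightarrow> ('a \<Rightarrow> real ^ 'm) \<Rightarrow> bool" where
  "vector_field A W X \<longleftrightarrow> (\<forall>c\<in>A. msmooth A (W \<inter> fst c) (\<lambda>p. mderiv A (snd c) p (X p)))"

text \<open>In the coordinates \<open>x\<close> chosen at \<open>p\<close> this is the usual
  \<open>[X, Y]\<^sup>k = X (Y\<^sup>k) - Y (X\<^sup>k)\<close>.\<close>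

definition lie_bracket ::
  "('a, 'm::finite) chart set \<Rightarrow> ('a \<Rightarrow> real ^ 'm) \<Rightarrow> ('a \<Rightarrow> real ^ 'm) \<Rightarrow> 'a \<Rightarrow> real ^ 'm" where
  "lie_bracket A X Y p =
     (let x = snd (chart_at A p) in
        mderiv A (\<lambda>q. mderiv A x q (Y q)) p (X p) - mderiv A (\<lambda>q. mderiv A x q (X q)) p (Y p))"

definition riemannian_metric ::
  "('a::topological_space, 'm::finite) chart set \<Rightarrow> ('a \<Rightarrow> real ^ 'm \<Rightarrow> real ^ 'm \<Rightarrow> real) \<Rightarrow> bool" where
  "riemannian_metric A g \<longleftrightarrow>
     (\<forall>p. bilinear (g p) \<and> (\<forall>v w. g p v w = g p w v) \<and> (\<forall>v. v \<noteq> 0 \<longrightarrow> g p v v > 0)) \<and>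
     (\<forall>W X Y. open W \<and> vector_field A W X \<and> vector_field A W Y \<longrightarrow>
        msmooth A W (\<lambda>p. g p (X p) (Y p)))"

text \<open>The axioms are imposed on vector fields over arbitrary open sets \<open>W\<close>; the values of
  \<open>D X Y\<close> outside \<open>W\<close> are irrelevant.\<close>

definition levi_civita ::
  "('a::topological_space, 'm::finite) chart set \<Rightarrow> ('a \<Rightarrow> real ^ 'm \<Rightarrow> real ^ 'm \<Rightarrow> real) \<Rightarrow>
   (('a \<Rightarrow> real ^ 'm) \<Rightarrow> ('a \<Rightarrow> real ^ 'm) \<Rightarrow> 'a \<Rightarrow> real ^ 'm) \<Rightarrow> bool" where
  "levi_civita A g D \<longleftrightarrow>
     (\<forall>W X Y Z u. open W \<and> vector_field A W X \<and> vector_field A W Y \<and> vector_field A W Z \<and>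
        msmooth A W (u :: 'a \<Rightarrow> real) \<longrightarrow>
        vector_field A W (D X Y) \<and>
        (\<forall>p\<in>W.
           D (\<lambda>q. X q + Z q) Y p = D X Y p + D Z Y p \<and>
           D (\<lambda>q. u q *\<^sub>R X q) Y p = u p *\<^sub>R D X Y p \<and>
           D X (\<lambda>q. Y q + Z q) p = D X Y p + D X Z p \<and>
           D X (\<lambda>q. u q *\<^sub>R Y q) p = mderiv A u p (X p) *\<^sub>R Y p + u p *\<^sub>R D X Y p \<and>
           D X Y p - D Y X p = lie_bracket A X Y p \<and>
           mderiv A (\<lambda>q. g q (Y q) (Z q)) p (X p) = g p (D X Y p) (Z p) + g p (Y p) (D X Z p)))"


section \<open>The warped product\<close>

text \<open>Points \<open>(t, x)\<close> of \<open>R \<times>\<^sub>\<rho> Q\<close>, with \<open>x = (x\<^sub>1, (x\<^sub>2, \<dots>, x\<^sub>n\<^sub>+\<^sub>1))\<close> and \<open>n = CARD('n)\<close>. Tangent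
  vectors of the warped product are also regarded as elements of this vector space.\<close>

type_synonym 'n ambient = "real \<times> (real \<times> (real ^ 'n))"

definition eform :: "real \<Rightarrow> real \<times> (real ^ 'n::finite) \<Rightarrow> real \<times> (real ^ 'n) \<Rightarrow> real" where
  "eform \<epsilon> x y = \<epsilon> * fst x * fst y + snd x \<bullet> snd y"

definition space_form :: "real \<Rightarrow> (real \<times> (real ^ 'n::finite)) set" where
  "space_form \<epsilon> = {x. eform \<epsilon> x x = \<epsilon> \<and> (\<epsilon> = -1 \<longrightarrow> fst x > 0)}"

definition wtangent :: "real \<Rightarrow> 'n::finite ambient \<Rightarrow> 'n ambient set" where
  "wtangent \<epsilon> y = {v. eform \<epsilon> (snd y) (snd v) = 0}"

definition wmetric ::
  "real \<Rightarrow> (real \<Rightarrow> real) \<Rightarrow> 'n::finite ambient \<Rightarrow> 'n ambient \<Rightarrow> 'n ambient \<Rightarrow> real" where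
  "wmetric \<epsilon> \<rho> y v w = fst v * fst w + (\<rho> (fst y))\<^sup>2 * eform \<epsilon> (snd v) (snd w)"

text \<open>The Levi-Civita covariant derivative of \<open>R \<times>\<^sub>\<rho> Q\<close>, at the point \<open>(t, x)\<close> and in the direction
  \<open>(t', x')\<close>, of a tangent field with value \<open>(s, y)\<close> and derivative \<open>(s', y')\<close> in that direction.
  In the second component, \<open>y' - \<epsilon> \<langle>x, y'\<rangle> x\<close> is the orthogonal projection of \<open>y'\<close> to the tangent
  space of \<open>Q\<close> at \<open>x\<close>, i.e. the covariant derivative in \<open>Q\<close>; the remaining terms come from
  \<open>\<nabla>\<^bsub>\<partial>t\<^esub> \<partial>t = 0\<close>, \<open>\<nabla>\<^bsub>\<partial>t\<^esub> V = \<nabla>\<^bsub>V\<^esub> \<partial>t = (\<rho>' / \<rho>) V\<close> and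
  \<open>\<nabla>\<^bsub>U\<^esub> V = \<nabla>\<^sup>Q\<^bsub>U\<^esub> V - \<rho> \<rho>' \<langle>U, V\<rangle>\<^bsub>Q\<^esub> \<partial>t\<close> for \<open>U\<close>, \<open>V\<close> lifted from \<open>Q\<close>. The lemmas
  below verify that this is a torsion-free metric connection.\<close>

fun wconn ::
  "real \<Rightarrow> (real \<Rightarrow> real) \<Rightarrow> 'n::finite ambient \<Rightarrow> 'n ambient \<Rightarrow> 'n ambient \<Rightarrow> 'n ambient \<Rightarrow> 'n ambient" where
  "wconn \<epsilon> \<rho> (t, x) (t', x') (s, y) (s', y') =
     (s' - \<rho> t * deriv \<rho> t * eform \<epsilon> x' y,
      (y' - (\<epsilon> * eform \<epsilon> x y') *\<^sub>R x) + (deriv \<rho> t / \<rho> t) *\<^sub>R (t' *\<^sub>R y + s *\<^sub>R x'))"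

lemma wconn_eq:
  "wconn \<epsilon> \<rho> p u v v' =
     (fst v' - \<rho> (fst p) * deriv \<rho> (fst p) * eform \<epsilon> (snd u) (snd v),
      (snd v' - (\<epsilon> * eform \<epsilon> (snd p) (snd v')) *\<^sub>R snd p) +
      (deriv \<rho> (fst p) / \<rho> (fst p)) *\<^sub>R (fst u *\<^sub>R snd v + fst v *\<^sub>R snd u))"
  by (cases p; cases u; cases v; cases v') (simp only: wconn.simps fst_conv snd_conv)

lemma eform_simps:
  "eform \<epsilon> (x + y) z = eform \<epsilon> x z + eform \<epsilon> y z"
  "eform \<epsilon> (x - y) z = eform \<epsilon> x z - eform \<epsilon> y z"
  "eform \<epsilon> (c *\<^sub>R x) z = c * eform \<epsilon> x z"
  "eform \<epsilon> z (x + y) = eform \<epsilon> z x + eform \<epsilon> z y"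
  "eform \<epsilon> z (x - y) = eform \<epsilon> z x - eform \<epsilon> z y"
  "eform \<epsilon> z (c *\<^sub>R x) = c * eform \<epsilon> z x"
  by (simp_all add: eform_def algebra_simps inner_simps)

lemma eform_commute: "eform \<epsilon> x y = eform \<epsilon> y x"
  by (simp add: eform_def inner_commute)

lemma wconn_tangent:
  assumes "\<epsilon> = 1 \<or> \<epsilon> = -1" "snd p \<in> space_form \<epsilon>"
    and "u \<in> wtangent \<epsilon> p" "v \<in> wtangent \<epsilon> p"
  shows "wconn \<epsilon> \<rho> p u v v' \<in> wtangent \<epsilon> p"
  using assms by (elim disjE) (simp_all add: wconn_eq wtangent_def space_form_def eform_simps)

lemma wconn_add:
  "wconn \<epsilon> \<rho> p u (v + w) (v' + w') = wconn \<epsilon> \<rho> p u v v' + wconn \<epsilon> \<rho> p u w w'"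
  by (simp add: wconn_eq eform_simps algebra_simps)

lemma wconn_linear_direction:
  assumes "linear Dv"
  shows "linear (\<lambda>u. wconn \<epsilon> \<rho> p u v (Dv u))"
  by (rule linearI)
    (simp_all add: wconn_eq eform_simps algebra_simps linear_add[OF assms] linear_cmul[OF assms])

lemma wconn_leibniz:
  assumes "v \<in> wtangent \<epsilon> p"
  shows "wconn \<epsilon> \<rho> p u (c *\<^sub>R v) (c' *\<^sub>R v + c *\<^sub>R v') = c' *\<^sub>R v + c *\<^sub>R wconn \<epsilon> \<rho> p u v v'"
  using assms by (intro prod_eqI) (simp_all only: wconn_eq fst_add snd_add fst_scaleR snd_scaleR
      fst_conv snd_conv, simp_all add: wtangent_def eform_simps algebra_simps)

text \<open>Torsion-freeness: for tangent fields \<open>U\<close>, \<open>V\<close> with values \<open>u\<close>, \<open>v\<close> at \<open>p\<close>, with \<open>v'\<close> the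
  derivative of \<open>V\<close> along \<open>u\<close> and \<open>u'\<close> that of \<open>U\<close> along \<open>v\<close>, the bracket is \<open>v' - u'\<close>. The
  assumptions are the tangency of \<open>U\<close> and \<open>V\<close>, differentiated.\<close>

lemma wconn_torsion_free:
  assumes "eform \<epsilon> (snd u) (snd v) + eform \<epsilon> (snd p) (snd v') = 0"
    and "eform \<epsilon> (snd v) (snd u) + eform \<epsilon> (snd p) (snd u') = 0"
  shows "wconn \<epsilon> \<rho> p u v v' - wconn \<epsilon> \<rho> p v u u' = v' - u'"
proof -
  have "eform \<epsilon> (snd p) (snd v') = eform \<epsilon> (snd p) (snd u')"
    using assms eform_commute[of \<epsilon> "snd u" "snd v"] by linarith
  then show ?thesis
    by (intro prod_eqI) (simp_all only: wconn_eq fst_diff snd_diff fst_conv snd_conv,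
      simp_all add: eform_commute[of \<epsilon> "snd u" "snd v"] algebra_simps)
qed

lemma has_derivative_eform:
  fixes x y :: "real \<Rightarrow> real \<times> (real ^ 'n::finite)"
  assumes "(x has_vector_derivative x') (at r)" "(y has_vector_derivative y') (at r)"
  shows "((\<lambda>r. eform \<epsilon> (x r) (y r)) has_real_derivative
           eform \<epsilon> x' (y r) + eform \<epsilon> (x r) y') (at r)"
proof -
  have bb: "bounded_bilinear (eform \<epsilon> :: real \<times> (real ^ 'n) \<Rightarrow> _)"
    unfolding bilinear_conv_bounded_bilinear[symmetric] bilinear_def linear_iff
    by (simp add: eform_simps)
  have "((\<lambda>r. eform \<epsilon> (x r) (y r)) has_vector_derivative
      (eform \<epsilon> (x r) y' + eform \<epsilon> x' (y r))) (at r)"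
    by (rule bounded_bilinear.has_vector_derivative[OF bb assms])
  then show ?thesis
    by (simp add: has_real_derivative_iff_has_vector_derivative add.commute)
qed

lemma wconn_metric:
  fixes c V W :: "real \<Rightarrow> 'n::finite ambient"
  assumes "\<And>t. \<rho> t > 0" "\<rho> differentiable (at (fst (c r)))"
    and "(c has_vector_derivative c') (at r)"
    and "(V has_vector_derivative V') (at r)" "(W has_vector_derivative W') (at r)"
    and "V r \<in> wtangent \<epsilon> (c r)" "W r \<in> wtangent \<epsilon> (c r)"
  shows "((\<lambda>r. wmetric \<epsilon> \<rho> (c r) (V r) (W r)) has_real_derivative
           wmetric \<epsilon> \<rho> (c r) (wconn \<epsilon> \<rho> (c r) c' (V r) V') (W r) +
           wmetric \<epsilon> \<rho> (c r) (V r) (wconn \<epsilon> \<rho> (c r) c' (W r) W')) (at r)"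
proof -
  have fst: "((\<lambda>r. fst (F r)) has_real_derivative fst F') (at r)"
    if "(F has_vector_derivative F') (at r)" for F :: "real \<Rightarrow> 'n ambient" and F'
    using bounded_linear.has_vector_derivative[OF bounded_linear_fst that]
    by (simp add: has_real_derivative_iff_has_vector_derivative)
  have snd: "((\<lambda>r. snd (F r)) has_vector_derivative snd F') (at r)"
    if "(F has_vector_derivative F') (at r)" for F :: "real \<Rightarrow> 'n ambient" and F'
    using bounded_linear.has_vector_derivative[OF bounded_linear_snd that] .
  have \<rho>: "(\<rho> has_real_derivative deriv \<rho> (fst (c r))) (at (fst (c r)))"
    using assms(2) by (simp add: DERIV_deriv_iff_real_differentiable)
  have \<rho>c: "((\<lambda>r. \<rho> (fst (c r))) has_real_derivative deriv \<rho> (fst (c r)) * fst c') (at r)"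
    using DERIV_chain2[OF \<rho> fst[OF assms(3)]] .
  have *: "((\<lambda>r. wmetric \<epsilon> \<rho> (c r) (V r) (W r)) has_real_derivative
      (fst V' * fst (W r) + fst W' * fst (V r)) +
      (2 * \<rho> (fst (c r)) * (deriv \<rho> (fst (c r)) * fst c') * eform \<epsilon> (snd (V r)) (snd (W r)) +
       (eform \<epsilon> (snd V') (snd (W r)) + eform \<epsilon> (snd (V r)) (snd W')) * (\<rho> (fst (c r)))\<^sup>2)) (at r)"
    unfolding wmetric_def
    by (auto intro!: derivative_eq_intros fst[OF assms(4)] fst[OF assms(5)] \<rho>c
        has_derivative_eform[OF snd[OF assms(4)] snd[OF assms(5)]])
  have pos: "\<rho> (fst (c r)) \<noteq> 0"
    using assms(1)[of "fst (c r)"] by simp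
  have "wmetric \<epsilon> \<rho> (c r) (wconn \<epsilon> \<rho> (c r) c' (V r) V') (W r) +
      wmetric \<epsilon> \<rho> (c r) (V r) (wconn \<epsilon> \<rho> (c r) c' (W r) W') =
      (fst V' * fst (W r) + fst W' * fst (V r)) +
      (2 * \<rho> (fst (c r)) * (deriv \<rho> (fst (c r)) * fst c') * eform \<epsilon> (snd (V r)) (snd (W r)) +
       (eform \<epsilon> (snd V') (snd (W r)) + eform \<epsilon> (snd (V r)) (snd W')) * (\<rho> (fst (c r)))\<^sup>2)"
    using assms(6,7) pos
    by (simp add: wmetric_def wtangent_def wconn_eq eform_simps field_simps power2_eq_square
        eform_commute)
  with * show ?thesis by simp
qed


section \<open>Isometric immersions into the warped product\<close>

definition isometric_immersion ::
  "('a::topological_space, 'm::finite) chart set \<Rightarrow> ('a \<Rightarrow> real ^ 'm \<Rightarrow> real ^ 'm \<Rightarrow> real) \<Rightarrow>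
   real \<Rightarrow> (real \<Rightarrow> real) \<Rightarrow> ('a \<Rightarrow> 'n::finite ambient) \<Rightarrow> bool" where
  "isometric_immersion A g \<epsilon> \<rho> f \<longleftrightarrow>
     (\<forall>p. snd (f p) \<in> space_form \<epsilon>) \<and> msmooth A UNIV f \<and>
     (\<forall>p. inj (mderiv A f p)) \<and>
     (\<forall>p v w. wmetric \<epsilon> \<rho> (f p) (mderiv A f p v) (mderiv A f p w) = g p v w)"

text \<open>\<open>induced_conn A \<epsilon> \<rho> f V p v\<close> is the covariant derivative of the field \<open>V\<close> along \<open>f\<close>
  in the direction of the tangent vector \<open>v\<close> at \<open>p\<close>.\<close>

definition induced_conn ::
  "('a, 'm::finite) chart set \<Rightarrow> real \<Rightarrow> (real \<Rightarrow> real) \<Rightarrow> ('a \<Rightarrow> 'n::finite ambient) \<Rightarrow>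
   ('a \<Rightarrow> 'n ambient) \<Rightarrow> 'a \<Rightarrow> real ^ 'm \<Rightarrow> 'n ambient" where
  "induced_conn A \<epsilon> \<rho> f V p v = wconn \<epsilon> \<rho> (f p) (mderiv A f p v) (V p) (mderiv A V p v)"

definition normal_space ::
  "('a, 'm::finite) chart set \<Rightarrow> real \<Rightarrow> (real \<Rightarrow> real) \<Rightarrow> ('a \<Rightarrow> 'n::finite ambient) \<Rightarrow>
   'a \<Rightarrow> 'n ambient set" where
  "normal_space A \<epsilon> \<rho> f p =
     {\<xi> \<in> wtangent \<epsilon> (f p). \<forall>v. wmetric \<epsilon> \<rho> (f p) \<xi> (mderiv A f p v) = 0}"

definition normal_part ::
  "('a, 'm::finite) chart set \<Rightarrow> real \<Rightarrow> (real \<Rightarrow> real) \<Rightarrow> ('a \<Rightarrow> 'n::finite ambient) \<Rightarrow>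
   'a \<Rightarrow> 'n ambient \<Rightarrow> 'n ambient" where
  "normal_part A \<epsilon> \<rho> f p w =
     (THE \<xi>. \<xi> \<in> normal_space A \<epsilon> \<rho> f p \<and> (\<exists>v. w = mderiv A f p v + \<xi>))"

definition eta ::
  "('a, 'm::finite) chart set \<Rightarrow> real \<Rightarrow> (real \<Rightarrow> real) \<Rightarrow> ('a \<Rightarrow> 'n::finite ambient) \<Rightarrow>
   'a \<Rightarrow> 'n ambient" where
  "eta A \<epsilon> \<rho> f p = normal_part A \<epsilon> \<rho> f p (1, 0)"

definition normal_section ::
  "('a::topological_space, 'm::finite) chart set \<Rightarrow> real \<Rightarrow> (real \<Rightarrow> real) \<Rightarrow> ('a \<Rightarrow> 'n::finite ambient) \<Rightarrow>
   'a set \<Rightarrow> ('a \<Rightarrow> 'n ambient) \<Rightarrow> bool" where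
  "normal_section A \<epsilon> \<rho> f W \<xi> \<longleftrightarrow> msmooth A W \<xi> \<and> (\<forall>p\<in>W. \<xi> p \<in> normal_space A \<epsilon> \<rho> f p)"

definition normal_conn ::
  "('a, 'm::finite) chart set \<Rightarrow> real \<Rightarrow> (real \<Rightarrow> real) \<Rightarrow> ('a \<Rightarrow> 'n::finite ambient) \<Rightarrow>
   ('a \<Rightarrow> 'n ambient) \<Rightarrow> 'a \<Rightarrow> real ^ 'm \<Rightarrow> 'n ambient" where
  "normal_conn A \<epsilon> \<rho> f \<xi> p v = normal_part A \<epsilon> \<rho> f p (induced_conn A \<epsilon> \<rho> f \<xi> p v)"

text \<open>The extension of a tangent vector \<open>w\<close> at \<open>p\<close> to a vector field with constant components in
  the chart chosen at \<open>p\<close>; at \<open>q\<close> it is expressed in the chart chosen at \<open>q\<close>.\<close>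

definition local_extension ::
  "('a, 'm::finite) chart set \<Rightarrow> 'a \<Rightarrow> real ^ 'm \<Rightarrow> 'a \<Rightarrow> real ^ 'm" where
  "local_extension A p w q =
     (let c = chart_at A p in
        frechet_derivative (snd (chart_at A q) \<circ> chart_inv c) (at (snd c q)) w)"

definition second_fundamental_form ::
  "('a, 'm::finite) chart set \<Rightarrow> real \<Rightarrow> (real \<Rightarrow> real) \<Rightarrow> ('a \<Rightarrow> 'n::finite ambient) \<Rightarrow>
   'a \<Rightarrow> real ^ 'm \<Rightarrow> real ^ 'm \<Rightarrow> 'n ambient" where
  "second_fundamental_form A \<epsilon> \<rho> f p v w =
     normal_part A \<epsilon> \<rho> f p
       (induced_conn A \<epsilon> \<rho> f (\<lambda>q. mderiv A f q (local_extension A p w q)) p v)"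

definition mean_curvature ::
  "('a, 'm::finite) chart set \<Rightarrow> ('a \<Rightarrow> real ^ 'm \<Rightarrow> real ^ 'm \<Rightarrow> real) \<Rightarrow>
   real \<Rightarrow> (real \<Rightarrow> real) \<Rightarrow> ('a \<Rightarrow> 'n::finite ambient) \<Rightarrow> 'a \<Rightarrow> 'n ambient" where
  "mean_curvature A g \<epsilon> \<rho> f p =
     (let e = (SOME e :: 'm \<Rightarrow> real ^ 'm. \<forall>i j. g p (e i) (e j) = (if i = j then 1 else 0)) in
        (1 / real CARD('m)) *\<^sub>R (\<Sum>i\<in>UNIV. second_fundamental_form A \<epsilon> \<rho> f p (e i) (e i)))"

definition first_normal_space ::
  "('a, 'm::finite) chart set \<Rightarrow> real \<Rightarrow> (real \<Rightarrow> real) \<Rightarrow> ('a \<Rightarrow> 'n::finite ambient) \<Rightarrow>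
   'a \<Rightarrow> 'n ambient set" where
  "first_normal_space A \<epsilon> \<rho> f p = span {second_fundamental_form A \<epsilon> \<rho> f p v w | v w. True}"

definition L_space ::
  "('a, 'm::finite) chart set \<Rightarrow> real \<Rightarrow> (real \<Rightarrow> real) \<Rightarrow> ('a \<Rightarrow> 'n::finite ambient) \<Rightarrow>
   'a \<Rightarrow> 'n ambient set" where
  "L_space A \<epsilon> \<rho> f p =
     {\<xi> + \<zeta> | \<xi> \<zeta>. \<xi> \<in> first_normal_space A \<epsilon> \<rho> f p \<and> \<zeta> \<in> span {eta A \<epsilon> \<rho> f p}}"

definition L_perp ::
  "('a, 'm::finite) chart set \<Rightarrow> real \<Rightarrow> (real \<Rightarrow> real) \<Rightarrow> ('a \<Rightarrow> 'n::finite ambient) \<Rightarrow>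
   'a \<Rightarrow> 'n ambient set" where
  "L_perp A \<epsilon> \<rho> f p =
     {\<xi> \<in> normal_space A \<epsilon> \<rho> f p. \<forall>\<zeta> \<in> L_space A \<epsilon> \<rho> f p. wmetric \<epsilon> \<rho> (f p) \<xi> \<zeta> = 0}"

definition normal_subbundle ::
  "('a::topological_space, 'm::finite) chart set \<Rightarrow> real \<Rightarrow> (real \<Rightarrow> real) \<Rightarrow> ('a \<Rightarrow> 'n::finite ambient) \<Rightarrow>
   ('a \<Rightarrow> 'n ambient set) \<Rightarrow> nat \<Rightarrow> bool" where
  "normal_subbundle A \<epsilon> \<rho> f S l \<longleftrightarrow>
     (\<forall>p. \<exists>W E. open W \<and> p \<in> W \<and> (\<forall>i<l. normal_section A \<epsilon> \<rho> f W (E i)) \<and>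
        (\<forall>q\<in>W. S q = span ((\<lambda>i. E i q) ` {..<l}) \<and> dim (S q) = l))"

definition normal_curvature ::
  "('a, 'm::finite) chart set \<Rightarrow> real \<Rightarrow> (real \<Rightarrow> real) \<Rightarrow> ('a \<Rightarrow> 'n::finite ambient) \<Rightarrow>
   ('a \<Rightarrow> real ^ 'm) \<Rightarrow> ('a \<Rightarrow> real ^ 'm) \<Rightarrow> ('a \<Rightarrow> 'n ambient) \<Rightarrow> 'a \<Rightarrow> 'n ambient" where
  "normal_curvature A \<epsilon> \<rho> f X Y \<xi> p =
     normal_conn A \<epsilon> \<rho> f (\<lambda>q. normal_conn A \<epsilon> \<rho> f \<xi> q (Y q)) p (X p)
     - normal_conn A \<epsilon> \<rho> f (\<lambda>q. normal_conn A \<epsilon> \<rho> f \<xi> q (X q)) p (Y p)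
     - normal_conn A \<epsilon> \<rho> f \<xi> p (lie_bracket A X Y p)"

definition normal_curvature_deriv ::
  "('a, 'm::finite) chart set \<Rightarrow> (('a \<Rightarrow> real ^ 'm) \<Rightarrow> ('a \<Rightarrow> real ^ 'm) \<Rightarrow> 'a \<Rightarrow> real ^ 'm) \<Rightarrow>
   real \<Rightarrow> (real \<Rightarrow> real) \<Rightarrow> ('a \<Rightarrow> 'n::finite ambient) \<Rightarrow>
   ('a \<Rightarrow> real ^ 'm) \<Rightarrow> ('a \<Rightarrow> real ^ 'm) \<Rightarrow> ('a \<Rightarrow> real ^ 'm) \<Rightarrow> ('a \<Rightarrow> 'n ambient) \<Rightarrow> 'a \<Rightarrow> 'n ambient" where
  "normal_curvature_deriv A D \<epsilon> \<rho> f Z X Y \<xi> p =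
     normal_conn A \<epsilon> \<rho> f (normal_curvature A \<epsilon> \<rho> f X Y \<xi>) p (Z p)
     - normal_curvature A \<epsilon> \<rho> f (D Z X) Y \<xi> p
     - normal_curvature A \<epsilon> \<rho> f X (D Z Y) \<xi> p
     - normal_curvature A \<epsilon> \<rho> f X Y (\<lambda>q. normal_conn A \<epsilon> \<rho> f \<xi> q (Z q)) p"

end

theory Submission
  imports Defs
begin

text \<open>Let \<open>\<xi>\<close> be a local section of \<open>L\<^sup>\<bottom>\<close>, so that \<open>A\<^sub>\<xi> = 0\<close> and \<open>\<xi> \<bottom> \<partial>\<^sub>t\<close>. The ambient curvature
  \<open>R(X, Y) \<zeta>\<close> of a normal field \<open>\<zeta>\<close> has no normal part, and \<open>R(X, Y) \<xi> = 0\<close>. Hence the Ricci equation gives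
  \<open>R\<^sup>\<bottom>(X, Y) \<xi> = 0\<close>, so (i) says that \<open>R\<^sup>\<bottom>(X, Y) \<nabla>\<^sup>\<bottom>\<^sub>Z \<xi> = 0\<close>. If \<open>\<nabla>\<^sup>\<bottom> N\<^sub>1 \<subseteq> L\<close>, then
  \<open>\<nabla>\<^sup>\<bottom>\<^sub>Z \<xi>\<close> is again a section of \<open>L\<^sup>\<bottom>\<close>, which proves (i). Conversely, consider
  \<open>\<phi>(X, Y, Z) = \<langle>\<alpha>(Y, Z), \<nabla>\<^sup>\<bottom>\<^sub>X \<xi>\<rangle>\<close>. It is symmetric in \<open>X\<close>, \<open>Y\<close> because \<open>R(X, Y) \<xi>\<close> has no tangential
  part; its trace vanishes by (ii); and by (i) with the Ricci equation the operators \<open>\<phi>(X, \<cdot>, \<cdot>)\<close> commute. These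
  three properties force \<open>\<phi> = 0\<close>, i.e. \<open>\<nabla>\<^sup>\<bottom>\<^sub>X \<xi> \<bottom> N\<^sub>1\<close>, and therefore \<open>\<nabla>\<^sup>\<bottom> N\<^sub>1 \<bottom> \<xi>\<close>.\<close>

section \<open>Maps of class \<open>C\<^sup>k\<close> on open sets\<close>

text \<open>In the warped product, planes tangent to the fibre have curvature
  \<open>(\<epsilon> - \<rho>'\<^sup>2) / \<rho>\<^sup>2\<close> and planes containing
  \<open>\<partial>\<^sub>t\<close> have curvature \<open>- \<rho>'' / \<rho>\<close>. For \<zeta>
  orthogonal to X and Y the constant-curvature part of R(X, Y) \<zeta> drops out; what remains is
  the difference of the two curvatures times the product of \<zeta> with
  \<open>\<partial>\<^sub>t\<close> times a combination of X and Y. This is why \<eta> is adjoined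
  to \<open>N\<^sub>1\<close>: for sections of \<open>L\<^sup>\<bottom>\<close> the remainder
  vanishes too. Derivatives pass between orthogonal sections by metric compatibility. So (ii) gives
  the trace condition by moving the derivative from \<xi> to H, and the last step is the same
  exchange with a section of \<open>N\<^sub>1\<close> for H. It requires each vector of
  \<open>L\<^sup>\<bottom>\<close> to extend to a local section; projection along a smooth frame of
  L provides this. Smooth frames are orthogonalised but not normalised, so projections involve
  division but no square roots.\<close>

lemma frechet_derivative_cong_open:
  assumes "open S" "x \<in> S" "\<And>y. y \<in> S \<Longrightarrow> f y = g y"
  shows "frechet_derivative f (at x) = frechet_derivative g (at x)"
proof -
  have "(f has_derivative D) (at x) \<longleftrightarrow> (g has_derivative D) (at x)" for D
    using has_derivative_transform_within_open[OF _ assms(1,2), of f D UNIV g]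
      has_derivative_transform_within_open[OF _ assms(1,2), of g D UNIV f] assms(3) by auto
  then show ?thesis
    unfolding frechet_derivative_def by simp
qed

lemma differentiable_cong_open:
  assumes "open S" "x \<in> S" "\<And>y. y \<in> S \<Longrightarrow> f y = g y" "f differentiable (at x)"
  shows "g differentiable (at x)"
proof -
  obtain D where "(f has_derivative D) (at x)"
    using assms(4) unfolding differentiable_def by blast
  then have "(g has_derivative D) (at x)"
    using has_derivative_transform_within_open[OF _ assms(1,2), of f D UNIV g] assms(3) by simp
  then show ?thesis unfolding differentiable_def by blast
qed

lemma Ck_on_cong:
  assumes "open S" "\<And>x. x \<in> S \<Longrightarrow> f x = g x" "Ck_on k S f"
  shows "Ck_on k S g"
  using assms(2,3)
proof (induction k arbitrary: f g)
  case 0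
  then show ?case by (auto cong: continuous_on_cong)
next
  case (Suc k)
  have "Ck_on k S (\<lambda>x. frechet_derivative g (at x) v)" for v
  proof (rule Suc.IH)
    show "Ck_on k S (\<lambda>x. frechet_derivative f (at x) v)"
      using Suc.prems by simp
  qed (use frechet_derivative_cong_open[OF assms(1)] Suc.prems(1) in metis)
  moreover have "g differentiable (at x)" if "x \<in> S" for x
    using differentiable_cong_open[OF assms(1) that Suc.prems(1)] Suc.prems(2) that by auto
  ultimately show ?case by simp
qed

lemma Ck_on_subset: "Ck_on k S f \<Longrightarrow> T \<subseteq> S \<Longrightarrow> Ck_on k T f"
  by (induction k arbitrary: f) (auto intro: continuous_on_subset)

lemma Ck_on_SucD: "Ck_on (Suc k) S f \<Longrightarrow> Ck_on k S f"
proof (induction k arbitrary: f)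
  case 0
  then show ?case
    by (auto intro!: continuous_at_imp_continuous_on differentiable_imp_continuous_within)
next
  case (Suc k)
  from Suc.prems have "Ck_on (Suc k) S (\<lambda>x. frechet_derivative f (at x) v)" for v
    unfolding Ck_on.simps(2)[of "Suc k"] by blast
  then show ?case using Suc.IH Suc.prems by simp
qed

lemma Ck_on_local:
  assumes "\<And>x. x \<in> S \<Longrightarrow> \<exists>T. open T \<and> x \<in> T \<and> Ck_on k T f"
  shows "Ck_on k S f"
  using assms
proof (induction k arbitrary: f)
  case 0
  then show ?case
    by (metis Ck_on.simps(1) continuous_at_imp_continuous_on continuous_on_eq_continuous_at)
next
  case (Suc k)
  have "Ck_on k S (\<lambda>x. frechet_derivative f (at x) v)" for v
    by (rule Suc.IH) (use Suc.prems in \<open>metis Ck_on.simps(2)\<close>)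
  moreover have "\<forall>x\<in>S. f differentiable (at x)"
    using Suc.prems by (metis Ck_on.simps(2))
  ultimately show ?case by simp
qed

lemma Ck_on_const: "Ck_on k S (\<lambda>x. c)"
  by (induction k arbitrary: c) simp_all

text \<open>Pattern of the closure lemmas: \<open>D\<close> gives the derivative as a formula,
  \<open>Ck_on_cong\<close> substitutes it for \<open>frechet_derivative\<close> on the open set,
  and the formula is built from maps covered by the induction hypothesis.\<close>

lemma Ck_on_bounded_linear:
  assumes "bounded_linear L" "open S" "Ck_on k S f"
  shows "Ck_on k S (\<lambda>x. L (f x))"
  using assms(3)
proof (induction k arbitrary: f)
  case 0
  then show ?case
    using continuous_on_compose2[OF linear_continuous_on[OF assms(1)], of S f UNIV] by simp
next
  case (Suc k)
  have D: "((\<lambda>x. L (f x)) has_derivative (\<lambda>v. L (frechet_derivative f (at x) v))) (at x)"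
    if "x \<in> S" for x
    using Suc.prems that
    by (intro bounded_linear.has_derivative[OF assms(1)]) (simp add: frechet_derivative_works)
  have "Ck_on k S (\<lambda>x. frechet_derivative (\<lambda>x. L (f x)) (at x) v)" for v
  proof (rule Ck_on_cong[OF assms(2)])
    show "Ck_on k S (\<lambda>x. L (frechet_derivative f (at x) v))"
      using Suc by simp
  qed (simp add: frechet_derivative_at[OF D, symmetric])
  then show ?case using D by (auto simp: differentiable_def)
qed

lemma Ck_on_add:
  assumes "open S" "Ck_on k S f" "Ck_on k S g"
  shows "Ck_on k S (\<lambda>x. f x + g x)"
  using assms(2,3)
proof (induction k arbitrary: f g)
  case 0
  then show ?case by (simp add: continuous_on_add)
next
  case (Suc k)
  have D: "((\<lambda>x. f x + g x) has_derivative
      (\<lambda>v. frechet_derivative f (at x) v + frechet_derivative g (at x) v)) (at x)"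
    if "x \<in> S" for x
    using Suc.prems that by (intro has_derivative_add) (simp_all add: frechet_derivative_works)
  have "Ck_on k S (\<lambda>x. frechet_derivative (\<lambda>x. f x + g x) (at x) v)" for v
  proof (rule Ck_on_cong[OF assms(1)])
    show "Ck_on k S (\<lambda>x. frechet_derivative f (at x) v + frechet_derivative g (at x) v)"
      using Suc by simp
  qed (simp add: frechet_derivative_at[OF D, symmetric])
  then show ?case using D by (auto simp: differentiable_def)
qed

lemma Ck_on_bounded_bilinear:
  assumes "bounded_bilinear B" "open S" "Ck_on k S f" "Ck_on k S g"
  shows "Ck_on k S (\<lambda>x. B (f x) (g x))"
  using assms(3,4)
proof (induction k arbitrary: f g)
  case 0
  then show ?case by (simp add: bounded_bilinear.continuous_on[OF assms(1)])
next
  case (Suc k)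
  have D: "((\<lambda>x. B (f x) (g x)) has_derivative
      (\<lambda>v. B (f x) (frechet_derivative g (at x) v) + B (frechet_derivative f (at x) v) (g x))) (at x)"
    if "x \<in> S" for x
    using Suc.prems that
    by (intro bounded_bilinear.FDERIV[OF assms(1)]) (simp_all add: frechet_derivative_works)
  have "Ck_on k S (\<lambda>x. frechet_derivative (\<lambda>x. B (f x) (g x)) (at x) v)" for v
  proof (rule Ck_on_cong[OF assms(2)])
    show "Ck_on k S (\<lambda>x. B (f x) (frechet_derivative g (at x) v) + B (frechet_derivative f (at x) v) (g x))"
      \<comment> \<open>The product rule also contains the undifferentiated factors; they are
        lowered from order k + 1 to k.\<close>
      using Suc Ck_on_SucD[OF Suc.prems(1)] Ck_on_SucD[OF Suc.prems(2)]
      by (intro Ck_on_add[OF assms(2)] Suc.IH) auto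
  qed (simp add: frechet_derivative_at[OF D, symmetric])
  then show ?case using D by (auto simp: differentiable_def)
qed

lemma Ck_on_sum:
  assumes "open S" "\<And>i. i \<in> I \<Longrightarrow> Ck_on k S (f i)"
  shows "Ck_on k S (\<lambda>x. \<Sum>i\<in>I. f i x)"
  using assms(2)
  by (induction I rule: infinite_finite_induct) (auto intro: Ck_on_add[OF assms(1)] simp: Ck_on_const)

lemma Ck_on_inverse:
  fixes f :: "'v::real_normed_vector \<Rightarrow> real"
  assumes "open S" "Ck_on k S f" "\<And>x. x \<in> S \<Longrightarrow> f x \<noteq> 0"
  shows "Ck_on k S (\<lambda>x. inverse (f x))"
  using assms(2)
proof (induction k)
  case 0
  then show ?case using assms(3) by (simp add: continuous_on_inverse)
next
  case (Suc k)
  have D: "((\<lambda>x. inverse (f x)) has_derivative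
      (\<lambda>v. - (inverse (f x) * frechet_derivative f (at x) v * inverse (f x)))) (at x)"
    if "x \<in> S" for x
    using Suc.prems that assms(3)
    by (intro Deriv.has_derivative_inverse) (simp_all add: frechet_derivative_works)
  have "Ck_on k S (\<lambda>x. frechet_derivative (\<lambda>x. inverse (f x)) (at x) v)" for v
  proof (rule Ck_on_cong[OF assms(1)])
    \<comment> \<open>The derivative of 1/f contains 1/f itself, which the induction hypothesis
      already makes of class k.\<close>
    have "Ck_on k S (\<lambda>x. inverse (f x))"
      using Suc.IH Ck_on_SucD[OF Suc.prems] .
    then show "Ck_on k S (\<lambda>x. - (inverse (f x) * frechet_derivative f (at x) v * inverse (f x)))"
      using Suc.prems
      by (intro Ck_on_bounded_linear[OF bounded_linear_minus[OF bounded_linear_ident]]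
          Ck_on_bounded_bilinear[OF bounded_bilinear_mult] assms(1)) auto
  qed (simp add: frechet_derivative_at[OF D, symmetric])
  then show ?case using D by (auto simp: differentiable_def)
qed

lemma linear_expand_Basis:
  fixes L :: "'v::euclidean_space \<Rightarrow> 'w::real_vector"
  assumes "linear L"
  shows "L v = (\<Sum>b\<in>Basis. (v \<bullet> b) *\<^sub>R L b)"
proof -
  have "L v = L (\<Sum>b\<in>Basis. (v \<bullet> b) *\<^sub>R b)"
    by (simp add: euclidean_representation)
  then show ?thesis
    by (simp add: linear_sum[OF assms] linear_cmul[OF assms])
qed

lemma frechet_derivative_expand_Basis:
  fixes f :: "'v::euclidean_space \<Rightarrow> 'w::real_normed_vector"
  assumes "f differentiable (at x)"
  shows "frechet_derivative f (at x) v = (\<Sum>b\<in>Basis. (v \<bullet> b) *\<^sub>R frechet_derivative f (at x) b)"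
  by (rule linear_expand_Basis[OF linear_frechet_derivative[OF assms]])

text \<open>\<open>Ck_on\<close> controls derivatives in fixed directions. When the direction
  \<open>u x\<close> moves with the point, expansion in a basis reduces it to fixed directions with
  coefficients of class k.\<close>

lemma Ck_on_frechet_derivative:
  fixes f :: "'v::euclidean_space \<Rightarrow> 'w::real_normed_vector"
  assumes "open S" "open T" "T \<subseteq> S" "Ck_on (Suc k) S f" "Ck_on k T u"
  shows "Ck_on k T (\<lambda>x. frechet_derivative f (at x) (u x))"
proof (rule Ck_on_cong[OF assms(2)])
  show "Ck_on k T (\<lambda>x. \<Sum>b\<in>Basis. (u x \<bullet> b) *\<^sub>R frechet_derivative f (at x) b)"
    using assms
    by (intro Ck_on_sum Ck_on_bounded_bilinear[OF bounded_bilinear_scaleR]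
        Ck_on_bounded_linear[OF bounded_linear_inner_left]) (auto intro: Ck_on_subset)
next
  fix x assume "x \<in> T"
  then show "(\<Sum>b\<in>Basis. (u x \<bullet> b) *\<^sub>R frechet_derivative f (at x) b) = frechet_derivative f (at x) (u x)"
    using assms by (intro frechet_derivative_expand_Basis[symmetric]) auto
qed

text \<open>The induction keeps g and varies f: by the chain rule the derivative is a sum of
  products of components of the derivative of g with partial derivatives of f composed with the same
  g.\<close>

lemma Ck_on_compose:
  fixes f :: "'v::euclidean_space \<Rightarrow> 'w::real_normed_vector" and g :: "'u::real_normed_vector \<Rightarrow> 'v"
  assumes "open S" "open T" "g ` S \<subseteq> T" "Ck_on k S g" "Ck_on k T f"
  shows "Ck_on k S (\<lambda>x. f (g x))"
  using assms(4,5)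
proof (induction k arbitrary: f)
  case 0
  then have "continuous_on S g" "continuous_on T f" by simp_all
  then show ?case using continuous_on_compose2[of T f S g] assms(3) by simp
next
  case (Suc k)
  let ?D = "\<lambda>x v. \<Sum>b\<in>Basis. (frechet_derivative g (at x) v \<bullet> b) *\<^sub>R frechet_derivative f (at (g x)) b"
  have D: "((\<lambda>x. f (g x)) has_derivative ?D x) (at x)" if "x \<in> S" for x
  proof -
    have f: "f differentiable (at (g x))" and g: "g differentiable (at x)"
      using Suc.prems assms(3) that by auto
    have "(f \<circ> g has_derivative frechet_derivative f (at (g x)) \<circ> frechet_derivative g (at x)) (at x)"
      using f g by (intro diff_chain_at) (simp_all add: frechet_derivative_works)
    then show ?thesis
      by (simp add: o_def frechet_derivative_expand_Basis[OF f, symmetric])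
  qed
  have "Ck_on k S (\<lambda>x. frechet_derivative (\<lambda>x. f (g x)) (at x) v)" for v
  proof (rule Ck_on_cong[OF assms(1)])
    show "Ck_on k S (\<lambda>x. ?D x v)"
      using Suc.prems assms(1) Ck_on_SucD[OF Suc.prems(1)]
      by (intro Ck_on_sum Ck_on_bounded_bilinear[OF bounded_bilinear_scaleR]
          Ck_on_bounded_linear[OF bounded_linear_inner_left] Suc.IH) auto
  qed (simp add: frechet_derivative_at[OF D, symmetric])
  then show ?case using D by (auto simp: differentiable_def)
qed

text \<open>The second difference of f over the parallelogram spanned by s u and s v is symmetric in
  u and v, and two applications of the mean value theorem write it as \<open>s * s\<close> times a
  mixed derivative at a nearby point. Continuity at a then compares the two orders.\<close>

lemma symmetric_second_derivative_real:
  fixes f :: "'v::real_normed_vector \<Rightarrow> real"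
  assumes S: "open S" "a \<in> S" and f: "Ck_on 2 S f"
  shows "frechet_derivative (\<lambda>x. frechet_derivative f (at x) u) (at a) v =
         frechet_derivative (\<lambda>x. frechet_derivative f (at x) v) (at a) u"
proof -
  define D where "D w x = frechet_derivative f (at x) w" for w x
  define D2 where "D2 w z x = frechet_derivative (D w) (at x) z" for w z x
  have f1: "f differentiable (at x)" and f2: "D w differentiable (at x)" if "x \<in> S" for x w
    using f that unfolding D_def[abs_def] numeral_2_eq_2 by auto
  have cont: "continuous_on S (D2 w z)" for w z
    using f unfolding D2_def[abs_def] D_def[abs_def] numeral_2_eq_2 by auto
  have line: "((\<lambda>r. f (c + r *\<^sub>R w)) has_real_derivative D w (c + r *\<^sub>R w)) (at r)"
    if "c + r *\<^sub>R w \<in> S" for c w r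
  proof -
    have "((\<lambda>r. f (c + r *\<^sub>R w)) has_derivative (\<lambda>h. frechet_derivative f (at (c + r *\<^sub>R w)) (h *\<^sub>R w))) (at r)"
      by (rule has_derivative_compose[of "\<lambda>r. c + r *\<^sub>R w", OF _ f1[OF that, unfolded frechet_derivative_works]])
        (auto intro!: derivative_eq_intros)
    then show ?thesis
      using linear_cmul[OF linear_frechet_derivative[OF f1[OF that]]]
      by (simp add: has_field_derivative_def D_def mult_commute_abs)
  qed
  have line2: "((\<lambda>r. D z (c + r *\<^sub>R w)) has_real_derivative D2 z w (c + r *\<^sub>R w)) (at r)"
    if "c + r *\<^sub>R w \<in> S" for c w z r
  proof -
    have "((\<lambda>r. D z (c + r *\<^sub>R w)) has_derivative (\<lambda>h. frechet_derivative (D z) (at (c + r *\<^sub>R w)) (h *\<^sub>R w))) (at r)"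
      by (rule has_derivative_compose[of "\<lambda>r. c + r *\<^sub>R w", OF _ f2[OF that, unfolded frechet_derivative_works]])
        (auto intro!: derivative_eq_intros)
    then show ?thesis
      using linear_cmul[OF linear_frechet_derivative[OF f2[OF that]]]
      by (simp add: has_field_derivative_def D2_def mult_commute_abs)
  qed
  obtain d where d: "d > 0" "ball a d \<subseteq> S"
    using S open_contains_ball by blast
  \<comment> \<open>The parallelogram scaled by s lies in the ball of radius \<open>s * K\<close>;
    the summand 1 keeps K positive when u = v = 0 and makes the estimate strict.\<close>
  define K where "K = norm u + norm v + 1"
  have K: "K > 0" by (simp add: K_def add_nonneg_pos)
  have inball: "a + p *\<^sub>R w + q *\<^sub>R z \<in> ball a (s * K)"
    if "0 \<le> p" "p \<le> s" "0 \<le> q" "q \<le> s" "0 < s" "{w, z} = {u, v}" for p q s w z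
  proof -
    have "norm (p *\<^sub>R w + q *\<^sub>R z) \<le> p * norm w + q * norm z"
      using that norm_triangle_ineq[of "p *\<^sub>R w" "q *\<^sub>R z"] by simp
    also have "\<dots> \<le> s * norm w + s * norm z"
      using that by (intro add_mono mult_right_mono) auto
    also have "\<dots> = s * (norm u + norm v)"
      using that(6) by (auto simp: doubleton_eq_iff algebra_simps)
    also have "\<dots> < s * K"
      using that by (simp add: K_def)
    finally show ?thesis
      by (metis add.assoc add_diff_cancel_left' dist_commute dist_norm mem_ball)
  qed
  \<comment> \<open>The condition \<open>{w, z} = {u, v}\<close> covers both orders of
    differentiation with one argument.\<close>
  have mvt: "\<exists>x\<in>ball a (s * K). f (a + s *\<^sub>R w + s *\<^sub>R z) - f (a + s *\<^sub>R w) - f (a + s *\<^sub>R z) + f a = s * s * D2 w z x"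
    if s: "0 < s" "s * K \<le> d" and wz: "{w, z} = {u, v}" for s w z
  proof -
    have in': "a + p *\<^sub>R w + q *\<^sub>R z \<in> S" if "0 \<le> p" "p \<le> s" "0 \<le> q" "q \<le> s" for p q
      using inball[OF that s(1) wz] s d by (auto simp: subset_iff)
    have in1: "a + p *\<^sub>R w \<in> S" if "0 \<le> p" "p \<le> s" for p
      using in'[of p 0] that s by simp
    let ?\<phi> = "\<lambda>r. f (a + s *\<^sub>R z + r *\<^sub>R w) - f (a + r *\<^sub>R w)"
    have sw: "a + q *\<^sub>R z + p *\<^sub>R w = a + p *\<^sub>R w + q *\<^sub>R z" for p q
      by (simp add: algebra_simps)
    have "(?\<phi> has_real_derivative D w (a + s *\<^sub>R z + r *\<^sub>R w) - D w (a + r *\<^sub>R w)) (at r)"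
      if "0 \<le> r" "r \<le> s" for r
      using that s in'[of r s] in1[of r] by (intro DERIV_diff line) (auto simp: sw)
    from MVT2[OF s(1), of ?\<phi>, OF this] obtain r where r: "0 < r" "r < s"
      "?\<phi> s - ?\<phi> 0 = (s - 0) * (D w (a + s *\<^sub>R z + r *\<^sub>R w) - D w (a + r *\<^sub>R w))" by blast
    have "((\<lambda>q. D w (a + r *\<^sub>R w + q *\<^sub>R z)) has_real_derivative D2 w z (a + r *\<^sub>R w + q *\<^sub>R z)) (at q)"
      if "0 \<le> q" "q \<le> s" for q
      using that r in'[of r q] by (intro line2) auto
    from MVT2[OF s(1), of "\<lambda>q. D w (a + r *\<^sub>R w + q *\<^sub>R z)", OF this] obtain q where q: "0 < q" "q < s"
      "D w (a + r *\<^sub>R w + s *\<^sub>R z) - D w (a + r *\<^sub>R w) = s * D2 w z (a + r *\<^sub>R w + q *\<^sub>R z)" by auto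
    show ?thesis
    proof
      show "a + r *\<^sub>R w + q *\<^sub>R z \<in> ball a (s * K)"
        using inball[of r s q w z] r q s wz by auto
      show "f (a + s *\<^sub>R w + s *\<^sub>R z) - f (a + s *\<^sub>R w) - f (a + s *\<^sub>R z) + f a =
          s * s * D2 w z (a + r *\<^sub>R w + q *\<^sub>R z)"
        using r(3) q(3) by (simp add: sw mult.assoc)
    qed
  qed
  have "\<bar>D2 u v a - D2 v u a\<bar> < e" if e: "e > 0" for e
  proof -
    have "\<exists>r>0. \<forall>x\<in>S. dist x a < r \<longrightarrow> dist (D2 w z x) (D2 w z a) < e / 2" for w z
      using cont[of w z] S(2) e unfolding continuous_on_iff by (meson half_gt_zero)
    then obtain r1 r2 where r: "r1 > 0" "r2 > 0"
      "\<And>x. x \<in> S \<Longrightarrow> dist x a < r1 \<Longrightarrow> dist (D2 u v x) (D2 u v a) < e / 2"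
      "\<And>x. x \<in> S \<Longrightarrow> dist x a < r2 \<Longrightarrow> dist (D2 v u x) (D2 v u a) < e / 2"
      by metis
    define s where "s = min d (min r1 r2) / K"
    have s: "0 < s" "s * K \<le> d" "s * K \<le> r1" "s * K \<le> r2"
      using d r K by (auto simp: s_def)
    obtain x y where xy: "x \<in> ball a (s * K)" "y \<in> ball a (s * K)"
      "f (a + s *\<^sub>R u + s *\<^sub>R v) - f (a + s *\<^sub>R u) - f (a + s *\<^sub>R v) + f a = s * s * D2 u v x"
      "f (a + s *\<^sub>R v + s *\<^sub>R u) - f (a + s *\<^sub>R v) - f (a + s *\<^sub>R u) + f a = s * s * D2 v u y"
      using mvt[OF s(1,2), of u v] mvt[OF s(1,2), of v u] by (auto simp: insert_commute)
    have "s * s * D2 u v x = s * s * D2 v u y"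
      unfolding xy(3)[symmetric] xy(4)[symmetric] by (simp add: algebra_simps)
    then have "D2 u v x = D2 v u y" using s by simp
    moreover have "dist x a < r1" "dist y a < r2" "x \<in> S" "y \<in> S"
      using xy(1,2) s d(2) by (auto simp: dist_commute subset_iff)
    then have "dist (D2 u v x) (D2 u v a) < e / 2" "dist (D2 v u y) (D2 v u a) < e / 2"
      using r(3,4) by blast+
    ultimately show ?thesis
      unfolding dist_real_def by linarith
  qed
  then have "D2 u v a = D2 v u a"
    by (metis abs_0_eq less_irrefl zero_less_abs_iff right_minus_eq)
  then show ?thesis unfolding D2_def D_def[abs_def] .
qed

text \<open>Taken componentwise, because the mean value theorem gives no common intermediate point
  for several components.\<close>

lemma symmetric_second_derivative:
  fixes f :: "'v::real_normed_vector \<Rightarrow> 'w::euclidean_space"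
  assumes S: "open S" "a \<in> S" and f: "Ck_on 2 S f"
  shows "frechet_derivative (\<lambda>x. frechet_derivative f (at x) u) (at a) v =
         frechet_derivative (\<lambda>x. frechet_derivative f (at x) v) (at a) u"
proof (rule euclidean_eqI)
  fix b :: 'w assume "b \<in> Basis"
  have f1: "f differentiable (at x)" and f2: "(\<lambda>x. frechet_derivative f (at x) w) differentiable (at x)"
    if "x \<in> S" for x w
    using f that by (auto simp: numeral_2_eq_2)
  have 1: "frechet_derivative (\<lambda>x. f x \<bullet> b) (at x) w = frechet_derivative f (at x) w \<bullet> b" if "x \<in> S" for x w
    using bounded_linear.has_derivative[OF bounded_linear_inner_left[of b] f1[OF that, unfolded frechet_derivative_works]]
    by (metis frechet_derivative_at)
  have 2: "frechet_derivative (\<lambda>x. frechet_derivative (\<lambda>x. f x \<bullet> b) (at x) w) (at a) z =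
      frechet_derivative (\<lambda>x. frechet_derivative f (at x) w) (at a) z \<bullet> b" for w z
  proof -
    have "frechet_derivative (\<lambda>x. frechet_derivative (\<lambda>x. f x \<bullet> b) (at x) w) (at a) =
        frechet_derivative (\<lambda>x. frechet_derivative f (at x) w \<bullet> b) (at a)"
      by (rule frechet_derivative_cong_open[OF S]) (rule 1)
    then show ?thesis
      using bounded_linear.has_derivative[OF bounded_linear_inner_left[of b] f2[OF S(2), unfolded frechet_derivative_works]]
      by (metis frechet_derivative_at)
  qed
  have "Ck_on 2 S (\<lambda>x. f x \<bullet> b)"
    by (rule Ck_on_bounded_linear[OF bounded_linear_inner_left S(1) f])
  from symmetric_second_derivative_real[OF S this, of u v]
  show "frechet_derivative (\<lambda>x. frechet_derivative f (at x) u) (at a) v \<bullet> b =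
      frechet_derivative (\<lambda>x. frechet_derivative f (at x) v) (at a) u \<bullet> b"
    by (simp add: 2)
qed


section \<open>Smooth maps\<close>

lemma smooth_on_cong: "open S \<Longrightarrow> (\<And>x. x \<in> S \<Longrightarrow> f x = g x) \<Longrightarrow> smooth_on S f \<Longrightarrow> smooth_on S g"
  unfolding smooth_on_def using Ck_on_cong by blast

lemma smooth_on_subset: "smooth_on S f \<Longrightarrow> T \<subseteq> S \<Longrightarrow> smooth_on T f"
  unfolding smooth_on_def using Ck_on_subset by blast

lemma smooth_on_local: "(\<And>x. x \<in> S \<Longrightarrow> \<exists>T. open T \<and> x \<in> T \<and> smooth_on T f) \<Longrightarrow> smooth_on S f"
  unfolding smooth_on_def by (metis Ck_on_local)

lemma smooth_on_const: "smooth_on S (\<lambda>x. c)"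
  by (simp add: smooth_on_def Ck_on_const)

lemma smooth_on_bounded_linear:
  "bounded_linear L \<Longrightarrow> open S \<Longrightarrow> smooth_on S f \<Longrightarrow> smooth_on S (\<lambda>x. L (f x))"
  by (simp add: smooth_on_def Ck_on_bounded_linear)

lemma smooth_on_add:
  "open S \<Longrightarrow> smooth_on S f \<Longrightarrow> smooth_on S g \<Longrightarrow> smooth_on S (\<lambda>x. f x + g x)"
  by (simp add: smooth_on_def Ck_on_add)

lemma smooth_on_bounded_bilinear:
  "bounded_bilinear B \<Longrightarrow> open S \<Longrightarrow> smooth_on S f \<Longrightarrow> smooth_on S g \<Longrightarrow> smooth_on S (\<lambda>x. B (f x) (g x))"
  by (simp add: smooth_on_def Ck_on_bounded_bilinear)

lemma smooth_on_inverse: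
  fixes f :: "'v::real_normed_vector \<Rightarrow> real"
  shows "open S \<Longrightarrow> smooth_on S f \<Longrightarrow> (\<And>x. x \<in> S \<Longrightarrow> f x \<noteq> 0) \<Longrightarrow> smooth_on S (\<lambda>x. inverse (f x))"
  by (simp add: smooth_on_def Ck_on_inverse)

lemma smooth_on_compose:
  fixes f :: "'v::euclidean_space \<Rightarrow> 'w::real_normed_vector" and g :: "'u::real_normed_vector \<Rightarrow> 'v"
  shows "open S \<Longrightarrow> open T \<Longrightarrow> g ` S \<subseteq> T \<Longrightarrow> smooth_on S g \<Longrightarrow> smooth_on T f \<Longrightarrow> smooth_on S (\<lambda>x. f (g x))"
  unfolding smooth_on_def using Ck_on_compose by blast

lemma smooth_on_frechet_derivative:
  fixes f :: "'v::euclidean_space \<Rightarrow> 'w::real_normed_vector"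
  shows "open S \<Longrightarrow> smooth_on S f \<Longrightarrow> smooth_on S u \<Longrightarrow>
    smooth_on S (\<lambda>x. frechet_derivative f (at x) (u x))"
  unfolding smooth_on_def using Ck_on_frechet_derivative by blast

lemma smooth_on_differentiable: "smooth_on S f \<Longrightarrow> x \<in> S \<Longrightarrow> f differentiable (at x)"
  unfolding smooth_on_def by (metis Ck_on.simps(2))

lemma smooth_on_deriv:
  fixes f :: "real \<Rightarrow> real"
  assumes "smooth_on UNIV f"
  shows "smooth_on UNIV (deriv f)"
proof (rule smooth_on_cong[OF open_UNIV])
  show "smooth_on UNIV (\<lambda>x. frechet_derivative f (at x) 1)"
    by (rule smooth_on_frechet_derivative[OF open_UNIV assms smooth_on_const])
  show "frechet_derivative f (at x) 1 = deriv f x" for x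
    using smooth_on_differentiable[OF assms, of x]
    by (metis DERIV_deriv_iff_real_differentiable UNIV_I frechet_derivative_at
        has_field_derivative_def mult.right_neutral)
qed

text \<open>The coordinate form of X(Y F) - Y(X F) = [X, Y] F: each iterated derivative is a Hessian
  term (\<open>H\<close>) plus the derivative of F along the derivative of the field, and the
  Hessian terms cancel by symmetry.\<close>

lemma frechet_derivative_along_field_commute:
  fixes F :: "'v::euclidean_space \<Rightarrow> 'w::euclidean_space"
  assumes S: "open S" "a \<in> S" and F: "smooth_on S F" and X: "smooth_on S X" and Y: "smooth_on S Y"
  shows "frechet_derivative (\<lambda>y. frechet_derivative F (at y) (Y y)) (at a) (X a)
       - frechet_derivative (\<lambda>y. frechet_derivative F (at y) (X y)) (at a) (Y a)
       = frechet_derivative F (at a)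
           (frechet_derivative Y (at a) (X a) - frechet_derivative X (at a) (Y a))"
proof -
  define H where "H b v = frechet_derivative (\<lambda>y. frechet_derivative F (at y) b) (at a) v" for b v
  have F1: "F differentiable (at y)" if "y \<in> S" for y
    using smooth_on_differentiable[OF F that] .
  have linF: "linear (frechet_derivative F (at a))"
    by (rule linear_frechet_derivative[OF F1[OF S(2)]])
  have smF: "smooth_on S (\<lambda>y. frechet_derivative F (at y) b)" for b
    by (rule smooth_on_frechet_derivative[OF S(1) F smooth_on_const])
  have H: "((\<lambda>y. frechet_derivative F (at y) b) has_derivative H b) (at a)" for b
    unfolding H_def using smooth_on_differentiable[OF smF S(2)] frechet_derivative_works by blast
  have sym: "H b c = H c b" for b c
    unfolding H_def using F symmetric_second_derivative[OF S, of F b c] by (auto simp: smooth_on_def)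
  have linH: "linear (H b)" for b
    using H has_derivative_linear by blast
  have second: "frechet_derivative (\<lambda>y. frechet_derivative F (at y) (Z y)) (at a) v
      = (\<Sum>b\<in>Basis. (Z a \<bullet> b) *\<^sub>R H b v) + frechet_derivative F (at a) (frechet_derivative Z (at a) v)"
    if Z: "smooth_on S Z" for Z v
  proof -
    have Zd: "(Z has_derivative frechet_derivative Z (at a)) (at a)"
      using smooth_on_differentiable[OF Z S(2)] frechet_derivative_works by blast
    have "((\<lambda>y. \<Sum>b\<in>Basis. (Z y \<bullet> b) *\<^sub>R frechet_derivative F (at y) b) has_derivative
       (\<lambda>v. \<Sum>b\<in>Basis. (Z a \<bullet> b) *\<^sub>R H b v + (frechet_derivative Z (at a) v \<bullet> b) *\<^sub>R frechet_derivative F (at a) b)) (at a)"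
      by (intro has_derivative_sum has_derivative_scaleR H has_derivative_inner_left Zd)
    moreover have "frechet_derivative (\<lambda>y. frechet_derivative F (at y) (Z y)) (at a) =
        frechet_derivative (\<lambda>y. \<Sum>b\<in>Basis. (Z y \<bullet> b) *\<^sub>R frechet_derivative F (at y) b) (at a)"
      by (rule frechet_derivative_cong_open[OF S]) (rule frechet_derivative_expand_Basis[OF F1])
    ultimately show ?thesis
      using linear_expand_Basis[OF linF, of "frechet_derivative Z (at a) v"]
      by (simp add: frechet_derivative_at[symmetric] sum.distrib)
  qed
  have "(\<Sum>b\<in>Basis. (Y a \<bullet> b) *\<^sub>R H b (X a)) = (\<Sum>b\<in>Basis. \<Sum>c\<in>Basis. (Y a \<bullet> b) *\<^sub>R (X a \<bullet> c) *\<^sub>R H b c)"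
    by (subst linear_expand_Basis[OF linH]) (simp add: scaleR_sum_right)
  also have "\<dots> = (\<Sum>c\<in>Basis. \<Sum>b\<in>Basis. (X a \<bullet> c) *\<^sub>R (Y a \<bullet> b) *\<^sub>R H c b)"
    by (subst sum.swap) (intro sum.cong refl, simp add: sym mult.commute)
  also have "\<dots> = (\<Sum>c\<in>Basis. (X a \<bullet> c) *\<^sub>R H c (Y a))"
    by (subst (2) linear_expand_Basis[OF linH]) (simp add: scaleR_sum_right)
  finally show ?thesis
    by (simp add: second X Y linear_diff[OF linF])
qed


section \<open>Calculus on a manifold\<close>

locale smooth_manifold =
  fixes A :: "('a::{t2_space,second_countable_topology}, 'm::finite) chart set"
  assumes atlas: "smooth_atlas A"
begin

section \<open>Charts and smooth functions\<close>

lemma chart_at: "chart_at A p \<in> A" "p \<in> fst (chart_at A p)"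
proof -
  have "p \<in> (\<Union>c\<in>A. fst c)"
    using atlas unfolding smooth_atlas_def by simp
  then have "\<exists>c. c \<in> A \<and> p \<in> fst c" by auto
  from someI_ex[OF this] show "chart_at A p \<in> A" "p \<in> fst (chart_at A p)"
    unfolding chart_at_def by simp_all
qed

lemma chart_homeomorphism: "c \<in> A \<Longrightarrow> homeomorphism (fst c) (snd c ` fst c) (snd c) (chart_inv c)"
  using atlas unfolding smooth_atlas_def by blast

lemma chart_open: "c \<in> A \<Longrightarrow> open (fst c)"
  using atlas unfolding smooth_atlas_def by blast

lemma chart_inv_chart [simp]: "c \<in> A \<Longrightarrow> p \<in> fst c \<Longrightarrow> chart_inv c (snd c p) = p"
  using chart_homeomorphism unfolding homeomorphism_def by blast

lemma chart_image_open:
  assumes "c \<in> A" "open W"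
  shows "open (snd c ` (fst c \<inter> W))"
proof -
  have "openin (top_of_set (snd c ` fst c)) (snd c ` (fst c \<inter> W))"
    by (rule homeomorphism_imp_open_map[OF chart_homeomorphism[OF assms(1)]])
      (use assms(2) in \<open>simp add: openin_open_Int\<close>)
  moreover have "open (snd c ` fst c)"
    using atlas assms(1) unfolding smooth_atlas_def by blast
  ultimately show ?thesis using openin_open_eq by blast
qed

lemma chart_image_open_subset: "c \<in> A \<Longrightarrow> open W \<Longrightarrow> W \<subseteq> fst c \<Longrightarrow> open (snd c ` W)"
  using chart_image_open[of c W] by (simp add: Int_absorb1)

lemma transition_smooth:
  "c \<in> A \<Longrightarrow> d \<in> A \<Longrightarrow> smooth_on (snd c ` (fst c \<inter> fst d)) (snd d \<circ> chart_inv c)"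
  using atlas unfolding smooth_atlas_def by blast

lemma msmooth_subset: "msmooth A W F \<Longrightarrow> V \<subseteq> W \<Longrightarrow> msmooth A V F"
  unfolding msmooth_def using smooth_on_subset[OF _ image_mono[OF Int_mono[OF order_refl]]] by blast

lemma smooth_on_chart:
  "msmooth A W F \<Longrightarrow> c \<in> A \<Longrightarrow> W \<subseteq> fst c \<Longrightarrow> smooth_on (snd c ` W) (\<lambda>x. F (chart_inv c x))"
  unfolding msmooth_def o_def using Int_absorb1 by fastforce

lemma msmooth_local:
  assumes "\<And>p. p \<in> W \<Longrightarrow> \<exists>V. open V \<and> p \<in> V \<and> msmooth A V F"
  shows "msmooth A W F"
  unfolding msmooth_def
proof (intro ballI smooth_on_local)
  fix c x assume c: "c \<in> A" and "x \<in> snd c ` (fst c \<inter> W)"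
  then obtain p where p: "p \<in> fst c" "p \<in> W" "x = snd c p" by blast
  from assms[OF p(2)] obtain V where V: "open V" "p \<in> V" "msmooth A V F" by blast
  then show "\<exists>T. open T \<and> x \<in> T \<and> smooth_on T (F \<circ> chart_inv c)"
    using chart_image_open[OF c V(1)] c p unfolding msmooth_def by blast
qed

text \<open>In any other chart the map is its representation in c composed with a smooth transition
  map.\<close>

lemma msmooth_in_chart:
  assumes c: "c \<in> A" and W: "open W" "W \<subseteq> fst c" and F: "smooth_on (snd c ` W) (\<lambda>x. F (chart_inv c x))"
  shows "msmooth A W F"
  unfolding msmooth_def
proof
  fix d assume d: "d \<in> A"
  let ?g = "\<lambda>x. snd c (chart_inv d x)"
  have S: "open (snd d ` (fst d \<inter> W))"
    by (rule chart_image_open[OF d W(1)])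
  have "smooth_on (snd d ` (fst d \<inter> W)) (\<lambda>x. F (chart_inv c (?g x)))"
  proof (rule smooth_on_compose[OF S chart_image_open_subset[OF c W] _ _ F])
    show "?g ` snd d ` (fst d \<inter> W) \<subseteq> snd c ` W"
      using d by auto
    show "smooth_on (snd d ` (fst d \<inter> W)) ?g"
      using smooth_on_subset[OF transition_smooth[OF d c], of "snd d ` (fst d \<inter> W)"] W
      by (auto simp: o_def)
  qed
  then show "smooth_on (snd d ` (fst d \<inter> W)) (F \<circ> chart_inv d)"
    by (rule smooth_on_cong[OF S, rotated]) (use c d W in auto)
qed

lemma msmooth_cong:
  assumes "open W" "\<And>p. p \<in> W \<Longrightarrow> F p = G p" "msmooth A W F"
  shows "msmooth A W G"
  unfolding msmooth_def
proof
  fix c assume c: "c \<in> A"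
  show "smooth_on (snd c ` (fst c \<inter> W)) (G \<circ> chart_inv c)"
  proof (rule smooth_on_cong[OF chart_image_open[OF c assms(1)]])
    show "smooth_on (snd c ` (fst c \<inter> W)) (F \<circ> chart_inv c)"
      using assms(3) c unfolding msmooth_def by blast
    show "(F \<circ> chart_inv c) x = (G \<circ> chart_inv c) x" if "x \<in> snd c ` (fst c \<inter> W)" for x
      using that c assms(2) by auto
  qed
qed

lemma msmooth_const: "msmooth A W (\<lambda>p. k)"
  unfolding msmooth_def by (simp add: o_def smooth_on_const)

lemma msmooth_bounded_linear:
  "bounded_linear L \<Longrightarrow> open W \<Longrightarrow> msmooth A W F \<Longrightarrow> msmooth A W (\<lambda>p. L (F p))"
  unfolding msmooth_def o_def using smooth_on_bounded_linear chart_image_open by blast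

lemma msmooth_add:
  "open W \<Longrightarrow> msmooth A W F \<Longrightarrow> msmooth A W G \<Longrightarrow> msmooth A W (\<lambda>p. F p + G p)"
  unfolding msmooth_def o_def by (simp add: smooth_on_add chart_image_open)

lemma msmooth_bounded_bilinear:
  "bounded_bilinear B \<Longrightarrow> open W \<Longrightarrow> msmooth A W F \<Longrightarrow> msmooth A W G \<Longrightarrow> msmooth A W (\<lambda>p. B (F p) (G p))"
  unfolding msmooth_def o_def using smooth_on_bounded_bilinear chart_image_open by blast

lemma msmooth_inverse:
  fixes F :: "'a \<Rightarrow> real"
  assumes "open W" "msmooth A W F" "\<And>p. p \<in> W \<Longrightarrow> F p \<noteq> 0"
  shows "msmooth A W (\<lambda>p. inverse (F p))"
  unfolding msmooth_def o_def
proof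
  fix c assume c: "c \<in> A"
  show "smooth_on (snd c ` (fst c \<inter> W)) (\<lambda>x. inverse (F (chart_inv c x)))"
    using assms(2,3) c unfolding msmooth_def o_def
    by (intro smooth_on_inverse chart_image_open[OF c assms(1)]) (auto simp del: split_paired_All)
qed

lemma msmooth_compose:
  fixes \<phi> :: "'v::euclidean_space \<Rightarrow> 'w::real_normed_vector"
  assumes "open W" "msmooth A W F" "smooth_on UNIV \<phi>"
  shows "msmooth A W (\<lambda>p. \<phi> (F p))"
  using assms smooth_on_compose[where T=UNIV, OF chart_image_open open_UNIV subset_UNIV]
  unfolding msmooth_def o_def by blast

lemmas msmooth_scaleR = msmooth_bounded_bilinear[OF bounded_bilinear_scaleR]
lemmas msmooth_mult = msmooth_bounded_bilinear[OF bounded_bilinear_mult]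

lemma msmooth_minus: "open W \<Longrightarrow> msmooth A W F \<Longrightarrow> msmooth A W (\<lambda>p. - F p)"
  by (rule msmooth_bounded_linear[OF bounded_linear_minus[OF bounded_linear_ident]])

lemma msmooth_diff:
  assumes "open W" "msmooth A W F" "msmooth A W G"
  shows "msmooth A W (\<lambda>p. F p - G p)"
  using msmooth_add[OF assms(1,2) msmooth_minus[OF assms(1,3)]] by simp

lemma msmooth_sum:
  assumes "open W" "\<And>i. i \<in> I \<Longrightarrow> msmooth A W (F i)"
  shows "msmooth A W (\<lambda>p. \<Sum>i\<in>I. F i p)"
  using assms(2)
  by (induction I rule: infinite_finite_induct) (auto intro: msmooth_add[OF assms(1)] simp: msmooth_const)

lemma msmooth_Pair:
  assumes "open W" "msmooth A W F" "msmooth A W G"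
  shows "msmooth A W (\<lambda>p. (F p, G p))"
proof -
  have "msmooth A W (\<lambda>p. (F p, 0) + (0, G p))"
    by (intro msmooth_add msmooth_bounded_linear[of "\<lambda>x. (x, 0)"] msmooth_bounded_linear[of "\<lambda>x. (0, x)"] assms)
      (auto intro!: bounded_linear_Pair bounded_linear_ident bounded_linear_zero)
  then show ?thesis by simp
qed

lemmas msmooth_fst = msmooth_bounded_linear[OF bounded_linear_fst]
lemmas msmooth_snd = msmooth_bounded_linear[OF bounded_linear_snd]

lemma msmooth_chart_map:
  assumes "c \<in> A"
  shows "msmooth A (fst c) (snd c)"
  unfolding msmooth_def using transition_smooth assms by blast

text \<open>A relational companion of \<open>mderiv\<close> in the chart chosen at p, so that
  differentiation rules can be chained by resolution and the result read off with
  \<open>mderiv_eq\<close>.\<close>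

definition has_mderiv :: "('a \<Rightarrow> 'w::real_normed_vector) \<Rightarrow> 'a \<Rightarrow> (real ^ 'm \<Rightarrow> 'w) \<Rightarrow> bool" where
  "has_mderiv F p F' \<longleftrightarrow>
     ((\<lambda>x. F (chart_inv (chart_at A p) x)) has_derivative F') (at (snd (chart_at A p) p))"

lemma mderiv_eq: "has_mderiv F p F' \<Longrightarrow> mderiv A F p = F'"
  unfolding has_mderiv_def mderiv_def Let_def o_def by (simp add: frechet_derivative_at[symmetric])

lemma differentiable_in_chart:
  assumes "open W" "p \<in> W" "msmooth A W F" "c \<in> A" "p \<in> fst c"
  shows "((\<lambda>x. F (chart_inv c x)) has_derivative frechet_derivative (\<lambda>x. F (chart_inv c x)) (at (snd c p)))
           (at (snd c p))"
proof -
  have "smooth_on (snd c ` (fst c \<inter> W)) (\<lambda>x. F (chart_inv c x))"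
    using assms unfolding msmooth_def o_def by blast
  then show ?thesis
    using smooth_on_differentiable assms unfolding frechet_derivative_works[symmetric] by blast
qed

lemma has_mderiv_mderiv:
  assumes "open W" "p \<in> W" "msmooth A W F"
  shows "has_mderiv F p (mderiv A F p)"
  using differentiable_in_chart[OF assms chart_at] unfolding has_mderiv_def mderiv_def Let_def o_def .

lemma has_mderiv_linear: "has_mderiv F p F' \<Longrightarrow> linear F'"
  unfolding has_mderiv_def using has_derivative_linear by blast

lemma linear_mderiv: "open W \<Longrightarrow> p \<in> W \<Longrightarrow> msmooth A W F \<Longrightarrow> linear (mderiv A F p)"
  using has_mderiv_linear has_mderiv_mderiv by blast

lemma has_mderiv_const: "has_mderiv (\<lambda>q. k) p (\<lambda>v. 0)"
  unfolding has_mderiv_def by simp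

lemma has_mderiv_add:
  "has_mderiv F p F' \<Longrightarrow> has_mderiv G p G' \<Longrightarrow> has_mderiv (\<lambda>q. F q + G q) p (\<lambda>v. F' v + G' v)"
  unfolding has_mderiv_def by (rule has_derivative_add)

lemma has_mderiv_diff:
  "has_mderiv F p F' \<Longrightarrow> has_mderiv G p G' \<Longrightarrow> has_mderiv (\<lambda>q. F q - G q) p (\<lambda>v. F' v - G' v)"
  unfolding has_mderiv_def by (rule has_derivative_diff)

lemma has_mderiv_bounded_linear:
  "bounded_linear L \<Longrightarrow> has_mderiv F p F' \<Longrightarrow> has_mderiv (\<lambda>q. L (F q)) p (\<lambda>v. L (F' v))"
  unfolding has_mderiv_def by (rule bounded_linear.has_derivative)

lemma has_mderiv_bounded_bilinear:
  "bounded_bilinear B \<Longrightarrow> has_mderiv F p F' \<Longrightarrow> has_mderiv G p G' \<Longrightarrow>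
     has_mderiv (\<lambda>q. B (F q) (G q)) p (\<lambda>v. B (F p) (G' v) + B (F' v) (G p))"
  unfolding has_mderiv_def
  using bounded_bilinear.FDERIV[of B "\<lambda>x. F (chart_inv (chart_at A p) x)" F' "snd (chart_at A p) p" UNIV
      "\<lambda>x. G (chart_inv (chart_at A p) x)" G'] chart_at[of p] by simp

lemma has_mderiv_compose_real:
  assumes "(\<phi> has_real_derivative \<phi>') (at (F p))" "has_mderiv F p F'"
  shows "has_mderiv (\<lambda>q. \<phi> (F q)) p (\<lambda>v. \<phi>' * F' v)"
proof -
  have "(\<phi> has_derivative (*) \<phi>') (at (F (chart_inv (chart_at A p) (snd (chart_at A p) p))))"
    using assms(1) chart_at by (simp add: has_field_derivative_def)
  then show ?thesis
    using assms(2) has_derivative_compose unfolding has_mderiv_def by blast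
qed

lemma mderiv_cong:
  assumes "open W" "p \<in> W" "\<And>q. q \<in> W \<Longrightarrow> F q = G q"
  shows "mderiv A F p = mderiv A G p"
proof -
  have "frechet_derivative (F \<circ> chart_inv (chart_at A p)) (at (snd (chart_at A p) p)) =
      frechet_derivative (G \<circ> chart_inv (chart_at A p)) (at (snd (chart_at A p) p))"
    using assms chart_at
    by (intro frechet_derivative_cong_open[OF chart_image_open[OF chart_at(1) assms(1)]]) auto
  then show ?thesis
    unfolding mderiv_def Let_def by (rule ext[OF fun_cong])
qed

lemma frechet_derivative_change_chart:
  assumes W: "open W" "p \<in> W" "msmooth A W F" and c: "c \<in> A" "p \<in> fst c" and d: "d \<in> A" "p \<in> fst d"
  shows "frechet_derivative (\<lambda>x. F (chart_inv c x)) (at (snd c p)) v =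
    frechet_derivative (\<lambda>x. F (chart_inv d x)) (at (snd d p))
      (frechet_derivative (\<lambda>x. snd d (chart_inv c x)) (at (snd c p)) v)"
proof -
  let ?S = "snd c ` (fst c \<inter> fst d)" and ?f = "\<lambda>x. F (chart_inv d x)" and ?g = "\<lambda>x. snd d (chart_inv c x)"
  have "(?f has_derivative frechet_derivative ?f (at (?g (snd c p)))) (at (?g (snd c p)))"
    using differentiable_in_chart[OF W d] c by simp
  moreover have "(?g has_derivative frechet_derivative ?g (at (snd c p))) (at (snd c p))"
    by (rule differentiable_in_chart[OF chart_open[OF d(1)] d(2) msmooth_chart_map[OF d(1)] c])
  ultimately have D: "((\<lambda>x. ?f (?g x)) has_derivative
      (\<lambda>v. frechet_derivative ?f (at (?g (snd c p))) (frechet_derivative ?g (at (snd c p)) v))) (at (snd c p))"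
    using has_derivative_compose by blast
  have "frechet_derivative (\<lambda>x. F (chart_inv c x)) (at (snd c p)) =
      frechet_derivative (\<lambda>x. ?f (?g x)) (at (snd c p))"
    using c d by (intro frechet_derivative_cong_open[OF chart_image_open[OF c(1) chart_open[OF d(1)]]]) auto
  moreover have "?g (snd c p) = snd d p" using c by simp
  ultimately show ?thesis
    using frechet_derivative_at[OF D] by metis
qed

text \<open>\<open>mderiv A (snd c) p v\<close> converts v from the components in the chart chosen
  at p to those in c.\<close>

lemma mderiv_in_chart:
  assumes "open W" "p \<in> W" "msmooth A W F" "c \<in> A" "p \<in> fst c"
  shows "mderiv A F p v = frechet_derivative (\<lambda>x. F (chart_inv c x)) (at (snd c p)) (mderiv A (snd c) p v)"
  using frechet_derivative_change_chart[OF assms(1-3) chart_at assms(4,5)]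
  unfolding mderiv_def Let_def o_def .

lemma mderiv_chart_at [simp]: "mderiv A (snd (chart_at A p)) p v = v"
proof -
  have "has_mderiv (snd (chart_at A p)) p (\<lambda>v. v)"
    unfolding has_mderiv_def
    by (rule has_derivative_transform_within_open[OF has_derivative_ident
          chart_image_open[OF chart_at(1)[of p] chart_open[OF chart_at(1)[of p]]]])
      (use chart_at[of p] in auto)
  then show ?thesis by (simp add: mderiv_eq)
qed

lemma linear_mderiv_chart: "c \<in> A \<Longrightarrow> p \<in> fst c \<Longrightarrow> linear (mderiv A (snd c) p)"
  using linear_mderiv[OF chart_open _ msmooth_chart_map] by blast

section \<open>Vector fields and their brackets\<close>

lemma vector_field_subset: "vector_field A W X \<Longrightarrow> V \<subseteq> W \<Longrightarrow> vector_field A V X"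
  unfolding vector_field_def using msmooth_subset[OF _ Int_mono[OF _ order_refl]] by blast

lemma vector_field_diff:
  assumes "open W" "vector_field A W X" "vector_field A W Y"
  shows "vector_field A W (\<lambda>p. X p - Y p)"
  unfolding vector_field_def
proof
  fix c assume c: "c \<in> A"
  have W: "open (W \<inter> fst c)" using assms(1) chart_open[OF c] by blast
  have "msmooth A (W \<inter> fst c) (\<lambda>p. mderiv A (snd c) p (X p) - mderiv A (snd c) p (Y p))"
    using assms c by (intro msmooth_diff[OF W]) (auto simp: vector_field_def)
  then show "msmooth A (W \<inter> fst c) (\<lambda>p. mderiv A (snd c) p (X p - Y p))"
    by (rule msmooth_cong[OF W, rotated]) (use c in \<open>auto simp: linear_diff[OF linear_mderiv_chart]\<close>)
qed

lemma vector_field_scaleR: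
  assumes "open W" "msmooth A W u" "vector_field A W X"
  shows "vector_field A W (\<lambda>p. u p *\<^sub>R X p)"
  unfolding vector_field_def
proof
  fix c assume c: "c \<in> A"
  have W: "open (W \<inter> fst c)" using assms(1) chart_open[OF c] by blast
  have "msmooth A (W \<inter> fst c) (\<lambda>p. u p *\<^sub>R mderiv A (snd c) p (X p))"
    using assms(3) c by (intro msmooth_scaleR[OF W] msmooth_subset[OF assms(2)]) (auto simp: vector_field_def)
  then show "msmooth A (W \<inter> fst c) (\<lambda>p. mderiv A (snd c) p (u p *\<^sub>R X p))"
    by (rule msmooth_cong[OF W, rotated]) (use c in \<open>auto simp: linear_cmul[OF linear_mderiv_chart]\<close>)
qed

text \<open>The chart used by \<open>mderiv\<close> jumps with the point, so smoothness is checked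
  in one fixed chart near p, where \<open>vector_field\<close> provides smooth components of
  X.\<close>

lemma msmooth_mderiv:
  assumes W: "open W" and F: "msmooth A W F" and X: "vector_field A W X"
  shows "msmooth A W (\<lambda>p. mderiv A F p (X p))"
proof (rule msmooth_local)
  fix p assume p: "p \<in> W"
  define c where "c = chart_at A p"
  have c: "c \<in> A" "p \<in> fst c" unfolding c_def by (rule chart_at)+
  define V where "V = W \<inter> fst c"
  have V: "open V" "V \<subseteq> fst c" "V \<subseteq> W" "p \<in> V"
    using W chart_open[OF c(1)] c p by (auto simp: V_def)
  note S = chart_image_open_subset[OF c(1) V(1,2)]
  have "smooth_on (snd c ` V) (\<lambda>x. frechet_derivative (\<lambda>x. F (chart_inv c x)) (at x)
      (mderiv A (snd c) (chart_inv c x) (X (chart_inv c x))))"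
  proof (rule smooth_on_frechet_derivative[OF S])
    show "smooth_on (snd c ` V) (\<lambda>x. F (chart_inv c x))"
      by (rule smooth_on_chart[OF msmooth_subset[OF F V(3)] c(1) V(2)])
    have "msmooth A V (\<lambda>p. mderiv A (snd c) p (X p))"
      using X c unfolding vector_field_def V_def by blast
    from smooth_on_chart[OF this c(1) V(2)]
    show "smooth_on (snd c ` V) (\<lambda>x. mderiv A (snd c) (chart_inv c x) (X (chart_inv c x)))" .
  qed
  then have "smooth_on (snd c ` V) (\<lambda>x. mderiv A F (chart_inv c x) (X (chart_inv c x)))"
  proof (rule smooth_on_cong[OF S, rotated])
    fix x assume "x \<in> snd c ` V"
    then obtain q where q: "q \<in> V" "x = snd c q" by blast
    then have "q \<in> W" "q \<in> fst c" using V(2,3) by blast+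
    then show "frechet_derivative (\<lambda>x. F (chart_inv c x)) (at x)
        (mderiv A (snd c) (chart_inv c x) (X (chart_inv c x))) = mderiv A F (chart_inv c x) (X (chart_inv c x))"
      unfolding q(2) chart_inv_chart[OF c(1) \<open>q \<in> fst c\<close>]
      using mderiv_in_chart[OF W _ F c(1), of q "X q"] by metis
  qed
  then have "msmooth A V (\<lambda>p. mderiv A F p (X p))"
    by (rule msmooth_in_chart[OF c(1) V(1,2)])
  then show "\<exists>V. open V \<and> p \<in> V \<and> msmooth A V (\<lambda>p. mderiv A F p (X p))"
    using V(1,4) by blast
qed

text \<open>Everything is moved to the chart c chosen at p, which is also the one in
  \<open>lie_bracket\<close>. \<open>comp Z\<close> is the coordinate expression of Z in c, and at p
  it is Z p itself; the identity is then
  \<open>frechet_derivative_along_field_commute\<close>.\<close>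

lemma mderiv_commutator:
  fixes F :: "'a \<Rightarrow> 'w::euclidean_space"
  assumes W: "open W" "p \<in> W" and F: "msmooth A W F" and X: "vector_field A W X" and Y: "vector_field A W Y"
  shows "mderiv A (\<lambda>q. mderiv A F q (Y q)) p (X p) - mderiv A (\<lambda>q. mderiv A F q (X q)) p (Y p) =
    mderiv A F p (lie_bracket A X Y p)"
proof -
  define c where "c = chart_at A p"
  have c: "c \<in> A" "p \<in> fst c" unfolding c_def by (rule chart_at)+
  define V where "V = W \<inter> fst c"
  have V: "open V" "V \<subseteq> fst c" "V \<subseteq> W" "p \<in> V"
    using W chart_open[OF c(1)] c by (auto simp: V_def)
  note S = chart_image_open_subset[OF c(1) V(1,2)]
  let ?G = "\<lambda>x. F (chart_inv c x)" and ?a = "snd c p"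
  define comp where "comp Z x = mderiv A (snd c) (chart_inv c x) (Z (chart_inv c x))" for Z x
  have comp: "smooth_on (snd c ` V) (comp Z)" if "vector_field A W Z" for Z
  proof -
    have "msmooth A V (\<lambda>p. mderiv A (snd c) p (Z p))"
      using that c unfolding vector_field_def V_def by blast
    from smooth_on_chart[OF this c(1) V(2)] show ?thesis by (simp add: comp_def[abs_def])
  qed
  have comp_p: "comp Z ?a = Z p" for Z
    using c by (simp add: comp_def c_def)
  have 1: "mderiv A (\<lambda>q. mderiv A F q (Z q)) p v =
      frechet_derivative (\<lambda>x. frechet_derivative ?G (at x) (comp Z x)) (at ?a) v" for Z v
  proof -
    have "frechet_derivative (\<lambda>x. mderiv A F (chart_inv c x) (Z (chart_inv c x))) (at ?a) =
        frechet_derivative (\<lambda>x. frechet_derivative ?G (at x) (comp Z x)) (at ?a)"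
    proof (rule frechet_derivative_cong_open[OF S])
      show "?a \<in> snd c ` V" using V(4) by blast
      fix x assume "x \<in> snd c ` V"
      then obtain q where q: "q \<in> V" "x = snd c q" by blast
      then have "q \<in> W" "q \<in> fst c" using V(2,3) by blast+
      then show "mderiv A F (chart_inv c x) (Z (chart_inv c x)) = frechet_derivative ?G (at x) (comp Z x)"
        unfolding q(2) comp_def chart_inv_chart[OF c(1) \<open>q \<in> fst c\<close>]
        using mderiv_in_chart[OF W(1) _ F c(1), of q "Z q"] by metis
    qed
    then show ?thesis unfolding mderiv_def[of A "\<lambda>q. mderiv A F q (Z q)"] Let_def o_def
      unfolding c_def by metis
  qed
  have 2: "mderiv A (\<lambda>q. mderiv A (snd c) q (Z q)) p v = frechet_derivative (comp Z) (at ?a) v" for Z v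
    unfolding mderiv_def[of A "\<lambda>q. mderiv A (snd c) q (Z q)"] Let_def o_def comp_def[abs_def]
    unfolding c_def ..
  have "mderiv A F p (lie_bracket A X Y p) = frechet_derivative ?G (at ?a) (lie_bracket A X Y p)"
    unfolding mderiv_def[of A F] Let_def o_def
    unfolding c_def ..
  moreover have "lie_bracket A X Y p = frechet_derivative (comp Y) (at ?a) (comp X ?a)
      - frechet_derivative (comp X) (at ?a) (comp Y ?a)"
    unfolding lie_bracket_def Let_def comp_p using 2 by (simp add: c_def)
  moreover have "mderiv A (\<lambda>q. mderiv A F q (Y q)) p (X p) - mderiv A (\<lambda>q. mderiv A F q (X q)) p (Y p) =
     frechet_derivative (\<lambda>x. frechet_derivative ?G (at x) (comp Y x)) (at ?a) (comp X ?a)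
     - frechet_derivative (\<lambda>x. frechet_derivative ?G (at x) (comp X x)) (at ?a) (comp Y ?a)"
    by (simp only: 1 comp_p)
  moreover have "smooth_on (snd c ` V) ?G"
    by (rule smooth_on_chart[OF msmooth_subset[OF F V(3)] c(1) V(2)])
  ultimately show ?thesis
    using frechet_derivative_along_field_commute[OF S _ _ comp[OF X] comp[OF Y], of ?a ?G] V(4) by (metis imageI)
qed

lemma local_extension_at [simp]: "local_extension A p w p = w"
  unfolding local_extension_def Let_def using mderiv_chart_at[of p w] unfolding mderiv_def Let_def .

text \<open>The change of chart built into \<open>local_extension\<close> undoes the one that
  \<open>mderiv\<close> makes at q.\<close>

lemma mderiv_local_extension:
  assumes "open W" "q \<in> W" "msmooth A W F" "q \<in> fst (chart_at A p)"
  shows "mderiv A F q (local_extension A p w q) =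
    frechet_derivative (\<lambda>x. F (chart_inv (chart_at A p) x)) (at (snd (chart_at A p) q)) w"
  using frechet_derivative_change_chart[OF assms(1-3) chart_at(1) assms(4) chart_at, of w]
  unfolding mderiv_def local_extension_def Let_def o_def by simp

lemma vector_field_local_extension: "vector_field A (fst (chart_at A p)) (local_extension A p w)"
  unfolding vector_field_def
proof
  fix c assume c: "c \<in> A"
  define d where "d = chart_at A p"
  have d: "d \<in> A" "p \<in> fst d" unfolding d_def by (rule chart_at)+
  have V: "open (fst d \<inter> fst c)" "fst d \<inter> fst c \<subseteq> fst d"
    using chart_open[OF c] chart_open[OF d(1)] by auto
  note S = chart_image_open_subset[OF d(1) V]
  have "smooth_on (snd d ` (fst d \<inter> fst c))
      (\<lambda>x. frechet_derivative (\<lambda>x. snd c (chart_inv d x)) (at x) w)"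
    by (rule smooth_on_frechet_derivative[OF S _ smooth_on_const])
      (use transition_smooth[OF d(1) c] in \<open>simp add: o_def\<close>)
  then have "smooth_on (snd d ` (fst d \<inter> fst c))
      (\<lambda>x. mderiv A (snd c) (chart_inv d x) (local_extension A p w (chart_inv d x)))"
  proof (rule smooth_on_cong[OF S, rotated])
    fix x assume "x \<in> snd d ` (fst d \<inter> fst c)"
    then obtain q where q: "q \<in> fst d" "q \<in> fst c" "x = snd d q" by blast
    then show "frechet_derivative (\<lambda>x. snd c (chart_inv d x)) (at x) w =
        mderiv A (snd c) (chart_inv d x) (local_extension A p w (chart_inv d x))"
      using mderiv_local_extension[OF chart_open[OF c] q(2) msmooth_chart_map[OF c], of p w] d
      by (simp add: d_def)
  qed
  then have "msmooth A (fst d \<inter> fst c) (\<lambda>q. mderiv A (snd c) q (local_extension A p w q))"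
    by (rule msmooth_in_chart[OF d(1) V])
  then show "msmooth A (fst (chart_at A p) \<inter> fst c) (\<lambda>q. mderiv A (snd c) q (local_extension A p w q))"
    by (simp add: d_def)
qed

end


section \<open>Gram--Schmidt for families of sections\<close>

text \<open>\<open>S\<close> plays the role of a module of smooth sections over \<open>W\<close>.\<close>

lemma gram_schmidt_family:
  fixes \<beta> :: "'a \<Rightarrow> 'v::real_vector \<Rightarrow> 'v \<Rightarrow> real" and V :: "'i \<Rightarrow> 'a \<Rightarrow> 'v"
  assumes fin: "finite I" and V: "\<And>i. i \<in> I \<Longrightarrow> V i \<in> S"
    and lin: "\<And>q y. q \<in> W \<Longrightarrow> linear (\<lambda>x. \<beta> q x y)" and sym: "\<And>q x y. q \<in> W \<Longrightarrow> \<beta> q x y = \<beta> q y x"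
    and pos: "\<And>U q. U \<in> S \<Longrightarrow> q \<in> W \<Longrightarrow> U q \<noteq> 0 \<Longrightarrow> \<beta> q (U q) (U q) > 0"
    and diff: "\<And>X Y. X \<in> S \<Longrightarrow> Y \<in> S \<Longrightarrow> (\<lambda>q. X q - Y q) \<in> S"
    and proj: "\<And>X U. X \<in> S \<Longrightarrow> U \<in> S \<Longrightarrow> (\<And>q. q \<in> W \<Longrightarrow> U q \<noteq> 0) \<Longrightarrow>
      (\<lambda>q. (\<beta> q (X q) (U q) / \<beta> q (U q) (U q)) *\<^sub>R U q) \<in> S"
    and indep: "\<And>q. q \<in> W \<Longrightarrow> inj_on (\<lambda>i. V i q) I \<and> independent ((\<lambda>i. V i q) ` I)"
  shows "\<exists>U. (\<forall>i\<in>I. U i \<in> S) \<and> (\<forall>i\<in>I. \<forall>q\<in>W. U i q \<noteq> 0) \<and>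
    (\<forall>i\<in>I. \<forall>j\<in>I. i \<noteq> j \<longrightarrow> (\<forall>q\<in>W. \<beta> q (U i q) (U j q) = 0)) \<and>
    (\<forall>q\<in>W. span ((\<lambda>i. U i q) ` I) = span ((\<lambda>i. V i q) ` I))"
  using fin V indep
proof (induction I rule: finite_induct)
  case empty
  then show ?case by simp
next
  case (insert k F)
  have indepF: "inj_on (\<lambda>i. V i q) F" "independent ((\<lambda>i. V i q) ` F)"
    "V k q \<notin> span ((\<lambda>i. V i q) ` F)" if "q \<in> W" for q
  proof -
    have *: "inj_on (\<lambda>i. V i q) (insert k F)" "independent (insert (V k q) ((\<lambda>i. V i q) ` F))"
      using insert.prems(2)[OF that] by simp_all
    then have "V k q \<notin> (\<lambda>i. V i q) ` F"
      using insert.hyps(2) by (auto simp: inj_on_def)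
    then show "V k q \<notin> span ((\<lambda>i. V i q) ` F)" "independent ((\<lambda>i. V i q) ` F)"
      using *(2) by (simp_all add: independent_insert)
    show "inj_on (\<lambda>i. V i q) F"
      using *(1) by (simp add: inj_on_insert)
  qed
  have "\<exists>U. (\<forall>i\<in>F. U i \<in> S) \<and> (\<forall>i\<in>F. \<forall>q\<in>W. U i q \<noteq> 0) \<and>
      (\<forall>i\<in>F. \<forall>j\<in>F. i \<noteq> j \<longrightarrow> (\<forall>q\<in>W. \<beta> q (U i q) (U j q) = 0)) \<and>
      (\<forall>q\<in>W. span ((\<lambda>i. U i q) ` F) = span ((\<lambda>i. V i q) ` F))"
    by (rule insert.IH) (use insert.prems(1) indepF in auto)
  then obtain U where U: "\<And>i. i \<in> F \<Longrightarrow> U i \<in> S" "\<And>i q. i \<in> F \<Longrightarrow> q \<in> W \<Longrightarrow> U i q \<noteq> 0"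
    "\<And>i j q. i \<in> F \<Longrightarrow> j \<in> F \<Longrightarrow> i \<noteq> j \<Longrightarrow> q \<in> W \<Longrightarrow> \<beta> q (U i q) (U j q) = 0"
    "\<And>q. q \<in> W \<Longrightarrow> span ((\<lambda>i. U i q) ` F) = span ((\<lambda>i. V i q) ` F)"
    by (elim exE conjE) metis
  define p where "p q = (\<Sum>j\<in>F. (\<beta> q (V k q) (U j q) / \<beta> q (U j q) (U j q)) *\<^sub>R U j q)" for q
  define u where "u q = V k q - p q" for q
  \<comment> \<open>The closure rules of \<open>S\<close> speak of differences, so the projections
    are subtracted one at a time.\<close>
  have "G \<subseteq> F \<Longrightarrow> (\<lambda>q. V k q - (\<Sum>j\<in>G. (\<beta> q (V k q) (U j q) / \<beta> q (U j q) (U j q)) *\<^sub>R U j q)) \<in> S" for G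
  proof (induction G rule: infinite_finite_induct)
    case (insert j G)
    have "(\<lambda>q. V k q - (\<Sum>j\<in>G. (\<beta> q (V k q) (U j q) / \<beta> q (U j q) (U j q)) *\<^sub>R U j q)
        - (\<beta> q (V k q) (U j q) / \<beta> q (U j q) (U j q)) *\<^sub>R U j q) \<in> S"
      using insert \<open>\<And>i. i \<in> insert k F \<Longrightarrow> V i \<in> S\<close> U(1,2) by (intro diff[OF _ proj]) auto
    then show ?case
      using insert.hyps by (simp add: algebra_simps)
  qed (use insert.prems insert.hyps finite_subset in auto)
  from this[of F] have uS: "u \<in> S"
    by (simp add: u_def[abs_def] p_def[abs_def])
  have p_span: "p q \<in> span ((\<lambda>i. U i q) ` F)" for q
    unfolding p_def by (intro span_sum span_scale span_base) simp
  have u0: "u q \<noteq> 0" if "q \<in> W" for q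
    using indepF(3)[OF that] p_span[of q] U(4)[OF that] by (auto simp: u_def)
  have ortho: "\<beta> q (u q) (U i q) = 0" if "q \<in> W" "i \<in> F" for q i
  proof -
    have "\<beta> q (p q) (U i q) = (\<Sum>j\<in>F. (\<beta> q (V k q) (U j q) / \<beta> q (U j q) (U j q)) * \<beta> q (U j q) (U i q))"
      unfolding p_def by (simp add: linear_sum[OF lin[OF that(1)]] linear_cmul[OF lin[OF that(1)]])
    also have "\<dots> = (\<Sum>j\<in>F. if j = i then \<beta> q (V k q) (U i q) else 0)"
      using U(3)[OF _ that(2) _ that(1)] pos[OF U(1) that(1) U(2)] that by (intro sum.cong) force+
    also have "\<dots> = \<beta> q (V k q) (U i q)"
      using that insert.hyps(1) by simp
    finally show ?thesis
      by (simp add: u_def linear_diff[OF lin[OF that(1)]])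
  qed
  have span: "span (insert (u q) ((\<lambda>i. U i q) ` F)) = span (insert (V k q) ((\<lambda>i. V i q) ` F))" if "q \<in> W" for q
  proof -
    have "u q - V k q \<in> span ((\<lambda>i. U i q) ` F)"
      using span_neg[OF p_span[of q]] by (simp add: u_def)
    from eq_span_insert_eq[OF this] show ?thesis
      by (simp add: span_insert[of "V k q"] U(4)[OF that])
  qed
  define U' where "U' = U(k := u)"
  have [simp]: "(\<lambda>i. U' i q) ` F = (\<lambda>i. U i q) ` F" "U' k q = u q" for q
    using insert.hyps by (auto simp: U'_def)
  show ?case
  proof (intro exI[of _ U'] conjI ballI impI)
    fix i assume "i \<in> insert k F"
    then show "U' i \<in> S" using uS U(1) by (auto simp: U'_def)
    show "U' i q \<noteq> 0" if "q \<in> W" for q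
      using \<open>i \<in> insert k F\<close> u0 U(2) that by (auto simp: U'_def)
    fix j q assume "j \<in> insert k F" "i \<noteq> j" "q \<in> W"
    then show "\<beta> q (U' i q) (U' j q) = 0"
      using \<open>i \<in> insert k F\<close> ortho U(3) sym[OF \<open>q \<in> W\<close>, of "U i q" "u q"]
      unfolding U'_def by (cases "i = k"; cases "j = k") simp_all
  qed (use span in simp)
qed

text \<open>Positivity is asked on the span: for \<open>\<epsilon> = -1\<close> the form
  \<open>wmetric\<close> is indefinite on the whole ambient vector space. The second claim holds
  because the residual lies in the span and is orthogonal to it.\<close>

lemma orthogonal_expansion:
  fixes \<beta> :: "'v::real_vector \<Rightarrow> 'v \<Rightarrow> real"
  assumes fin: "finite I" and lin: "\<And>y. linear (\<lambda>x. \<beta> x y)" and sym: "\<And>x y. \<beta> x y = \<beta> y x"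
    and pos: "\<And>x. x \<in> span (u ` I) \<Longrightarrow> x \<noteq> 0 \<Longrightarrow> \<beta> x x > 0"
    and u: "\<And>i. i \<in> I \<Longrightarrow> u i \<noteq> 0" "\<And>i j. i \<in> I \<Longrightarrow> j \<in> I \<Longrightarrow> i \<noteq> j \<Longrightarrow> \<beta> (u i) (u j) = 0"
  shows "i \<in> I \<Longrightarrow> \<beta> (w - (\<Sum>j\<in>I. (\<beta> w (u j) / \<beta> (u j) (u j)) *\<^sub>R u j)) (u i) = 0"
    and "w \<in> span (u ` I) \<Longrightarrow> w = (\<Sum>i\<in>I. (\<beta> w (u i) / \<beta> (u i) (u i)) *\<^sub>R u i)"
proof -
  define p where "p = (\<Sum>j\<in>I. (\<beta> w (u j) / \<beta> (u j) (u j)) *\<^sub>R u j)"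
  have ortho: "\<beta> (w - p) (u i) = 0" if "i \<in> I" for i
  proof -
    have "\<beta> p (u i) = (\<Sum>j\<in>I. (\<beta> w (u j) / \<beta> (u j) (u j)) * \<beta> (u j) (u i))"
      unfolding p_def by (simp add: linear_sum[OF lin] linear_cmul[OF lin])
    also have "\<dots> = (\<Sum>j\<in>I. if j = i then \<beta> w (u i) else 0)"
      using u(2)[OF _ that] pos[OF span_base] u(1) that by (intro sum.cong) force+
    also have "\<dots> = \<beta> w (u i)"
      using that fin by simp
    finally show ?thesis by (simp add: linear_diff[OF lin])
  qed
  then show "i \<in> I \<Longrightarrow> \<beta> (w - (\<Sum>j\<in>I. (\<beta> w (u j) / \<beta> (u j) (u j)) *\<^sub>R u j)) (u i) = 0"
    by (simp add: p_def)
  show "w = (\<Sum>i\<in>I. (\<beta> w (u i) / \<beta> (u i) (u i)) *\<^sub>R u i)" if w: "w \<in> span (u ` I)"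
  proof -
    have "p \<in> span (u ` I)"
      unfolding p_def by (intro span_sum span_scale span_base) simp
    then have wp: "w - p \<in> span (u ` I)" using w by (rule span_diff[rotated])
    have "linear (\<lambda>x. \<beta> (w - p) x)"
      using lin[of "w - p"] by (simp add: sym[of "w - p"])
    then have "\<beta> (w - p) x = 0" if "x \<in> span (u ` I)" for x
      using linear_eq_0_on_span[of "\<beta> (w - p)" "u ` I" x] that ortho by auto
    then have "w - p = 0" using pos[OF wp] wp by (metis less_irrefl)
    then show ?thesis by (simp add: p_def)
  qed
qed


lemma symmetric_components_zero:
  fixes \<phi> :: "'i::finite \<Rightarrow> 'i \<Rightarrow> 'i \<Rightarrow> real"
  assumes sym: "\<And>a b c. \<phi> a b c = \<phi> b a c" "\<And>a b c. \<phi> a b c = \<phi> a c b"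
    and trace: "\<And>a. (\<Sum>b\<in>UNIV. \<phi> a b b) = 0"
    and comm: "\<And>a a' b c. (\<Sum>i\<in>UNIV. \<phi> a b i * \<phi> a' c i) = (\<Sum>i\<in>UNIV. \<phi> a c i * \<phi> a' b i)"
  shows "\<phi> a b c = 0"
proof -
  txt \<open>Put \<open>b = a\<close>, \<open>a' = c = j\<close> in \<open>comm\<close> and sum over \<open>j\<close>: one side is a trace, the other a sum of squares.\<close>
  have "(\<Sum>j\<in>UNIV. \<Sum>i\<in>UNIV. \<phi> a a i * \<phi> j j i) = (\<Sum>i\<in>UNIV. \<phi> a a i * (\<Sum>j\<in>UNIV. \<phi> j j i))"
    by (subst sum.swap) (simp add: sum_distrib_left)
  \<comment> \<open>Total symmetry gives \<open>\<phi> j j i = \<phi> i j j\<close>, which turns the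
    inner sum into a trace.\<close>
  also have "\<dots> = (\<Sum>i\<in>UNIV. \<phi> a a i * (\<Sum>j\<in>UNIV. \<phi> i j j))"
    by (metis (no_types, lifting) sym(1) sym(2) sum.cong)
  also have "\<dots> = 0" by (simp add: trace)
  finally have "(\<Sum>j\<in>UNIV. \<Sum>i\<in>UNIV. \<phi> a j i * \<phi> j a i) = 0"
    by (simp add: comm[of a a])
  moreover have "\<phi> j a i = \<phi> a j i" for i j by (rule sym(1))
  ultimately have "(\<Sum>j\<in>UNIV. \<Sum>i\<in>UNIV. \<phi> a j i * \<phi> a j i) = 0" by simp
  then have "(\<Sum>i\<in>UNIV. \<phi> a b i * \<phi> a b i) = 0"
    using sum_nonneg_eq_0_iff[of UNIV "\<lambda>j. \<Sum>i\<in>UNIV. \<phi> a j i * \<phi> a j i"] by (simp add: sum_nonneg)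
  then have "\<phi> a b c * \<phi> a b c = 0"
    using sum_nonneg_eq_0_iff[of UNIV "\<lambda>i. \<phi> a b i * \<phi> a b i"] by simp
  then show ?thesis by simp
qed


section \<open>The metric of the warped product at a point\<close>

lemma wmetric_commute: "wmetric \<epsilon> \<rho> y v w = wmetric \<epsilon> \<rho> y w v"
  by (simp add: wmetric_def eform_commute mult.commute)

lemma wmetric_simps:
  "wmetric \<epsilon> \<rho> y (u + v) w = wmetric \<epsilon> \<rho> y u w + wmetric \<epsilon> \<rho> y v w"
  "wmetric \<epsilon> \<rho> y (u - v) w = wmetric \<epsilon> \<rho> y u w - wmetric \<epsilon> \<rho> y v w"
  "wmetric \<epsilon> \<rho> y (c *\<^sub>R v) w = c * wmetric \<epsilon> \<rho> y v w"
  "wmetric \<epsilon> \<rho> y w (u + v) = wmetric \<epsilon> \<rho> y w u + wmetric \<epsilon> \<rho> y w v"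
  "wmetric \<epsilon> \<rho> y w (u - v) = wmetric \<epsilon> \<rho> y w u - wmetric \<epsilon> \<rho> y w v"
  "wmetric \<epsilon> \<rho> y w (c *\<^sub>R v) = c * wmetric \<epsilon> \<rho> y w v"
  by (simp_all add: wmetric_def eform_simps algebra_simps)

lemma linear_wmetric: "linear (\<lambda>v. wmetric \<epsilon> \<rho> y v w)" "linear (\<lambda>v. wmetric \<epsilon> \<rho> y w v)"
  by (rule linearI; simp add: wmetric_simps)+

lemma wmetric_zero [simp]: "wmetric \<epsilon> \<rho> y 0 w = 0" "wmetric \<epsilon> \<rho> y w 0 = 0"
  using linear_0[OF linear_wmetric(1)] linear_0[OF linear_wmetric(2)] by blast+

lemma bounded_bilinear_eform: "bounded_bilinear (eform \<epsilon> :: real \<times> (real ^ 'n::finite) \<Rightarrow> _)"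
  unfolding bilinear_conv_bounded_bilinear[symmetric] bilinear_def linear_iff
  by (simp add: eform_simps)

text \<open>In the hyperbolic case, \<open>v\<close> is spacelike because it is orthogonal to the timelike vector \<open>x\<close>.\<close>

lemma eform_tangent_pos:
  assumes eps: "\<epsilon> = 1 \<or> \<epsilon> = -1" and x: "x \<in> space_form \<epsilon>" and v: "eform \<epsilon> x v = 0" "v \<noteq> 0"
  shows "eform \<epsilon> v v > 0"
  using eps
proof
  assume "\<epsilon> = 1"
  then have "eform \<epsilon> v v = v \<bullet> v" by (simp add: eform_def inner_prod_def)
  then show ?thesis using v by simp
next
  assume e: "\<epsilon> = -1"
  have x1: "(fst x)\<^sup>2 = 1 + snd x \<bullet> snd x" "fst x > 0" and xv: "fst x * fst v = snd x \<bullet> snd v"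
    using x v e by (simp_all add: space_form_def eform_def power2_eq_square)
  have "snd v \<noteq> 0"
    using xv x1 v by (auto simp: prod_eq_iff)
  have "(fst x)\<^sup>2 * (fst v)\<^sup>2 = (snd x \<bullet> snd v)\<^sup>2"
    by (simp add: xv[symmetric] power_mult_distrib)
  also have "\<dots> \<le> (snd x \<bullet> snd x) * (snd v \<bullet> snd v)"
    by (rule Cauchy_Schwarz_ineq)
  \<comment> \<open>Strict because \<open>(fst x)\<^sup>2\<close> exceeds
    \<open>snd x \<bullet> snd x\<close> by 1 and \<open>snd v\<close> is nonzero.\<close>
  also have "\<dots> < (fst x)\<^sup>2 * (snd v \<bullet> snd v)"
    using \<open>snd v \<noteq> 0\<close> by (intro mult_strict_right_mono) (simp_all add: x1)
  finally have "(fst v)\<^sup>2 < snd v \<bullet> snd v"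
    using x1(2) by (simp add: mult_less_cancel_left)
  then show ?thesis by (simp add: eform_def e power2_eq_square)
qed

lemma wmetric_pos:
  assumes "\<epsilon> = 1 \<or> \<epsilon> = -1" "snd y \<in> space_form \<epsilon>" "\<rho> (fst y) > 0" "v \<in> wtangent \<epsilon> y" "v \<noteq> 0"
  shows "wmetric \<epsilon> \<rho> y v v > 0"
proof (cases "snd v = 0")
  case True
  then have "fst v \<noteq> 0" using assms(5) by (auto simp: prod_eq_iff)
  moreover have "eform \<epsilon> (snd v) (snd v) = 0"
    using True by (simp add: eform_def)
  ultimately show ?thesis
    by (simp add: wmetric_def) (metis not_real_square_gt_zero)
next
  case False
  then have "eform \<epsilon> (snd v) (snd v) > 0"
    using assms by (intro eform_tangent_pos) (auto simp: wtangent_def)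
  then have "(\<rho> (fst y))\<^sup>2 * eform \<epsilon> (snd v) (snd v) > 0"
    using assms(3) by simp
  then show ?thesis
    by (simp add: wmetric_def add_nonneg_pos)
qed

lemma subspace_wtangent: "subspace (wtangent \<epsilon> y)"
  unfolding subspace_def wtangent_def by (simp add: eform_simps) (simp add: eform_def)


section \<open>Covariant differentiation along an immersion\<close>

locale immersed_manifold = smooth_manifold A
  for A :: "('a::{t2_space,second_countable_topology}, 'm::finite) chart set" +
  fixes g :: "'a \<Rightarrow> real ^ 'm \<Rightarrow> real ^ 'm \<Rightarrow> real"
    and \<epsilon> :: real and \<rho> :: "real \<Rightarrow> real" and f :: "'a \<Rightarrow> 'n::finite ambient"
  assumes eps: "\<epsilon> = 1 \<or> \<epsilon> = -1"
    and rho_smooth: "smooth_on UNIV \<rho>" and rho_pos: "\<rho> t > 0"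
    and metric: "riemannian_metric A g"
    and immersion: "isometric_immersion A g \<epsilon> \<rho> f"
begin

abbreviation "ip p \<equiv> wmetric \<epsilon> \<rho> (f p)"
abbreviation "df p \<equiv> mderiv A f p"
abbreviation "Dc \<equiv> induced_conn A \<epsilon> \<rho> f"
abbreviation "nsp p \<equiv> normal_space A \<epsilon> \<rho> f p"
abbreviation "np p \<equiv> normal_part A \<epsilon> \<rho> f p"
abbreviation "nc \<equiv> normal_conn A \<epsilon> \<rho> f"
abbreviation "sff p \<equiv> second_fundamental_form A \<epsilon> \<rho> f p"
abbreviation "wt p \<equiv> wtangent \<epsilon> (f p)"
abbreviation "nsec \<equiv> normal_section A \<epsilon> \<rho> f"

text \<open>Sections of the pullback along f of the tangent bundle of the warped product; the fields
  \<open>df q (X q)\<close> and the normal sections are both of this kind.\<close>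

definition ambient_section :: "'a set \<Rightarrow> ('a \<Rightarrow> 'n ambient) \<Rightarrow> bool" where
  "ambient_section W V \<longleftrightarrow> msmooth A W V \<and> (\<forall>p\<in>W. V p \<in> wt p)"

lemma nsec_ambient: "nsec W \<xi> \<Longrightarrow> ambient_section W \<xi>"
  unfolding normal_section_def ambient_section_def normal_space_def by blast

lemma nsec_subset: "nsec W \<xi> \<Longrightarrow> V \<subseteq> W \<Longrightarrow> nsec V \<xi>"
  unfolding normal_section_def using msmooth_subset by blast

lemma ambient_section_subset: "ambient_section W X \<Longrightarrow> V \<subseteq> W \<Longrightarrow> ambient_section V X"
  unfolding ambient_section_def using msmooth_subset by blast

lemma f_smooth: "msmooth A UNIV f"
  using immersion unfolding isometric_immersion_def by blast

lemma f_smooth_on: "msmooth A W f"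
  using msmooth_subset[OF f_smooth] by simp

lemma f_mem: "snd (f p) \<in> space_form \<epsilon>"
  using immersion unfolding isometric_immersion_def by blast

lemma eform_ff: "eform \<epsilon> (snd (f p)) (snd (f p)) = \<epsilon>"
  using f_mem unfolding space_form_def by blast

lemma linear_df: "linear (df p)"
  by (rule linear_mderiv[OF open_UNIV UNIV_I f_smooth])

lemma ip_df: "ip p (df p v) (df p w) = g p v w"
  using immersion unfolding isometric_immersion_def by blast

lemma g_lin: "linear (\<lambda>v. g p v w)" and g_sym: "g p v w = g p w v" and g_pos: "v \<noteq> 0 \<Longrightarrow> g p v v > 0"
  using metric unfolding riemannian_metric_def bilinear_def by blast+

lemma g_smooth: "open W \<Longrightarrow> vector_field A W X \<Longrightarrow> vector_field A W Y \<Longrightarrow> msmooth A W (\<lambda>p. g p (X p) (Y p))"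
  using metric unfolding riemannian_metric_def by blast

lemma has_mderiv_f: "has_mderiv f p (df p)"
  by (rule has_mderiv_mderiv[OF open_UNIV UNIV_I f_smooth])

lemma rho_nz [simp]: "\<rho> t \<noteq> 0"
  using rho_pos[of t] by simp

lemma DERIV_rho: "(\<rho> has_real_derivative deriv \<rho> t) (at t)"
  using smooth_on_differentiable[OF rho_smooth, of t] by (simp add: DERIV_deriv_iff_real_differentiable)

lemma DERIV_deriv_rho: "(deriv \<rho> has_real_derivative deriv (deriv \<rho>) t) (at t)"
  using smooth_on_differentiable[OF smooth_on_deriv[OF rho_smooth], of t]
  by (simp add: DERIV_deriv_iff_real_differentiable)

lemma has_mderiv_eform:
  "has_mderiv F p F' \<Longrightarrow> has_mderiv G p G' \<Longrightarrow>
     has_mderiv (\<lambda>q. eform \<epsilon> (F q) (G q)) p (\<lambda>v. eform \<epsilon> (F p) (G' v) + eform \<epsilon> (F' v) (G p))"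
  by (rule has_mderiv_bounded_bilinear[OF bounded_bilinear_eform])

lemmas has_mderiv_fst = has_mderiv_bounded_linear[OF bounded_linear_fst]
lemmas has_mderiv_snd = has_mderiv_bounded_linear[OF bounded_linear_snd]
lemmas has_mderiv_mult = has_mderiv_bounded_bilinear[OF bounded_bilinear_mult]
lemmas has_mderiv_scaleR = has_mderiv_bounded_bilinear[OF bounded_bilinear_scaleR]

lemma ambient_section_has_mderiv:
  "open W \<Longrightarrow> p \<in> W \<Longrightarrow> ambient_section W V \<Longrightarrow> has_mderiv V p (mderiv A V p)"
  unfolding ambient_section_def using has_mderiv_mderiv by blast

text \<open>The derivative of \<open>\<langle>x, V\<rangle> = 0\<close>.\<close>

lemma ambient_section_deriv:
  assumes "open W" "p \<in> W" "ambient_section W V"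
  shows "eform \<epsilon> (snd (f p)) (snd (mderiv A V p v)) = - eform \<epsilon> (snd (df p v)) (snd (V p))"
proof -
  have "has_mderiv (\<lambda>q. eform \<epsilon> (snd (f q)) (snd (V q))) p
      (\<lambda>v. eform \<epsilon> (snd (f p)) (snd (mderiv A V p v)) + eform \<epsilon> (snd (df p v)) (snd (V p)))"
    by (intro has_mderiv_eform has_mderiv_snd has_mderiv_f ambient_section_has_mderiv[OF assms])
  from mderiv_eq[OF this]
  have "mderiv A (\<lambda>q. eform \<epsilon> (snd (f q)) (snd (V q))) p v =
      eform \<epsilon> (snd (f p)) (snd (mderiv A V p v)) + eform \<epsilon> (snd (df p v)) (snd (V p))" by simp
  moreover have "mderiv A (\<lambda>q. eform \<epsilon> (snd (f q)) (snd (V q))) p = mderiv A (\<lambda>q. 0) p"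
    by (rule mderiv_cong[OF assms(1,2)])
      (use assms(3) in \<open>auto simp: ambient_section_def wtangent_def\<close>)
  moreover have "mderiv A (\<lambda>q. 0 :: real) p = (\<lambda>v. 0)"
    by (rule mderiv_eq[OF has_mderiv_const])
  ultimately show ?thesis by simp
qed

lemma df_wt: "df p v \<in> wt p"
proof -
  have "has_mderiv (\<lambda>q. eform \<epsilon> (snd (f q)) (snd (f q))) p
      (\<lambda>v. eform \<epsilon> (snd (f p)) (snd (df p v)) + eform \<epsilon> (snd (df p v)) (snd (f p)))"
    by (intro has_mderiv_eform has_mderiv_snd has_mderiv_f)
  from mderiv_eq[OF this] mderiv_eq[OF has_mderiv_const[of \<epsilon> p]]
  have "eform \<epsilon> (snd (f p)) (snd (df p v)) + eform \<epsilon> (snd (df p v)) (snd (f p)) = 0"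
    by (simp add: eform_ff fun_eq_iff)
  then show ?thesis by (simp add: wtangent_def eform_commute)
qed

lemma eform_f_df [simp]:
  "eform \<epsilon> (snd (f p)) (snd (df p v)) = 0" "eform \<epsilon> (snd (df p v)) (snd (f p)) = 0"
  using df_wt[of p v] by (simp_all add: wtangent_def eform_commute)

lemma ip_pos: "v \<in> wt p \<Longrightarrow> v \<noteq> 0 \<Longrightarrow> ip p v v > 0"
  by (rule wmetric_pos[OF eps f_mem rho_pos])

lemma wt_subspace: "subspace (wt p)"
  by (rule subspace_wtangent)

section \<open>The covariant derivative along the immersion\<close>

lemma Dc_wt: "V p \<in> wt p \<Longrightarrow> Dc V p v \<in> wt p"
  unfolding induced_conn_def by (rule wconn_tangent[OF eps f_mem df_wt])

text \<open>Differentiated tangency replaces the product of x with the derivative of V by one that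
  carries no derivative of V. The resulting expression is the one that is differentiated again in
  \<open>mderiv_Dc\<close>.\<close>

lemma Dc_eq:
  assumes "open W" "p \<in> W" "ambient_section W V"
  shows "fst (Dc V p v) = fst (mderiv A V p v)
      - (\<rho> (fst (f p)) * deriv \<rho> (fst (f p))) * eform \<epsilon> (snd (df p v)) (snd (V p))"
    and "snd (Dc V p v) = snd (mderiv A V p v) + (\<epsilon> * eform \<epsilon> (snd (df p v)) (snd (V p))) *\<^sub>R snd (f p)
      + (deriv \<rho> (fst (f p)) * inverse (\<rho> (fst (f p)))) *\<^sub>R
          (fst (df p v) *\<^sub>R snd (V p) + fst (V p) *\<^sub>R snd (df p v))"
  by (simp_all add: induced_conn_def wconn_eq ambient_section_deriv[OF assms] divide_inverse)

lemma linear_Dc: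
  assumes "open W" "p \<in> W" "msmooth A W V"
  shows "linear (Dc V p)"
proof -
  have l: "linear (mderiv A V p)" by (rule linear_mderiv[OF assms])
  show ?thesis
    unfolding induced_conn_def
    by (rule linearI)
      (simp_all add: wconn_eq eform_simps algebra_simps linear_add[OF l] linear_cmul[OF l]
        linear_add[OF linear_df] linear_cmul[OF linear_df])
qed

lemma Dc_cong:
  assumes "open W" "p \<in> W" "\<And>q. q \<in> W \<Longrightarrow> V q = U q"
  shows "Dc V p v = Dc U p v"
  using mderiv_cong[OF assms] assms unfolding induced_conn_def by simp

lemma Dc_diff:
  assumes "open W" "p \<in> W" "msmooth A W V" "msmooth A W U"
  shows "Dc (\<lambda>q. V q - U q) p v = Dc V p v - Dc U p v"
proof -
  have "mderiv A (\<lambda>q. V q - U q) p v = mderiv A V p v - mderiv A U p v"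
    using mderiv_eq[OF has_mderiv_diff[OF has_mderiv_mderiv[OF assms(1,2,3)] has_mderiv_mderiv[OF assms(1,2,4)]]]
    by simp
  then show ?thesis
    using wconn_add[of \<epsilon> \<rho> "f p" "df p v" "V p - U p" "U p" "mderiv A V p v - mderiv A U p v" "mderiv A U p v"]
    unfolding induced_conn_def by simp
qed

lemma Dc_metric:
  assumes W: "open W" "p \<in> W" and V: "ambient_section W V" and U: "ambient_section W U"
  shows "mderiv A (\<lambda>q. ip q (V q) (U q)) p v = ip p (Dc V p v) (U p) + ip p (V p) (Dc U p v)"
proof -
  have "has_mderiv (\<lambda>q. fst (V q) * fst (U q) + (\<rho> (fst (f q)) * \<rho> (fst (f q))) * eform \<epsilon> (snd (V q)) (snd (U q))) p
    (\<lambda>v. (fst (V p) * fst (mderiv A U p v) + fst (mderiv A V p v) * fst (U p)) +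
      ((\<rho> (fst (f p)) * \<rho> (fst (f p))) * (eform \<epsilon> (snd (V p)) (snd (mderiv A U p v)) + eform \<epsilon> (snd (mderiv A V p v)) (snd (U p)))
       + (\<rho> (fst (f p)) * (deriv \<rho> (fst (f p)) * fst (df p v)) + (deriv \<rho> (fst (f p)) * fst (df p v)) * \<rho> (fst (f p)))
         * eform \<epsilon> (snd (V p)) (snd (U p))))"
    by (intro has_mderiv_add has_mderiv_mult has_mderiv_eform has_mderiv_fst has_mderiv_snd
        has_mderiv_compose_real[OF DERIV_rho] has_mderiv_f
        ambient_section_has_mderiv[OF W V] ambient_section_has_mderiv[OF W U])
  from mderiv_eq[OF this] have
    "mderiv A (\<lambda>q. ip q (V q) (U q)) p v = fst (V p) * fst (mderiv A U p v) + fst (mderiv A V p v) * fst (U p) +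
      ((\<rho> (fst (f p)) * \<rho> (fst (f p))) * (eform \<epsilon> (snd (V p)) (snd (mderiv A U p v)) + eform \<epsilon> (snd (mderiv A V p v)) (snd (U p)))
       + (\<rho> (fst (f p)) * (deriv \<rho> (fst (f p)) * fst (df p v)) + (deriv \<rho> (fst (f p)) * fst (df p v)) * \<rho> (fst (f p)))
         * eform \<epsilon> (snd (V p)) (snd (U p)))"
    by (simp add: wmetric_def[abs_def] power2_eq_square)
  \<comment> \<open>The projection term in \<open>Dc_eq\<close> is a multiple of
    \<open>snd (f p)\<close>, to which V and U are orthogonal.\<close>
  moreover have "eform \<epsilon> (snd (f p)) (snd (U p)) = 0" "eform \<epsilon> (snd (f p)) (snd (V p)) = 0"
    using V U W(2) by (auto simp: ambient_section_def wtangent_def)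
  ultimately show ?thesis
    by (simp add: wmetric_def Dc_eq[OF W V] Dc_eq[OF W U] eform_simps field_simps power2_eq_square eform_commute)
qed

lemma ambient_section_df:
  assumes "open W" "vector_field A W X"
  shows "ambient_section W (\<lambda>q. df q (X q))"
  unfolding ambient_section_def using msmooth_mderiv[OF assms(1) f_smooth_on assms(2)] df_wt by blast

text \<open>\<open>mderiv_commutator\<close> for the map f turns the difference of coordinate
  derivatives into the image of the bracket; \<open>wconn_torsion_free\<close> shows that the
  connection terms cancel.\<close>

lemma Dc_torsion_free:
  assumes W: "open W" "p \<in> W" and X: "vector_field A W X" and Y: "vector_field A W Y"
  shows "Dc (\<lambda>q. df q (Y q)) p (X p) - Dc (\<lambda>q. df q (X q)) p (Y p) = df p (lie_bracket A X Y p)"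
  unfolding induced_conn_def mderiv_commutator[OF W f_smooth_on X Y, symmetric]
  by (rule wconn_torsion_free)
    (simp_all add: ambient_section_deriv[OF W ambient_section_df[OF W(1) Y]]
      ambient_section_deriv[OF W ambient_section_df[OF W(1) X]])

lemma msmooth_rho: "open W \<Longrightarrow> msmooth A W (\<lambda>q. \<rho> (fst (f q)))"
  and msmooth_deriv_rho: "open W \<Longrightarrow> msmooth A W (\<lambda>q. deriv \<rho> (fst (f q)))"
  by (intro msmooth_compose[OF _ _ rho_smooth] msmooth_compose[OF _ _ smooth_on_deriv[OF rho_smooth]]
      msmooth_fst f_smooth_on; assumption)+

lemma ambient_section_Dc:
  assumes W: "open W" and V: "ambient_section W V" and X: "vector_field A W X"
  shows "ambient_section W (\<lambda>q. Dc V q (X q))"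
proof -
  have Vs: "msmooth A W V" using V by (simp add: ambient_section_def)
  note sm = msmooth_mderiv[OF W Vs X] msmooth_mderiv[OF W f_smooth_on X] Vs f_smooth_on
  have "msmooth A W (\<lambda>q. (fst (mderiv A V q (X q))
      - (\<rho> (fst (f q)) * deriv \<rho> (fst (f q))) * eform \<epsilon> (snd (df q (X q))) (snd (V q)),
      snd (mderiv A V q (X q)) + (\<epsilon> * eform \<epsilon> (snd (df q (X q))) (snd (V q))) *\<^sub>R snd (f q)
      + (deriv \<rho> (fst (f q)) * inverse (\<rho> (fst (f q)))) *\<^sub>R
          (fst (df q (X q)) *\<^sub>R snd (V q) + fst (V q) *\<^sub>R snd (df q (X q)))))"
    by (intro msmooth_Pair msmooth_diff msmooth_add msmooth_mult msmooth_scaleR msmooth_fst msmooth_snd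
        msmooth_bounded_bilinear[OF bounded_bilinear_eform] msmooth_const sm msmooth_rho msmooth_deriv_rho
        msmooth_inverse W) simp_all
  then have "msmooth A W (\<lambda>q. Dc V q (X q))"
    by (rule msmooth_cong[OF W, rotated]) (simp add: prod_eq_iff Dc_eq[OF W _ V])
  then show ?thesis
    using Dc_wt V by (simp add: ambient_section_def)
qed

text \<open>Prepares the curvature computation: values at p are abbreviated, so that second
  covariant derivatives become algebraic expressions in them.\<close>

lemma mderiv_Dc:
  fixes V X p v
  assumes W: "open W" "p \<in> W" and V: "ambient_section W V" and X: "vector_field A W X"
  defines "r \<equiv> \<rho> (fst (f p))" and "r' \<equiv> deriv \<rho> (fst (f p))" and "r'' \<equiv> deriv (deriv \<rho>) (fst (f p))"
    and "fX \<equiv> df p (X p)" and "VX \<equiv> mderiv A V p (X p)" and "fv \<equiv> df p v" and "Vv \<equiv> mderiv A V p v"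
    and "fXv \<equiv> mderiv A (\<lambda>q. df q (X q)) p v" and "VXv \<equiv> mderiv A (\<lambda>q. mderiv A V q (X q)) p v"
  defines "E \<equiv> eform \<epsilon> (snd fX) (snd (V p))"
    and "Ev \<equiv> eform \<epsilon> (snd fX) (snd Vv) + eform \<epsilon> (snd fXv) (snd (V p))"
  shows "mderiv A (\<lambda>q. Dc V q (X q)) p v =
     (fst VXv - ((r * r') * Ev + (r * (r'' * fst fv) + (r' * fst fv) * r') * E),
      snd VXv + ((\<epsilon> * E) *\<^sub>R snd fv + (\<epsilon> * Ev) *\<^sub>R snd (f p)) +
      ((r' * inverse r) *\<^sub>R ((fst fX *\<^sub>R snd Vv + fst fXv *\<^sub>R snd (V p)) + (fst (V p) *\<^sub>R snd fXv + fst Vv *\<^sub>R snd fX))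
       + (r' * (- (inverse r * inverse r) * (r' * fst fv)) + (r'' * fst fv) * inverse r) *\<^sub>R (fst fX *\<^sub>R snd (V p) + fst (V p) *\<^sub>R snd fX)))"
    (is "_ = ?R")
proof -
  have Vs: "msmooth A W V" using V by (simp add: ambient_section_def)
  note hVX = has_mderiv_mderiv[OF W msmooth_mderiv[OF W(1) Vs X]]
  note hfX = has_mderiv_mderiv[OF W msmooth_mderiv[OF W(1) f_smooth_on X]]
  note hV = has_mderiv_mderiv[OF W Vs]
  have inv: "((\<lambda>t. inverse t) has_real_derivative - (inverse r * inverse r)) (at (\<rho> (fst (f p))))"
    using DERIV_inverse[of "\<rho> (fst (f p))"] by (simp add: r_def power2_eq_square)
  note hrho = has_mderiv_compose_real[OF DERIV_rho has_mderiv_fst[OF has_mderiv_f]]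
  note hrho' = has_mderiv_compose_real[OF DERIV_deriv_rho has_mderiv_fst[OF has_mderiv_f]]
  note hinv = has_mderiv_compose_real[OF inv hrho]
  note rules = has_mderiv_add has_mderiv_diff has_mderiv_mult has_mderiv_scaleR has_mderiv_eform
      has_mderiv_fst has_mderiv_snd has_mderiv_const has_mderiv_f hVX hfX hV hrho hrho' hinv
  have 1: "has_mderiv (\<lambda>q. fst (mderiv A V q (X q))
      - (\<rho> (fst (f q)) * deriv \<rho> (fst (f q))) * eform \<epsilon> (snd (df q (X q))) (snd (V q))) p
      (\<lambda>v. fst (mderiv A (\<lambda>q. mderiv A V q (X q)) p v) - ((r * r') * (eform \<epsilon> (snd fX) (snd (mderiv A V p v)) + eform \<epsilon> (snd (mderiv A (\<lambda>q. df q (X q)) p v)) (snd (V p)))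
        + (r * (r'' * fst (df p v)) + (r' * fst (df p v)) * r') * E))" (is "has_mderiv ?F1 p _")
    unfolding E_def r_def r'_def r''_def fX_def by (intro rules)
  \<comment> \<open>The summand \<open>0 * E\<close> is what the product rule yields for the
    constant factor \<open>\<epsilon>\<close>.\<close>
  have 2: "has_mderiv (\<lambda>q. snd (mderiv A V q (X q)) + (\<epsilon> * eform \<epsilon> (snd (df q (X q))) (snd (V q))) *\<^sub>R snd (f q)
      + (deriv \<rho> (fst (f q)) * inverse (\<rho> (fst (f q)))) *\<^sub>R
          (fst (df q (X q)) *\<^sub>R snd (V q) + fst (V q) *\<^sub>R snd (df q (X q)))) p
      (\<lambda>v. snd (mderiv A (\<lambda>q. mderiv A V q (X q)) p v) + ((\<epsilon> * E) *\<^sub>R snd (df p v) + (\<epsilon> * (eform \<epsilon> (snd fX) (snd (mderiv A V p v)) + eform \<epsilon> (snd (mderiv A (\<lambda>q. df q (X q)) p v)) (snd (V p))) + 0 * E) *\<^sub>R snd (f p)) +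
      ((r' * inverse r) *\<^sub>R ((fst fX *\<^sub>R snd (mderiv A V p v) + fst (mderiv A (\<lambda>q. df q (X q)) p v) *\<^sub>R snd (V p)) + (fst (V p) *\<^sub>R snd (mderiv A (\<lambda>q. df q (X q)) p v) + fst (mderiv A V p v) *\<^sub>R snd fX))
       + (r' * (- (inverse r * inverse r) * (r' * fst (df p v))) + (r'' * fst (df p v)) * inverse r) *\<^sub>R (fst fX *\<^sub>R snd (V p) + fst (V p) *\<^sub>R snd fX)))"
    (is "has_mderiv ?F2 p _")
    unfolding E_def r_def r'_def r''_def fX_def by (intro rules[unfolded r_def])
  have h: "has_mderiv (\<lambda>q. Dc V q (X q)) p (mderiv A (\<lambda>q. Dc V q (X q)) p)"
    using ambient_section_has_mderiv[OF W ambient_section_Dc[OF W(1) V X]] .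
  have "fst (mderiv A (\<lambda>q. Dc V q (X q)) p v) = fst ?R"
  proof -
    have cong1: "mderiv A (\<lambda>q. fst (Dc V q (X q))) p = mderiv A ?F1 p"
      by (rule mderiv_cong[OF W]) (rule Dc_eq(1)[OF W(1) _ V])
    have "fst (mderiv A (\<lambda>q. Dc V q (X q)) p v) = mderiv A (\<lambda>q. fst (Dc V q (X q))) p v"
      using mderiv_eq[OF has_mderiv_fst[OF h]] by simp
    also have "\<dots> = fst ?R"
      unfolding cong1 mderiv_eq[OF 1]
      unfolding Ev_def Vv_def fXv_def VXv_def fv_def by simp
    finally show ?thesis .
  qed
  moreover have "snd (mderiv A (\<lambda>q. Dc V q (X q)) p v) = snd ?R"
  proof -
    have cong2: "mderiv A (\<lambda>q. snd (Dc V q (X q))) p = mderiv A ?F2 p"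
      by (rule mderiv_cong[OF W]) (rule Dc_eq(2)[OF W(1) _ V])
    have "snd (mderiv A (\<lambda>q. Dc V q (X q)) p v) = mderiv A (\<lambda>q. snd (Dc V q (X q))) p v"
      using mderiv_eq[OF has_mderiv_snd[OF h]] by simp
    also have "\<dots> = snd ?R"
      unfolding cong2 mderiv_eq[OF 2]
      unfolding Ev_def Vv_def fXv_def VXv_def fv_def by simp
    finally show ?thesis .
  qed
  ultimately show ?thesis by (rule prod_eqI)
qed

text \<open>All that matters below about the right-hand side: it is tangent to the immersion, and it vanishes
  where \<open>\<xi>\<close> is orthogonal to \<open>\<partial>\<^sub>t\<close>.\<close>

lemma ambient_curvature_normal:
  assumes W: "open W" "p \<in> W" and \<xi>: "ambient_section W \<xi>"
    and X: "vector_field A W X" and Y: "vector_field A W Y"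
    and nX: "ip p (\<xi> p) (df p (X p)) = 0" and nY: "ip p (\<xi> p) (df p (Y p)) = 0"
  defines "r \<equiv> \<rho> (fst (f p))" and "r' \<equiv> deriv \<rho> (fst (f p))" and "r'' \<equiv> deriv (deriv \<rho>) (fst (f p))"
  shows "Dc (\<lambda>q. Dc \<xi> q (Y q)) p (X p) - Dc (\<lambda>q. Dc \<xi> q (X q)) p (Y p) - Dc \<xi> p (lie_bracket A X Y p) =
    (fst (\<xi> p) * ((\<epsilon> - r'\<^sup>2) / r\<^sup>2 + r'' / r)) *\<^sub>R
      (fst (df p (X p)) *\<^sub>R df p (Y p) - fst (df p (Y p)) *\<^sub>R df p (X p))"
    (is "?L = ?R")
proof -
  have r: "r \<noteq> 0" by (simp add: r_def)
  have \<xi>s: "msmooth A W \<xi>" using \<xi> by (simp add: ambient_section_def)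
  define x y s where "x = snd (f p)" and "y = snd (\<xi> p)" and "s = fst (\<xi> p)"
  define fX fY \<xi>X \<xi>Y where "fX = df p (X p)" and "fY = df p (Y p)"
    and "\<xi>X = mderiv A \<xi> p (X p)" and "\<xi>Y = mderiv A \<xi> p (Y p)"
  define fXY fYX \<xi>XY \<xi>YX where "fXY = mderiv A (\<lambda>q. df q (Y q)) p (X p)"
    and "fYX = mderiv A (\<lambda>q. df q (X q)) p (Y p)"
    and "\<xi>XY = mderiv A (\<lambda>q. mderiv A \<xi> q (Y q)) p (X p)"
    and "\<xi>YX = mderiv A (\<lambda>q. mderiv A \<xi> q (X q)) p (Y p)"
  note defs = x_def y_def s_def fX_def fY_def \<xi>X_def \<xi>Y_def fXY_def fYX_def \<xi>XY_def \<xi>YX_def r_def r'_def r''_def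
  \<comment> \<open>With \<open>K\<close>, \<open>m\<close> and \<open>j\<close> for the quotients,
    the identity becomes polynomial in them, with \<open>rj\<close> as the relation between r and
    j.\<close>
  define K m j where "K = r' / r" and "m = r'' / r" and "j = 1 / r\<^sup>2"
  have rj: "r * (r * (j * z)) = z" "j * (r * (r * z)) = z" for z
    using r by (simp_all add: j_def power2_eq_square)
  \<comment> \<open>Orthogonality of \<xi> to the two tangent vectors expresses products of fibre
    components by products of t-components.\<close>
  have EX: "eform \<epsilon> (snd fX) y = - (s * fst fX) * j" and EY: "eform \<epsilon> (snd fY) y = - (s * fst fY) * j"
    using nX nY r by (simp_all add: wmetric_def defs field_simps eform_commute j_def)
  have coeff: "(\<epsilon> - r'\<^sup>2) / r\<^sup>2 + r'' / r = \<epsilon> * j - K * K + m"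
    "r' * inverse r = K"
    "r' * (- (inverse r * inverse r) * (r' * z)) + (r'' * z) * inverse r = (m - K * K) * z"
    "r * r' = K * (r * r)" "r * (r'' * z) + (r' * z) * r' = (m + K * K) * (r * (r * z))" for z
    using r by (simp_all add: j_def K_def m_def field_simps power2_eq_square)
  \<comment> \<open>The second derivatives of f and \<xi> enter the curvature through these
    differences, which the bracket term cancels.\<close>
  have brf: "df p (lie_bracket A X Y p) = fXY - fYX" and br\<xi>: "mderiv A \<xi> p (lie_bracket A X Y p) = \<xi>XY - \<xi>YX"
    by (simp_all add: mderiv_commutator[OF W f_smooth_on X Y, symmetric] mderiv_commutator[OF W \<xi>s X Y, symmetric] defs)
  have tan: "eform \<epsilon> (snd fX) x = 0" "eform \<epsilon> (snd fY) x = 0"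
    by (simp_all add: defs)
  note eqX = Dc_eq[OF W ambient_section_Dc[OF W(1) \<xi> X], of "Y p", unfolded mderiv_Dc[OF W \<xi> X] Dc_eq[OF W \<xi>],
      unfolded fst_conv snd_conv, folded defs, unfolded eform_simps EX EY tan]
  note eqY = Dc_eq[OF W ambient_section_Dc[OF W(1) \<xi> Y], of "X p", unfolded mderiv_Dc[OF W \<xi> Y] Dc_eq[OF W \<xi>],
      unfolded fst_conv snd_conv, folded defs, unfolded eform_simps EX EY tan]
  note eqB = Dc_eq[OF W \<xi>, of "lie_bracket A X Y p", unfolded brf br\<xi> fst_diff snd_diff, folded defs,
      unfolded eform_simps]
  have com: "eform \<epsilon> (snd fY) (snd fX) = eform \<epsilon> (snd fX) (snd fY)"
    by (rule eform_commute)
  have "fst ?L = fst ?R"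
    unfolding fst_diff fst_scaleR eqX eqY eqB coeff
    by (simp add: defs[symmetric] com) (simp add: algebra_simps rj)
  \<comment> \<open>Pairing with an arbitrary w makes the vector identity a real one.\<close>
  moreover have "snd ?L \<bullet> w = snd ?R \<bullet> w" for w
    unfolding snd_diff snd_scaleR eqX eqY eqB coeff
    by (simp add: defs[symmetric] com inner_simps) (simp add: algebra_simps rj)
  then have "snd ?L = snd ?R"
    using vector_eq_rdot[of "snd ?L" "snd ?R"] by blast
  ultimately show ?thesis by (rule prod_eqI)
qed


section \<open>Frames and the normal part\<close>

text \<open>Gram-Schmidt on the coordinate fields of the chart at p, with the vector fields over its
  domain as the module \<open>S\<close>.\<close>

lemma local_orthogonal_frame:
  obtains W and e :: "'m \<Rightarrow> 'a \<Rightarrow> real ^ 'm" where "open W" "p \<in> W" "\<And>i. vector_field A W (e i)"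
    "\<And>i q. q \<in> W \<Longrightarrow> e i q \<noteq> 0" "\<And>i j q. q \<in> W \<Longrightarrow> i \<noteq> j \<Longrightarrow> g q (e i q) (e j q) = 0"
proof -
  define c W where "c = chart_at A p" and "W = fst c"
  have c: "c \<in> A" "p \<in> fst c" unfolding c_def by (rule chart_at)+
  have W: "open W" "p \<in> W" using chart_open[OF c(1)] c(2) by (simp_all add: W_def)
  define V :: "'m \<Rightarrow> 'a \<Rightarrow> real ^ 'm" where "V i = local_extension A p (axis i 1)" for i
  define S where "S = {X. vector_field A W X}"
  have indep: "inj_on (\<lambda>i. V i q) UNIV \<and> independent ((\<lambda>i. V i q) ` UNIV)" if q: "q \<in> W" for q
  proof -
    \<comment> \<open>\<open>J\<close> carries components in c to components in the chart chosen at
      q; \<open>mderiv A (snd c) q\<close> inverts it, so the coordinate fields stay independent at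
      q.\<close>
    define J where "J w = local_extension A p w q" for w
    have qc: "q \<in> fst c" using q by (simp add: W_def)
    have "(\<lambda>x. snd (chart_at A q) (chart_inv c x)) differentiable at (snd c q)"
      using differentiable_in_chart[OF chart_open[OF chart_at(1)] chart_at(2) msmooth_chart_map[OF chart_at(1)] c(1) qc]
      unfolding differentiable_def by blast
    from linear_frechet_derivative[OF this]
    have linJ: "linear J"
      unfolding J_def[abs_def] local_extension_def Let_def o_def c_def .
    have "mderiv A (snd c) q (J w) = w" for w
    proof -
      have "mderiv A (snd c) q (J w) = frechet_derivative (\<lambda>x. snd c (chart_inv c x)) (at (snd c q)) w"
        unfolding J_def
        using mderiv_local_extension[OF chart_open[OF c(1)] qc msmooth_chart_map[OF c(1)], of p w] qc
        by (simp add: c_def)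
      also have "frechet_derivative (\<lambda>x. snd c (chart_inv c x)) (at (snd c q)) = frechet_derivative (\<lambda>x. x) (at (snd c q))"
        using c qc by (intro frechet_derivative_cong_open[OF chart_image_open_subset[OF c(1) chart_open[OF c(1)] order_refl]]) auto
      also have "\<dots> = (\<lambda>x. x)"
        by (rule frechet_derivative_at[OF has_derivative_ident, symmetric])
      finally show ?thesis .
    qed
    then have injJ: "inj J" by (metis injI)
    have Bas: "range (\<lambda>i::'m. axis i (1::real)) = Basis" by (auto simp: Basis_vec_def)
    have im: "(\<lambda>i. V i q) ` UNIV = J ` Basis"
      unfolding Bas[symmetric] V_def J_def by (simp add: image_image)
    have "inj_on (\<lambda>i. V i q) UNIV"
    proof (rule injI)
      fix i j assume "V i q = V j q"
      then have "axis i (1::real) = axis j 1" using injJ by (auto simp: V_def J_def inj_def)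
      then show "i = j" by (simp add: axis_eq_axis)
    qed
    moreover have "independent (J ` Basis)"
      using linear_independent_injective_image[OF linJ independent_Basis] injJ by (simp add: inj_on_subset[of J UNIV])
    ultimately show ?thesis unfolding im by blast
  qed
  have "\<exists>U :: 'm \<Rightarrow> 'a \<Rightarrow> real ^ 'm. (\<forall>i\<in>UNIV. U i \<in> S) \<and> (\<forall>i\<in>UNIV. \<forall>q\<in>W. U i q \<noteq> 0) \<and>
    (\<forall>i\<in>UNIV. \<forall>j\<in>UNIV. i \<noteq> j \<longrightarrow> (\<forall>q\<in>W. g q (U i q) (U j q) = 0)) \<and>
    (\<forall>q\<in>W. span ((\<lambda>i. U i q) ` UNIV) = span ((\<lambda>i. V i q) ` UNIV))"
  proof (rule gram_schmidt_family[where I="UNIV :: 'm set" and \<beta>=g and V=V and S=S and W=W])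
    show "V i \<in> S" for i
      unfolding V_def S_def W_def c_def using vector_field_local_extension by blast
    show "(\<lambda>q. X q - Y q) \<in> S" if "X \<in> S" "Y \<in> S" for X Y
      using that vector_field_diff[OF W(1)] by (simp add: S_def)
    show "(\<lambda>q. (g q (X q) (U q) / g q (U q) (U q)) *\<^sub>R U q) \<in> S"
      if "X \<in> S" "U \<in> S" "\<And>q. q \<in> W \<Longrightarrow> U q \<noteq> 0" for X U
      using that g_pos unfolding S_def divide_inverse
      by (auto intro!: vector_field_scaleR msmooth_mult msmooth_inverse g_smooth W simp: less_imp_neq[symmetric])
  qed (use indep g_pos g_sym g_lin in auto)
  then obtain U :: "'m \<Rightarrow> 'a \<Rightarrow> real ^ 'm" where "\<forall>i. U i \<in> S" "\<forall>i. \<forall>q\<in>W. U i q \<noteq> 0"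
    "\<forall>i j. i \<noteq> j \<longrightarrow> (\<forall>q\<in>W. g q (U i q) (U j q) = 0)"
    by auto
  then show ?thesis
    using that[OF W, of U] by (simp add: S_def)
qed

definition orthonormal :: "'a \<Rightarrow> ('m \<Rightarrow> real ^ 'm) \<Rightarrow> bool" where
  "orthonormal p e \<longleftrightarrow> (\<forall>i j. g p (e i) (e j) = (if i = j then 1 else 0))"

lemma g_linear_right: "linear (\<lambda>v. g p w v)"
  using g_lin[of p w] by (simp add: g_sym[of p w])

text \<open>Pairing with \<open>e i\<close> recovers the coefficients, so the synthesis map
  \<open>T\<close> is injective, and equality of dimensions makes it surjective.\<close>

lemma orthonormal_expand:
  assumes "orthonormal p e"
  shows "v = (\<Sum>i\<in>UNIV. g p v (e i) *\<^sub>R e i)"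
proof -
  define T :: "real ^ 'm \<Rightarrow> real ^ 'm" where "T c = (\<Sum>i\<in>UNIV. (c $ i) *\<^sub>R e i)" for c
  have T: "linear T"
    unfolding T_def by (rule linearI) (simp_all add: scaleR_left_distrib sum.distrib scaleR_sum_right)
  have coef: "g p (T c) (e i) = c $ i" for c i
  proof -
    have *: "g p (e a) (e i) = (if a = i then 1 else 0)" for a
      using assms by (simp add: orthonormal_def)
    have "g p (T c) (e i) = (\<Sum>a\<in>UNIV. c $ a * g p (e a) (e i))"
      by (simp add: T_def linear_sum[OF g_lin] linear_cmul[OF g_lin])
    also have "\<dots> = (\<Sum>a\<in>UNIV. if a = i then c $ i else 0)"
      by (rule sum.cong) (simp_all add: *)
    finally show ?thesis by simp
  qed
  then have "inj T" by (metis injI vec_eq_iff)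
  then have "surj T" using linear_injective_imp_surjective[OF T] by blast
  then obtain c where "v = T c" by (metis surjD)
  then show ?thesis using coef[of c] unfolding T_def by simp
qed

lemma orthonormal_normalize:
  assumes "\<And>i. e i \<noteq> 0" "\<And>i j. i \<noteq> j \<Longrightarrow> g p (e i) (e j) = 0"
  shows "orthonormal p (\<lambda>i. (1 / sqrt (g p (e i) (e i))) *\<^sub>R e i)"
proof -
  have "sqrt (g p (e i) (e i)) * sqrt (g p (e i) (e i)) = g p (e i) (e i)" "g p (e i) (e i) \<noteq> 0" for i
    using g_pos[OF assms(1), of p i] by simp_all
  then show ?thesis
    using assms(2) by (auto simp: orthonormal_def linear_cmul[OF g_lin] linear_cmul[OF g_linear_right])
qed

lemma orthonormal_exists: "\<exists>e. orthonormal p e"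
proof -
  obtain W and e :: "'m \<Rightarrow> 'a \<Rightarrow> real ^ 'm" where "p \<in> W" "\<And>i q. q \<in> W \<Longrightarrow> e i q \<noteq> 0"
    "\<And>i j q. q \<in> W \<Longrightarrow> i \<noteq> j \<Longrightarrow> g q (e i q) (e j q) = 0"
    using local_orthogonal_frame[of p] by metis
  then show ?thesis using orthonormal_normalize[of "\<lambda>i. e i p" p] by blast
qed

lemma orthogonal_frame_expand:
  fixes e :: "'m \<Rightarrow> real ^ 'm"
  assumes "\<And>i. e i \<noteq> 0" "\<And>i j. i \<noteq> j \<Longrightarrow> g p (e i) (e j) = 0"
  shows "v = (\<Sum>i\<in>UNIV. (g p v (e i) / g p (e i) (e i)) *\<^sub>R e i)"
proof -
  have "sqrt (g p (e i) (e i)) * sqrt (g p (e i) (e i)) = g p (e i) (e i)" for i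
    using g_pos[OF assms(1), of p i] by simp
  then show ?thesis
    using orthonormal_expand[OF orthonormal_normalize[of e p, OF assms], of v]
    by (simp add: linear_cmul[OF g_linear_right])
qed

section \<open>Normal spaces and the projection onto them\<close>

lemma nsp_iff: "\<xi> \<in> nsp p \<longleftrightarrow> \<xi> \<in> wt p \<and> (\<forall>v. ip p \<xi> (df p v) = 0)"
  by (simp add: normal_space_def)

lemma nsp_wt: "\<xi> \<in> nsp p \<Longrightarrow> \<xi> \<in> wt p"
  by (simp add: nsp_iff)

lemma nsp_df [simp]: "\<xi> \<in> nsp p \<Longrightarrow> ip p \<xi> (df p v) = 0" "\<xi> \<in> nsp p \<Longrightarrow> ip p (df p v) \<xi> = 0"
  by (simp_all add: nsp_iff wmetric_commute)

lemma nsp_subspace: "subspace (nsp p)"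
  using wt_subspace[of p] unfolding subspace_def by (simp add: nsp_iff wmetric_simps)

lemma nsp_eqI:
  assumes "a \<in> nsp p" "b \<in> nsp p" "\<And>\<nu>. \<nu> \<in> nsp p \<Longrightarrow> ip p a \<nu> = ip p b \<nu>"
  shows "a = b"
proof -
  have ab: "a - b \<in> nsp p" using subspace_diff[OF nsp_subspace assms(1,2)] .
  then have "ip p (a - b) (a - b) = 0" using assms(3)[OF ab] by (simp add: wmetric_simps)
  then show ?thesis using ip_pos[OF nsp_wt[OF ab]] by force
qed

text \<open>Two candidates differ by a vector that is both tangent and normal, and the metric is
  positive definite.\<close>

lemma np_eqI:
  assumes "\<xi> \<in> nsp p" "w = df p v + \<xi>"
  shows "np p w = \<xi>"
  unfolding normal_part_def
proof (rule the_equality)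
  fix \<zeta> assume \<zeta>: "\<zeta> \<in> nsp p \<and> (\<exists>v. w = df p v + \<zeta>)"
  then obtain u where "w = df p u + \<zeta>" by blast
  then have "\<zeta> = df p v + \<xi> - df p u" using assms(2) by simp
  then show "\<zeta> = \<xi>"
    using \<zeta> assms(1) by (intro nsp_eqI[of _ p]) (auto simp: wmetric_simps)
qed (use assms in blast)

text \<open>The explicit projection shows that the description in \<open>normal_part\<close> is
  satisfiable, and along a smooth orthogonal frame it makes the normal part depend smoothly on the
  point.\<close>

lemma np_formula:
  fixes e :: "'m \<Rightarrow> real ^ 'm"
  assumes w: "w \<in> wt p" and e: "\<And>i. e i \<noteq> 0" "\<And>i j. i \<noteq> j \<Longrightarrow> g p (e i) (e j) = 0"
  shows "np p w = w - (\<Sum>i\<in>UNIV. (ip p w (df p (e i)) / g p (e i) (e i)) *\<^sub>R df p (e i))" (is "_ = ?\<xi>")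
    and "np p w \<in> nsp p" and "\<exists>v. w = df p v + np p w"
proof -
  have df0: "df p (e i) \<noteq> 0" for i
    using g_pos[OF e(1), of p i] ip_df[of p "e i" "e i"] by auto
  have in_wt: "x \<in> wt p" if "x \<in> span (range (\<lambda>i. df p (e i)))" for x
    using span_minimal[OF _ wt_subspace, of "range (\<lambda>i. df p (e i))" p] df_wt that by blast
  have ortho: "ip p ?\<xi> (df p (e i)) = 0" for i
  proof -
    have "ip p (w - (\<Sum>i\<in>UNIV. (ip p w (df p (e i)) / ip p (df p (e i)) (df p (e i))) *\<^sub>R df p (e i))) (df p (e i)) = 0"
      by (rule orthogonal_expansion(1)[where \<beta>="ip p" and I=UNIV and u="\<lambda>i. df p (e i)"])
        (simp_all add: linear_wmetric ip_pos in_wt df0 ip_df e(2) wmetric_commute)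
    then show ?thesis by (simp add: ip_df)
  qed
  have "ip p ?\<xi> (df p v) = 0" for v
  proof -
    have "df p v = (\<Sum>i\<in>UNIV. (g p v (e i) / g p (e i) (e i)) *\<^sub>R df p (e i))"
      by (subst orthogonal_frame_expand[of e p v]) (simp_all add: e linear_sum[OF linear_df] linear_cmul[OF linear_df])
    then have "ip p ?\<xi> (df p v) = (\<Sum>i\<in>UNIV. (g p v (e i) / g p (e i) (e i)) * ip p ?\<xi> (df p (e i)))"
      by (simp only: linear_sum[OF linear_wmetric(2)] wmetric_simps(6))
    then show ?thesis using ortho by simp
  qed
  moreover have "?\<xi> \<in> wt p"
    using w df_wt by (intro subspace_diff[OF wt_subspace] subspace_sum[OF wt_subspace] subspace_scale[OF wt_subspace])
  ultimately have \<xi>: "?\<xi> \<in> nsp p" by (simp add: nsp_iff)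
  have eq: "w = df p (\<Sum>i\<in>UNIV. (ip p w (df p (e i)) / g p (e i) (e i)) *\<^sub>R e i) + ?\<xi>"
    by (simp add: linear_sum[OF linear_df] linear_cmul[OF linear_df])
  show 1: "np p w = ?\<xi>" by (rule np_eqI[OF \<xi> eq])
  show "np p w \<in> nsp p" unfolding 1 by (rule \<xi>)
  show "\<exists>v. w = df p v + np p w" unfolding 1 using eq by (rule exI)
qed

lemma np_nsp: "w \<in> wt p \<Longrightarrow> np p w \<in> nsp p"
  and np_decomp: "w \<in> wt p \<Longrightarrow> \<exists>v. w = df p v + np p w"
proof -
  obtain W and e :: "'m \<Rightarrow> 'a \<Rightarrow> real ^ 'm" where "p \<in> W" "\<And>i q. q \<in> W \<Longrightarrow> e i q \<noteq> 0"
    "\<And>i j q. q \<in> W \<Longrightarrow> i \<noteq> j \<Longrightarrow> g q (e i q) (e j q) = 0"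
    using local_orthogonal_frame[of p] by metis
  then show "w \<in> wt p \<Longrightarrow> np p w \<in> nsp p" "w \<in> wt p \<Longrightarrow> \<exists>v. w = df p v + np p w"
    using np_formula[of w p "\<lambda>i. e i p"] by blast+
qed

lemma np_ip:
  assumes "w \<in> wt p" "\<nu> \<in> nsp p"
  shows "ip p (np p w) \<nu> = ip p w \<nu>" "ip p \<nu> (np p w) = ip p \<nu> w"
proof -
  obtain v where "w = df p v + np p w" using np_decomp[OF assms(1)] by blast
  then have "ip p w \<nu> = ip p (df p v) \<nu> + ip p (np p w) \<nu>" by (metis wmetric_simps(1))
  then show "ip p (np p w) \<nu> = ip p w \<nu>" using assms by simp
  then show "ip p \<nu> (np p w) = ip p \<nu> w" by (simp add: wmetric_commute)
qed

lemma np_id: "\<xi> \<in> nsp p \<Longrightarrow> np p \<xi> = \<xi>"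
  by (rule np_eqI[of _ _ _ 0]) (simp_all add: linear_0[OF linear_df])

lemma msmooth_ip:
  assumes "open W" "msmooth A W V" "msmooth A W U"
  shows "msmooth A W (\<lambda>q. ip q (V q) (U q))"
  unfolding wmetric_def power2_eq_square
  by (intro msmooth_add msmooth_mult msmooth_fst msmooth_snd msmooth_rho assms
      msmooth_bounded_bilinear[OF bounded_bilinear_eform])

lemma nsec_np:
  assumes W: "open W" and V: "ambient_section W V"
  shows "nsec W (\<lambda>q. np q (V q))"
proof -
  have "msmooth A W (\<lambda>q. np q (V q))"
  proof (rule msmooth_local)
    fix p assume "p \<in> W"
    obtain W' and e :: "'m \<Rightarrow> 'a \<Rightarrow> real ^ 'm" where W': "open W'" "p \<in> W'" and ve: "\<And>i. vector_field A W' (e i)"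
      and e: "\<And>i q. q \<in> W' \<Longrightarrow> e i q \<noteq> 0" "\<And>i j q. q \<in> W' \<Longrightarrow> i \<noteq> j \<Longrightarrow> g q (e i q) (e j q) = 0"
      using local_orthogonal_frame[of p] by metis
    define U where "U = W \<inter> W'"
    have U: "open U" "p \<in> U" "U \<subseteq> W" "U \<subseteq> W'" using W W' \<open>p \<in> W\<close> by (auto simp: U_def)
    have Vs: "msmooth A U V" using ambient_section_subset[OF V U(3)] by (simp add: ambient_section_def)
    note veU = vector_field_subset[OF ve U(4)]
    have "msmooth A U (\<lambda>q. V q - (\<Sum>i\<in>UNIV. (ip q (V q) (df q (e i q)) * inverse (g q (e i q) (e i q))) *\<^sub>R df q (e i q)))"
    proof (intro msmooth_diff msmooth_sum msmooth_scaleR msmooth_mult msmooth_inverse msmooth_ip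
        msmooth_mderiv[OF U(1) f_smooth_on] g_smooth U(1) Vs veU)
      show "g q (e i q) (e i q) \<noteq> 0" if "q \<in> U" for i q
        using g_pos[OF e(1), of q q i] that U(4) by auto
    qed
    then have "msmooth A U (\<lambda>q. np q (V q))"
    proof (rule msmooth_cong[OF U(1), rotated])
      fix q assume "q \<in> U"
      then have q: "q \<in> W" "q \<in> W'" using U by auto
      then have "V q \<in> wt q" using V by (simp add: ambient_section_def)
      from np_formula(1)[OF this, of "\<lambda>i. e i q"] e q
      show "V q - (\<Sum>i\<in>UNIV. (ip q (V q) (df q (e i q)) * inverse (g q (e i q) (e i q))) *\<^sub>R df q (e i q)) = np q (V q)"
        by (simp add: divide_inverse)
    qed
    then show "\<exists>U. open U \<and> p \<in> U \<and> msmooth A U (\<lambda>q. np q (V q))" using U by blast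
  qed
  then show ?thesis
    using V np_nsp by (simp add: normal_section_def ambient_section_def)
qed

text \<open>The constant map \<nu> is projected to the ambient tangent space
  (\<open>\<epsilon> * \<epsilon> = 1\<close> and \<open>eform_ff\<close> justify the coefficient)
  and then to the normal space; both projections fix \<nu> at p. Normal vectors can therefore be
  treated as values of sections.\<close>

lemma normal_extension:
  assumes \<nu>: "\<nu> \<in> nsp p"
  shows "\<exists>\<xi>. nsec UNIV \<xi> \<and> \<xi> p = \<nu>"
proof -
  define V where "V q = \<nu> - (0, (\<epsilon> * eform \<epsilon> (snd (f q)) (snd \<nu>)) *\<^sub>R snd (f q))" for q
  have "\<epsilon> * \<epsilon> = 1" using eps by auto
  then have "V q \<in> wt q" for q
    using eform_ff[of q] by (simp add: V_def wtangent_def eform_simps)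
  moreover have "msmooth A UNIV V"
    unfolding V_def
    by (intro msmooth_diff msmooth_const msmooth_Pair msmooth_scaleR msmooth_mult msmooth_snd f_smooth
        msmooth_bounded_bilinear[OF bounded_bilinear_eform] open_UNIV)
  ultimately have "nsec UNIV (\<lambda>q. np q (V q))"
    by (intro nsec_np) (simp_all add: ambient_section_def)
  moreover have "V p = \<nu>"
    using nsp_wt[OF \<nu>] by (simp add: V_def wtangent_def prod_eq_iff)
  ultimately show ?thesis using np_id[OF \<nu>] by metis
qed


section \<open>The second fundamental form and the normal connection\<close>

lemma nsec_nsp: "nsec W \<xi> \<Longrightarrow> q \<in> W \<Longrightarrow> \<xi> q \<in> nsp q"
  by (simp add: normal_section_def)

lemma nsec_msmooth: "nsec W \<xi> \<Longrightarrow> msmooth A W \<xi>"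
  by (simp add: normal_section_def)

lemma nc_nsp: "\<xi> p \<in> wt p \<Longrightarrow> nc \<xi> p v \<in> nsp p"
  unfolding normal_conn_def by (intro np_nsp Dc_wt)

lemma nc_ip: "\<xi> p \<in> wt p \<Longrightarrow> \<nu> \<in> nsp p \<Longrightarrow> ip p (nc \<xi> p v) \<nu> = ip p (Dc \<xi> p v) \<nu>"
  unfolding normal_conn_def by (intro np_ip Dc_wt)

lemma nsec_nc:
  assumes "open W" "nsec W \<xi>" "vector_field A W X"
  shows "nsec W (\<lambda>q. nc \<xi> q (X q))"
  unfolding normal_conn_def by (intro nsec_np ambient_section_Dc nsec_ambient assms)

lemma nc_linear:
  assumes "open W" "p \<in> W" "nsec W \<xi>"
  shows "linear (nc \<xi> p)"
proof -
  have \<xi>: "\<xi> p \<in> wt p" using assms nsec_nsp nsp_wt by blast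
  have l: "linear (Dc \<xi> p)" by (rule linear_Dc[OF assms(1,2) nsec_msmooth[OF assms(3)]])
  show ?thesis
    by (rule linearI; rule nsp_eqI[of _ p];
      (intro nc_nsp subspace_add[OF nsp_subspace] subspace_scale[OF nsp_subspace] \<xi>)?)
      (simp_all add: nc_ip[of \<xi> p, OF \<xi>] wmetric_simps linear_add[OF l] linear_cmul[OF l])
qed

lemma nc_cong: "open W \<Longrightarrow> p \<in> W \<Longrightarrow> (\<And>q. q \<in> W \<Longrightarrow> V q = U q) \<Longrightarrow> nc V p v = nc U p v"
  unfolding normal_conn_def using Dc_cong by metis

lemma nc_zero: "nc (\<lambda>q. 0) p v = 0"
proof -
  have d0: "mderiv A (\<lambda>q. 0) p v = (0 :: 'n ambient)"
    using mderiv_eq[OF has_mderiv_const[of "0 :: 'n ambient" p]] by simp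
  have "Dc (\<lambda>q. 0) p v = 0"
    unfolding induced_conn_def wconn_eq d0 by (simp add: eform_def zero_prod_def)
  then show ?thesis
    unfolding normal_conn_def using np_id subspace_0[OF nsp_subspace] by simp
qed

lemma ip_const_zero:
  assumes W: "open W" "p \<in> W" and V: "ambient_section W V" and U: "ambient_section W U"
    and "\<And>q. q \<in> W \<Longrightarrow> ip q (V q) (U q) = 0"
  shows "ip p (Dc V p v) (U p) = - ip p (V p) (Dc U p v)"
proof -
  have "mderiv A (\<lambda>q. ip q (V q) (U q)) p v = 0"
    using mderiv_cong[OF W assms(5)] mderiv_eq[OF has_mderiv_const[of "0::real" p]] by simp
  then show ?thesis using Dc_metric[OF W V U, of v] by simp
qed

lemma nc_skew:
  assumes W: "open W" "p \<in> W" and \<xi>: "nsec W \<xi>" and \<zeta>: "nsec W \<zeta>"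
    and "\<And>q. q \<in> W \<Longrightarrow> ip q (\<xi> q) (\<zeta> q) = 0"
  shows "ip p (nc \<xi> p v) (\<zeta> p) = - ip p (\<xi> p) (nc \<zeta> p v)"
  using ip_const_zero[OF W nsec_ambient[OF \<xi>] nsec_ambient[OF \<zeta>] assms(5), of v]
    nsec_nsp[OF \<xi> W(2)] nsec_nsp[OF \<zeta> W(2)]
  by (simp add: nc_ip nsp_wt wmetric_commute[of _ _ _ "\<xi> p"])

text \<open>The Weingarten relation, obtained by differentiating \<langle>\<xi>, df Z\<rangle> = 0.
  Its right-hand side sees Z only through its value at p, which is the source of the tensoriality of
  \<alpha>.\<close>

lemma Dc_normal_tangent:
  assumes W: "open W" "p \<in> W" and \<xi>: "nsec W \<xi>" and Z: "vector_field A W Z"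
  shows "ip p (\<xi> p) (np p (Dc (\<lambda>q. df q (Z q)) p v)) = - ip p (Dc \<xi> p v) (df p (Z p))"
  using ip_const_zero[OF W nsec_ambient[OF \<xi>] ambient_section_df[OF W(1) Z], of v] nsec_nsp[OF \<xi>] W(2) df_wt
  by (simp add: np_ip Dc_wt)

lemma sff_nsp: "sff p v w \<in> nsp p"
  unfolding second_fundamental_form_def by (intro np_nsp Dc_wt df_wt)

lemma sff_ip:
  assumes W: "open W" "p \<in> W" and \<xi>: "nsec W \<xi>"
  shows "ip p (\<xi> p) (sff p v w) = - ip p (Dc \<xi> p v) (df p w)"
proof -
  define U where "U = W \<inter> fst (chart_at A p)"
  have U: "open U" "p \<in> U" "U \<subseteq> W" "U \<subseteq> fst (chart_at A p)"
    using W chart_at[of p] chart_open[OF chart_at(1)] by (auto simp: U_def)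
  show ?thesis
    using Dc_normal_tangent[OF U(1,2) nsec_subset[OF \<xi> U(3)] vector_field_subset[OF vector_field_local_extension U(4)]]
    unfolding second_fundamental_form_def by simp
qed

text \<open>The Weingarten relation against all normal sections determines \<alpha>(v, w); linearity
  and independence of the extension follow by checking it.\<close>

lemma sff_eqI:
  assumes "a \<in> nsp p" "\<And>\<xi>. nsec UNIV \<xi> \<Longrightarrow> ip p (\<xi> p) a = - ip p (Dc \<xi> p v) (df p w)"
  shows "sff p v w = a"
proof (rule nsp_eqI[OF sff_nsp assms(1)])
  fix \<nu> assume "\<nu> \<in> nsp p"
  then obtain \<xi> where "nsec UNIV \<xi>" "\<xi> p = \<nu>" using normal_extension by blast
  then show "ip p (sff p v w) \<nu> = ip p a \<nu>"
    using sff_ip[OF open_UNIV UNIV_I, of \<xi> p v w] assms(2)[of \<xi>] by (simp add: wmetric_commute)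
qed

lemma sff_tensorial:
  assumes W: "open W" "p \<in> W" and Z: "vector_field A W Z"
  shows "np p (Dc (\<lambda>q. df q (Z q)) p v) = sff p v (Z p)"
  by (rule sff_eqI[symmetric])
    (use Dc_normal_tangent[OF W nsec_subset Z] in \<open>auto intro: np_nsp Dc_wt df_wt\<close>)

lemma sff_linear: "linear (\<lambda>v. sff p v w)" "linear (\<lambda>w. sff p v w)"
proof -
  have l: "linear (Dc \<xi> p)" if "nsec UNIV \<xi>" for \<xi>
    by (rule linear_Dc[OF open_UNIV UNIV_I nsec_msmooth[OF that]])
  show "linear (\<lambda>v. sff p v w)" "linear (\<lambda>w. sff p v w)"
    by (rule linearI; rule sff_eqI;
      (intro sff_nsp subspace_add[OF nsp_subspace] subspace_scale[OF nsp_subspace])?;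
      simp add: wmetric_simps sff_ip[OF open_UNIV UNIV_I] linear_add[OF l] linear_cmul[OF l]
        linear_add[OF linear_df] linear_cmul[OF linear_df] algebra_simps)+
qed

text \<open>By torsion-freeness the two covariant derivatives differ by the image of a bracket,
  which is tangent to the immersion.\<close>

lemma sff_sym: "sff p v w = sff p w v"
proof (rule nsp_eqI[of _ p])
  fix \<nu> assume \<nu>: "\<nu> \<in> nsp p"
  note W = chart_open[OF chart_at(1)] chart_at(2)[of p]
  define X Y where "X = local_extension A p v" and "Y = local_extension A p w"
  have "Dc (\<lambda>q. df q (Y q)) p (X p) - Dc (\<lambda>q. df q (X q)) p (Y p) = df p (lie_bracket A X Y p)"
    unfolding X_def Y_def
    by (rule Dc_torsion_free[OF W vector_field_local_extension vector_field_local_extension])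
  then have "ip p (Dc (\<lambda>q. df q (Y q)) p (X p) - Dc (\<lambda>q. df q (X q)) p (Y p)) \<nu> = 0"
    using \<nu> by simp
  then have "ip p (Dc (\<lambda>q. df q (Y q)) p (X p)) \<nu> = ip p (Dc (\<lambda>q. df q (X q)) p (Y p)) \<nu>"
    by (simp add: wmetric_simps)
  then show "ip p (sff p v w) \<nu> = ip p (sff p w v) \<nu>"
    unfolding second_fundamental_form_def using \<nu> by (simp add: X_def Y_def np_ip Dc_wt df_wt)
qed (rule sff_nsp)+

text \<open>Parseval for tangential parts; with covariant derivatives of two normal sections for a
  and b it yields the products of shape operators in the Ricci equation.\<close>

lemma tangential_ip:
  assumes a: "a \<in> wt p" and b: "b \<in> wt p" and e: "orthonormal p e"
  shows "ip p (a - np p a) b = (\<Sum>i\<in>UNIV. ip p a (df p (e i)) * ip p b (df p (e i)))"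
proof -
  obtain u where u: "a = df p u + np p a" using np_decomp[OF a] by blast
  have "ip p a (df p (e i)) = g p u (e i)" for i
    using np_nsp[OF a] by (subst u) (simp add: wmetric_simps ip_df)
  moreover have "ip p (df p u) b = (\<Sum>i\<in>UNIV. g p u (e i) * ip p b (df p (e i)))"
    by (subst orthonormal_expand[OF e, of u])
      (simp add: linear_sum[OF linear_df] linear_cmul[OF linear_df] linear_sum[OF linear_wmetric(1)]
        wmetric_simps wmetric_commute[of _ _ _ b])
  moreover have "a - np p a = df p u" using u by (metis add_diff_cancel_right')
  ultimately show ?thesis by simp
qed

text \<open>The covariant derivative of \<xi> along Y is split into normal and tangential parts; the
  tangential part is orthogonal to \<nu>, so differentiating it and pairing with \<nu> gives a
  product of shape operators. There is no ambient term, because by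
  \<open>ambient_curvature_normal\<close> the ambient curvature applied to \<xi> is tangent to the
  immersion.\<close>

lemma ricci_equation:
  assumes W: "open W" "p \<in> W" and \<xi>: "nsec W \<xi>" and \<nu>: "nsec W \<nu>"
    and X: "vector_field A W X" and Y: "vector_field A W Y" and e: "orthonormal p e"
  shows "ip p (normal_curvature A \<epsilon> \<rho> f X Y \<xi> p) (\<nu> p) =
     (\<Sum>i\<in>UNIV. ip p (\<xi> p) (sff p (Y p) (e i)) * ip p (\<nu> p) (sff p (X p) (e i)))
   - (\<Sum>i\<in>UNIV. ip p (\<xi> p) (sff p (X p) (e i)) * ip p (\<nu> p) (sff p (Y p) (e i)))"
proof -
  note \<xi>a = nsec_ambient[OF \<xi>]
  have \<nu>p: "\<nu> p \<in> nsp p" and \<xi>p: "\<xi> p \<in> nsp p" using nsec_nsp \<xi> \<nu> W by blast+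
  have *: "ip p (nc (\<lambda>q. nc \<xi> q (Y q)) p v) (\<nu> p) = ip p (Dc (\<lambda>q. Dc \<xi> q (Y q)) p v) (\<nu> p)
      + (\<Sum>i\<in>UNIV. ip p (\<xi> p) (sff p (Y p) (e i)) * ip p (\<nu> p) (sff p v (e i)))"
    if Y: "vector_field A W Y" for Y v
  proof -
    \<comment> \<open>Here \<open>\<eta>\<close> is the normal part of \<open>\<sigma>\<close>,
      namely \<open>\<nabla>\<^sup>\<bottom>\<^sub>Y \<xi>\<close>, and not the normal part of
      \<open>\<partial>\<^sub>t\<close>; \<open>\<tau>\<close> is the tangential part of
      \<open>\<sigma>\<close>.\<close>
    define \<eta> \<sigma> \<tau> where "\<eta> q = nc \<xi> q (Y q)" and "\<sigma> q = Dc \<xi> q (Y q)" and "\<tau> q = \<sigma> q - \<eta> q" for q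
    have \<eta>: "nsec W \<eta>" unfolding \<eta>_def by (rule nsec_nc[OF W(1) \<xi> Y])
    have \<sigma>: "ambient_section W \<sigma>" unfolding \<sigma>_def by (rule ambient_section_Dc[OF W(1) \<xi>a Y])
    have \<tau>: "ambient_section W \<tau>"
      using \<sigma> nsec_ambient[OF \<eta>] msmooth_diff[OF W(1)] subspace_diff[OF wt_subspace]
      unfolding ambient_section_def \<tau>_def[abs_def] by blast
    have \<eta>\<sigma>: "\<eta> q = np q (\<sigma> q)" for q by (simp add: \<eta>_def \<sigma>_def normal_conn_def)
    have "ip q (\<tau> q) (\<nu> q) = 0" if "q \<in> W" for q
      using that \<sigma> nsec_nsp[OF \<nu> that] by (simp add: \<tau>_def \<eta>\<sigma> wmetric_simps np_ip ambient_section_def)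
    then have "ip p (Dc \<tau> p v) (\<nu> p) = - ip p (\<tau> p) (Dc \<nu> p v)"
      by (rule ip_const_zero[OF W \<tau> nsec_ambient[OF \<nu>]])
    also have "ip p (\<tau> p) (Dc \<nu> p v) = (\<Sum>i\<in>UNIV. ip p (\<sigma> p) (df p (e i)) * ip p (Dc \<nu> p v) (df p (e i)))"
      unfolding \<tau>_def \<eta>\<sigma> using \<sigma> W(2) nsp_wt[OF \<nu>p]
      by (intro tangential_ip e Dc_wt) (auto simp: ambient_section_def)
    also have "\<dots> = (\<Sum>i\<in>UNIV. ip p (\<xi> p) (sff p (Y p) (e i)) * ip p (\<nu> p) (sff p v (e i)))"
      by (simp add: sff_ip[OF W \<xi>] sff_ip[OF W \<nu>] \<sigma>_def)
    finally have "ip p (Dc \<tau> p v) (\<nu> p) = - (\<Sum>i\<in>UNIV. ip p (\<xi> p) (sff p (Y p) (e i)) * ip p (\<nu> p) (sff p v (e i)))" .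
    moreover have "Dc \<tau> p v = Dc \<sigma> p v - Dc \<eta> p v"
      unfolding \<tau>_def using \<sigma> nsec_msmooth[OF \<eta>] by (intro Dc_diff[OF W]) (auto simp: ambient_section_def)
    moreover have "ip p (nc \<eta> p v) (\<nu> p) = ip p (Dc \<eta> p v) (\<nu> p)"
      using nsec_nsp[OF \<eta> W(2)] by (intro nc_ip nsp_wt \<nu>p)
    ultimately show ?thesis
      by (simp add: wmetric_simps \<eta>_def[abs_def] \<sigma>_def[abs_def])
  qed
  have "ip p (Dc (\<lambda>q. Dc \<xi> q (Y q)) p (X p) - Dc (\<lambda>q. Dc \<xi> q (X q)) p (Y p) - Dc \<xi> p (lie_bracket A X Y p)) (\<nu> p) = 0"
    using \<xi>p \<nu>p by (subst ambient_curvature_normal[OF W \<xi>a X Y]) (simp_all add: wmetric_simps)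
  then show ?thesis
    unfolding normal_curvature_def
    using *[OF X, of "Y p"] *[OF Y, of "X p"] nc_ip[of \<xi> p "\<nu> p" "lie_bracket A X Y p"] \<xi>p \<nu>p
    by (simp add: wmetric_simps nsp_wt)
qed

text \<open>By \<open>sff_ip\<close> the tangential part of the derivative is given by the shape
  operator of \<xi>, which is zero at p by assumption.\<close>

lemma Dc_eq_nc:
  assumes "open W" "p \<in> W" "nsec W \<xi>" "\<And>v w. ip p (\<xi> p) (sff p v w) = 0"
  shows "Dc \<xi> p v = nc \<xi> p v"
proof -
  have "Dc \<xi> p v \<in> nsp p"
    using sff_ip[OF assms(1-3)] assms(4) Dc_wt[of \<xi> p, OF nsp_wt[OF nsec_nsp[OF assms(3,2)]]]
    by (simp add: nsp_iff)
  then show ?thesis by (simp add: normal_conn_def np_id)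
qed

text \<open>The symmetry that the Codazzi equation would give, read off from the tangential part of the
  ambient curvature of \<open>\<xi>\<close>.\<close>

lemma sff_nc_symmetric:
  assumes W: "open W" "p \<in> W" and \<xi>: "nsec W \<xi>"
    and perp: "\<And>q v w. q \<in> W \<Longrightarrow> ip q (\<xi> q) (sff q v w) = 0" and dt: "fst (\<xi> p) = 0"
    and X: "vector_field A W X" and Y: "vector_field A W Y"
  shows "ip p (nc \<xi> p (X p)) (sff p (Y p) z) = ip p (nc \<xi> p (Y p)) (sff p (X p) z)"
proof -
  have \<xi>p: "\<xi> q \<in> nsp q" if "q \<in> W" for q using nsec_nsp \<xi> that by blast
  have nc: "Dc \<xi> q v = nc \<xi> q v" if "q \<in> W" for q v
    by (rule Dc_eq_nc[OF W(1) that \<xi> perp[OF that]])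
  \<comment> \<open>As \<open>A\<^sub>\<xi>\<close> vanishes on W, the derivative of \<xi> along Y
    is itself a normal section, to which \<open>sff_ip\<close> applies.\<close>
  have *: "ip p (Dc (\<lambda>q. Dc \<xi> q (Y q)) p v) (df p z) = - ip p (nc \<xi> p (Y p)) (sff p v z)"
    if "vector_field A W Y" for Y v
  proof -
    have "Dc (\<lambda>q. Dc \<xi> q (Y q)) p v = Dc (\<lambda>q. nc \<xi> q (Y q)) p v"
      by (rule Dc_cong[OF W]) (rule nc)
    then show ?thesis
      using sff_ip[OF W nsec_nc[OF W(1) \<xi> that], of v z] by simp
  qed
  \<comment> \<open>The formula for the ambient curvature carries the factor
    \<open>fst (\<xi> p)\<close>, which is 0 by \<open>dt\<close>.\<close>
  have "ip p (Dc (\<lambda>q. Dc \<xi> q (Y q)) p (X p) - Dc (\<lambda>q. Dc \<xi> q (X q)) p (Y p) - Dc \<xi> p (lie_bracket A X Y p)) (df p z) = 0"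
    using \<xi>p[OF W(2)] dt by (subst ambient_curvature_normal[OF W nsec_ambient[OF \<xi>] X Y]) simp_all
  moreover have "ip p (Dc \<xi> p (lie_bracket A X Y p)) (df p z) = 0"
    using nc[OF W(2)] nc_nsp[of \<xi> p, OF nsp_wt[OF \<xi>p[OF W(2)]]] by simp
  ultimately show ?thesis
    using *[OF X, of "Y p"] *[OF Y, of "X p"] by (simp add: wmetric_simps)
qed


section \<open>The mean curvature vector field\<close>

text \<open>\<open>mean_curvature\<close> picks a basis by choice at each point; this frees it from
  that choice. Each vector of one basis is expanded in the other, and the two double sums agree by
  symmetry of the coefficients.\<close>

lemma sff_trace_independent:
  assumes e: "orthonormal p e" and e': "orthonormal p e'"
  shows "(\<Sum>i\<in>UNIV. sff p (e i) (e i)) = (\<Sum>i\<in>UNIV. sff p (e' i) (e' i))"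
proof -
  have "(\<Sum>k\<in>UNIV. sff p (e' k) (e' k)) = (\<Sum>k\<in>UNIV. \<Sum>i\<in>UNIV. g p (e' k) (e i) *\<^sub>R sff p (e' k) (e i))"
    by (intro sum.cong refl, subst (2) orthonormal_expand[OF e])
      (simp add: linear_sum[OF sff_linear(2)] linear_cmul[OF sff_linear(2)])
  also have "\<dots> = (\<Sum>i\<in>UNIV. \<Sum>k\<in>UNIV. g p (e i) (e' k) *\<^sub>R sff p (e' k) (e i))"
    by (subst sum.swap) (simp add: g_sym)
  also have "\<dots> = (\<Sum>i\<in>UNIV. sff p (e i) (e i))"
    by (intro sum.cong refl, subst (4) orthonormal_expand[OF e'])
      (simp add: linear_sum[OF sff_linear(1)] linear_cmul[OF sff_linear(1)])
  finally show ?thesis by simp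
qed

lemma mean_curvature_eq:
  assumes "orthonormal p e"
  shows "mean_curvature A g \<epsilon> \<rho> f p = (1 / real CARD('m)) *\<^sub>R (\<Sum>i\<in>UNIV. sff p (e i) (e i))"
proof -
  define e' where "e' = (SOME e :: 'm \<Rightarrow> real ^ 'm. \<forall>i j. g p (e i) (e j) = (if i = j then 1 else 0))"
  have "orthonormal p e'"
    using someI_ex[OF orthonormal_exists[of p, unfolded orthonormal_def]]
    unfolding orthonormal_def e'_def .
  from sff_trace_independent[OF assms this] show ?thesis
    unfolding mean_curvature_def Let_def e'_def by simp
qed

lemma nsec_sff:
  assumes W: "open W" and X: "vector_field A W X" and Y: "vector_field A W Y"
  shows "nsec W (\<lambda>q. sff q (X q) (Y q))"
proof -
  have n: "nsec W (\<lambda>q. np q (Dc (\<lambda>q. df q (Y q)) q (X q)))"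
    by (intro nsec_np ambient_section_Dc ambient_section_df W X Y)
  have "msmooth A W (\<lambda>q. sff q (X q) (Y q))"
    by (rule msmooth_cong[OF W _ nsec_msmooth[OF n]]) (rule sff_tensorial[OF W _ Y])
  then show ?thesis by (simp add: normal_section_def sff_nsp)
qed

text \<open>The bases chosen pointwise need not vary smoothly; a smooth orthogonal frame computes
  the same trace, with the weights \<open>inverse (g q (e i q) (e i q))\<close> in place of
  normalisation.\<close>

lemma nsec_mean_curvature: "nsec UNIV (mean_curvature A g \<epsilon> \<rho> f)"
proof -
  have "msmooth A UNIV (mean_curvature A g \<epsilon> \<rho> f)"
  proof (rule msmooth_local)
    fix p
    obtain W and e :: "'m \<Rightarrow> 'a \<Rightarrow> real ^ 'm" where W: "open W" "p \<in> W" and ve: "\<And>i. vector_field A W (e i)"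
      and e: "\<And>i q. q \<in> W \<Longrightarrow> e i q \<noteq> 0" "\<And>i j q. q \<in> W \<Longrightarrow> i \<noteq> j \<Longrightarrow> g q (e i q) (e j q) = 0"
      using local_orthogonal_frame[of p] by metis
    have "msmooth A W (\<lambda>q. (1 / real CARD('m)) *\<^sub>R (\<Sum>i\<in>UNIV. inverse (g q (e i q) (e i q)) *\<^sub>R sff q (e i q) (e i q)))"
    proof (intro msmooth_scaleR msmooth_const msmooth_sum msmooth_inverse g_smooth W(1) ve nsec_msmooth[OF nsec_sff])
      show "g q (e i q) (e i q) \<noteq> 0" if "q \<in> W" for i q
        using g_pos[OF e(1)[OF that], of q i] by simp
    qed
    then have "msmooth A W (mean_curvature A g \<epsilon> \<rho> f)"
    proof (rule msmooth_cong[OF W(1), rotated])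
      fix q assume q: "q \<in> W"
      have "sqrt (g q (e i q) (e i q)) * sqrt (g q (e i q) (e i q)) = g q (e i q) (e i q)" for i
        using g_pos[OF e(1)[OF q], of q i] by simp
      then show "(1 / real CARD('m)) *\<^sub>R (\<Sum>i\<in>UNIV. inverse (g q (e i q) (e i q)) *\<^sub>R sff q (e i q) (e i q))
          = mean_curvature A g \<epsilon> \<rho> f q"
        using mean_curvature_eq[OF orthonormal_normalize[of "\<lambda>i. e i q" q, OF e(1)[OF q] e(2)[OF q]]]
        by (simp add: linear_cmul[OF sff_linear(1)] linear_cmul[OF sff_linear(2)] divide_inverse
            inverse_mult_distrib[symmetric] del: inverse_mult_distrib)
    qed
    then show "\<exists>V. open V \<and> p \<in> V \<and> msmooth A V (mean_curvature A g \<epsilon> \<rho> f)" using W by blast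
  qed
  moreover have "mean_curvature A g \<epsilon> \<rho> f p \<in> nsp p" for p
  proof -
    obtain e where "orthonormal p e" using orthonormal_exists by blast
    from mean_curvature_eq[OF this] show ?thesis
      using sff_nsp by (simp add: subspace_sum[OF nsp_subspace] subspace_scale[OF nsp_subspace])
  qed
  ultimately show ?thesis by (simp add: normal_section_def)
qed

lemma mean_curvature_first_normal: "mean_curvature A g \<epsilon> \<rho> f p \<in> first_normal_space A \<epsilon> \<rho> f p"
proof -
  obtain e where "orthonormal p e" using orthonormal_exists by blast
  from mean_curvature_eq[OF this] show ?thesis
    unfolding first_normal_space_def by (auto intro!: span_scale span_sum intro: span_base)
qed


section \<open>The bundle \<open>L\<close> and its orthogonal complement\<close>

abbreviation "N1 p \<equiv> first_normal_space A \<epsilon> \<rho> f p"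
abbreviation "L p \<equiv> L_space A \<epsilon> \<rho> f p"
abbreviation "Lperp p \<equiv> L_perp A \<epsilon> \<rho> f p"

lemma dt_wt: "(1, 0) \<in> wt p"
  by (simp add: wtangent_def eform_def)

lemma eta_nsp: "eta A \<epsilon> \<rho> f p \<in> nsp p"
  unfolding eta_def by (rule np_nsp[OF dt_wt])

lemma eta_ip: "\<nu> \<in> nsp p \<Longrightarrow> ip p \<nu> (eta A \<epsilon> \<rho> f p) = fst \<nu>"
  unfolding eta_def np_ip(2)[OF dt_wt] by (simp add: wmetric_def eform_def)

lemma L_spaceI: "a \<in> N1 p \<Longrightarrow> b \<in> span {eta A \<epsilon> \<rho> f p} \<Longrightarrow> a + b \<in> L p"
  unfolding L_space_def by blast

lemma L_spaceE:
  assumes "\<zeta> \<in> L p"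
  obtains a b where "\<zeta> = a + b" "a \<in> N1 p" "b \<in> span {eta A \<epsilon> \<rho> f p}"
  using assms unfolding L_space_def by blast

lemma N1_subset_L: "\<xi> \<in> N1 p \<Longrightarrow> \<xi> \<in> L p"
  using L_spaceI[OF _ span_0, of \<xi> p] by simp

lemma sff_N1: "sff p v w \<in> N1 p"
  unfolding first_normal_space_def by (intro span_base) blast

lemma N1_nsp: "N1 p \<subseteq> nsp p"
  unfolding first_normal_space_def using sff_nsp by (intro span_minimal nsp_subspace) blast

lemma L_subspace: "subspace (L p)"
  unfolding L_space_def first_normal_space_def by (intro subspace_sums subspace_span)

lemma L_nsp: "L p \<subseteq> nsp p"
proof -
  have "span {eta A \<epsilon> \<rho> f p} \<subseteq> nsp p"
    using eta_nsp by (intro span_minimal nsp_subspace) blast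
  then have "a + b \<in> nsp p" if "a \<in> N1 p" "b \<in> span {eta A \<epsilon> \<rho> f p}" for a b
    using that N1_nsp[of p] by (intro subspace_add[OF nsp_subspace]) blast+
  then show ?thesis by (blast elim: L_spaceE)
qed

text \<open>Orthogonality to L is tested on generators. For normal \<nu> the product with \<eta> is
  the product with \<open>\<partial>\<^sub>t\<close>, that is \<open>fst \<nu>\<close>.\<close>

lemma Lperp_iff: "\<nu> \<in> Lperp p \<longleftrightarrow> \<nu> \<in> nsp p \<and> (\<forall>v w. ip p \<nu> (sff p v w) = 0) \<and> fst \<nu> = 0"
proof
  assume \<nu>: "\<nu> \<in> Lperp p"
  then have n: "\<nu> \<in> nsp p" and z: "\<And>\<zeta>. \<zeta> \<in> L p \<Longrightarrow> ip p \<nu> \<zeta> = 0"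
    by (simp_all add: L_perp_def)
  have "0 \<in> N1 p" by (simp add: first_normal_space_def span_0)
  then have "eta A \<epsilon> \<rho> f p \<in> L p"
    using L_spaceI[of 0 p "eta A \<epsilon> \<rho> f p"] span_base[of "eta A \<epsilon> \<rho> f p" "{eta A \<epsilon> \<rho> f p}"] by simp
  then show "\<nu> \<in> nsp p \<and> (\<forall>v w. ip p \<nu> (sff p v w) = 0) \<and> fst \<nu> = 0"
    using n z[OF N1_subset_L[OF sff_N1]] z[of "eta A \<epsilon> \<rho> f p"] eta_ip[OF n] by simp
next
  assume *: "\<nu> \<in> nsp p \<and> (\<forall>v w. ip p \<nu> (sff p v w) = 0) \<and> fst \<nu> = 0"
  have "ip p \<nu> a = 0" if "a \<in> N1 p" for a
    using that * unfolding first_normal_space_def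
    by (intro linear_eq_0_on_span[OF linear_wmetric(2), of _ \<epsilon> \<rho> "f p" \<nu> a]) auto
  moreover have "ip p \<nu> b = 0" if "b \<in> span {eta A \<epsilon> \<rho> f p}" for b
    using that * eta_ip[of \<nu> p]
    by (intro linear_eq_0_on_span[OF linear_wmetric(2), of _ \<epsilon> \<rho> "f p" \<nu> b]) auto
  ultimately have "ip p \<nu> \<zeta> = 0" if "\<zeta> \<in> L p" for \<zeta>
    using that by (elim L_spaceE) (simp add: wmetric_simps)
  then show "\<nu> \<in> Lperp p" using * by (simp add: L_perp_def)
qed

lemma Lperp_L: "\<nu> \<in> Lperp p \<Longrightarrow> \<zeta> \<in> L p \<Longrightarrow> ip p \<nu> \<zeta> = 0"
  by (simp add: L_perp_def)

lemma Lperp_section_Dc: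
  assumes "open W" "p \<in> W" "nsec W \<xi>" "\<And>q. q \<in> W \<Longrightarrow> \<xi> q \<in> Lperp q"
  shows "Dc \<xi> p v = nc \<xi> p v"
  by (rule Dc_eq_nc[OF assms(1-3)]) (use assms(2,4) Lperp_iff in blast)

text \<open>Both terms of \<open>fst (Dc \<xi> p v)\<close> vanish: \<open>fst (\<xi> q)\<close> is
  0 throughout W, and then normality of \<xi> makes its fibre component orthogonal to that of
  \<open>df p v\<close>. So orthogonality to \<eta> survives differentiation of \<xi> in the normal
  bundle.\<close>

lemma fst_nc_Lperp:
  assumes W: "open W" "p \<in> W" and \<xi>: "nsec W \<xi>" and Lp: "\<And>q. q \<in> W \<Longrightarrow> \<xi> q \<in> Lperp q"
  shows "fst (nc \<xi> p v) = 0"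
proof -
  have 0: "fst (\<xi> q) = 0" if "q \<in> W" for q using Lp[OF that] Lperp_iff by blast
  have "ip p (\<xi> p) (df p v) = 0" using nsec_nsp[OF \<xi> W(2)] by simp
  then have "eform \<epsilon> (snd (df p v)) (snd (\<xi> p)) = 0"
    using 0[OF W(2)] by (simp add: wmetric_def eform_commute)
  moreover have "fst (mderiv A \<xi> p v) = 0"
  proof -
    have "fst (mderiv A \<xi> p v) = mderiv A (\<lambda>q. fst (\<xi> q)) p v"
      using mderiv_eq[OF has_mderiv_fst[OF ambient_section_has_mderiv[OF W nsec_ambient[OF \<xi>]]]] by simp
    also have "\<dots> = mderiv A (\<lambda>q. 0) p v"
      by (simp only: mderiv_cong[OF W, of "\<lambda>q. fst (\<xi> q)" "\<lambda>q. 0", OF 0])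
    also have "\<dots> = 0"
      using mderiv_eq[OF has_mderiv_const[of "0::real" p]] by simp
    finally show ?thesis .
  qed
  ultimately have "fst (Dc \<xi> p v) = 0"
    by (simp add: Dc_eq(1)[OF W nsec_ambient[OF \<xi>]])
  then show ?thesis
    using Lperp_section_Dc[OF W \<xi> Lp] by simp
qed

lemma normal_curvature_nsp:
  assumes "open W" "p \<in> W" "nsec W \<xi>" "vector_field A W X" "vector_field A W Y"
  shows "normal_curvature A \<epsilon> \<rho> f X Y \<xi> p \<in> nsp p"
  unfolding normal_curvature_def
  using nsec_nsp[OF nsec_nc[OF assms(1,3,4)] assms(2)] nsec_nsp[OF nsec_nc[OF assms(1,3,5)] assms(2)]
    nsec_nsp[OF assms(3,2)]
  by (intro subspace_diff[OF nsp_subspace] nc_nsp nsp_wt)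

text \<open>The Ricci equation involves \<xi> through its shape operator at p, so membership in
  \<open>L\<^sup>\<bottom>\<close> is asked at p; this form fits the later application to
  \<open>\<nabla>\<^sup>\<bottom>\<^sub>Z \<xi>\<close>.\<close>

lemma normal_curvature_Lperp:
  assumes W: "open W" "p \<in> W" and \<xi>: "nsec W \<xi>" and "\<xi> p \<in> Lperp p"
    and X: "vector_field A W X" and Y: "vector_field A W Y"
  shows "normal_curvature A \<epsilon> \<rho> f X Y \<xi> p = 0"
proof (rule nsp_eqI[OF normal_curvature_nsp[OF W \<xi> X Y] subspace_0[OF nsp_subspace]])
  fix \<nu> assume "\<nu> \<in> nsp p"
  then obtain \<zeta> where \<zeta>: "nsec UNIV \<zeta>" "\<zeta> p = \<nu>" using normal_extension by blast
  obtain e where e: "orthonormal p e" using orthonormal_exists by blast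
  have "ip p (\<xi> p) (sff p v w) = 0" for v w using assms(4) Lperp_iff by blast
  then show "ip p (normal_curvature A \<epsilon> \<rho> f X Y \<xi> p) \<nu> = ip p 0 \<nu>"
    using ricci_equation[OF W \<xi> nsec_subset[OF \<zeta>(1)] X Y e] \<zeta>(2) by simp
qed

text \<open>Three of the four terms in the definition contain the normal curvature applied to \<xi>,
  which vanishes throughout W.\<close>

lemma normal_curvature_deriv_Lperp:
  assumes W: "open W" "p \<in> W" and \<xi>: "nsec W \<xi>" and Lp: "\<And>q. q \<in> W \<Longrightarrow> \<xi> q \<in> Lperp q"
    and X: "vector_field A W X" and Y: "vector_field A W Y" and Z: "vector_field A W Z"
    and D: "levi_civita A g D"
  shows "normal_curvature_deriv A D \<epsilon> \<rho> f Z X Y \<xi> p = - normal_curvature A \<epsilon> \<rho> f X Y (\<lambda>q. nc \<xi> q (Z q)) p"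
proof -
  \<comment> \<open>V and the zero function fill the remaining places of the Levi-Civita axioms,
    from which the smoothness of \<open>D Z V\<close> is taken.\<close>
  have DZ: "vector_field A W (D Z V)" if V: "vector_field A W V" for V
    using D[unfolded levi_civita_def, rule_format, of W Z V V "\<lambda>q. 0"] W(1) Z V msmooth_const by blast
  have "nc (normal_curvature A \<epsilon> \<rho> f X Y \<xi>) p (Z p) = nc (\<lambda>q. 0) p (Z p)"
    by (rule nc_cong[OF W]) (rule normal_curvature_Lperp[OF W(1) _ \<xi> Lp X Y])
  then show ?thesis
    unfolding normal_curvature_deriv_def
    by (simp add: nc_zero normal_curvature_Lperp[OF W \<xi> Lp[OF W(2)]] X Y DZ)
qed

lemma adapted_frame:
  assumes sub: "normal_subbundle A \<epsilon> \<rho> f (L_space A \<epsilon> \<rho> f) l"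
  obtains W and V :: "nat \<Rightarrow> 'a \<Rightarrow> 'n ambient" where "open W" "p \<in> W" "\<And>i. i < l \<Longrightarrow> nsec W (V i)"
    "\<And>i q. i < l \<Longrightarrow> q \<in> W \<Longrightarrow> V i q \<noteq> 0"
    "\<And>i j q. i < l \<Longrightarrow> j < l \<Longrightarrow> i \<noteq> j \<Longrightarrow> q \<in> W \<Longrightarrow> ip q (V i q) (V j q) = 0"
    "\<And>q. q \<in> W \<Longrightarrow> span ((\<lambda>i. V i q) ` {..<l}) = L q"
proof -
  obtain W and E :: "nat \<Rightarrow> 'a \<Rightarrow> 'n ambient" where W: "open W" "p \<in> W" and E: "\<And>i. i < l \<Longrightarrow> nsec W (E i)"
    "\<And>q. q \<in> W \<Longrightarrow> L q = span ((\<lambda>i. E i q) ` {..<l})" "\<And>q. q \<in> W \<Longrightarrow> dim (L q) = l"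
    using sub unfolding normal_subbundle_def by metis
  define S where "S = {V. nsec W V}"
  have "\<exists>U :: nat \<Rightarrow> 'a \<Rightarrow> 'n ambient. (\<forall>i\<in>{..<l}. U i \<in> S) \<and> (\<forall>i\<in>{..<l}. \<forall>q\<in>W. U i q \<noteq> 0) \<and>
    (\<forall>i\<in>{..<l}. \<forall>j\<in>{..<l}. i \<noteq> j \<longrightarrow> (\<forall>q\<in>W. ip q (U i q) (U j q) = 0)) \<and>
    (\<forall>q\<in>W. span ((\<lambda>i. U i q) ` {..<l}) = span ((\<lambda>i. E i q) ` {..<l}))"
  proof (rule gram_schmidt_family[where \<beta>=ip and V=E and S=S and W=W])
    show "E i \<in> S" if "i \<in> {..<l}" for i using E(1) that by (simp add: S_def)
    show "0 < ip q (U q) (U q)" if "U \<in> S" "q \<in> W" "U q \<noteq> 0" for U q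
      using that nsec_nsp nsp_wt by (intro ip_pos) (auto simp: S_def)
    show "(\<lambda>q. X q - Y q) \<in> S" if "X \<in> S" "Y \<in> S" for X Y
      using that subspace_diff[OF nsp_subspace] msmooth_diff[OF W(1), of X Y]
      by (simp add: S_def normal_section_def)
    show "(\<lambda>q. (ip q (X q) (U q) / ip q (U q) (U q)) *\<^sub>R U q) \<in> S"
      if XU: "X \<in> S" "U \<in> S" "\<And>q. q \<in> W \<Longrightarrow> U q \<noteq> 0" for X U
    proof -
      have nz: "ip q (U q) (U q) \<noteq> 0" if "q \<in> W" for q
        using ip_pos[OF nsp_wt XU(3)[OF that]] XU(2) nsec_nsp that by (force simp: S_def)
      have "msmooth A W (\<lambda>q. (ip q (X q) (U q) / ip q (U q) (U q)) *\<^sub>R U q)"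
        unfolding divide_inverse using XU nz
        by (intro msmooth_scaleR msmooth_mult msmooth_inverse msmooth_ip W(1)) (auto simp: S_def normal_section_def)
      then show ?thesis
        using XU subspace_scale[OF nsp_subspace] by (simp add: S_def normal_section_def)
    qed
    show "inj_on (\<lambda>i. E i q) {..<l} \<and> independent ((\<lambda>i. E i q) ` {..<l})" if q: "q \<in> W" for q
    proof -
      \<comment> \<open>A family of l vectors spanning a space of dimension l is injective and
        independent.\<close>
      let ?B = "(\<lambda>i. E i q) ` {..<l}"
      have dim: "dim ?B = l" using E(2,3)[OF q] by (metis dim_span)
      have "card ?B \<le> l" using card_image_le[of "{..<l}" "\<lambda>i. E i q"] by simp
      moreover have "l \<le> card ?B" using dim_le_card'[of ?B] dim by simp
      ultimately have c: "card ?B = l" by simp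
      then have "inj_on (\<lambda>i. E i q) {..<l}" by (intro eq_card_imp_inj_on) simp_all
      moreover have "independent ?B"
        using card_le_dim_spanning[of ?B "span ?B"] c dim by (simp add: span_superset)
      ultimately show ?thesis by blast
    qed
  qed (simp_all add: linear_wmetric wmetric_commute)
  then obtain U :: "nat \<Rightarrow> 'a \<Rightarrow> 'n ambient" where U: "\<forall>i\<in>{..<l}. U i \<in> S" "\<forall>i\<in>{..<l}. \<forall>q\<in>W. U i q \<noteq> 0"
    "\<forall>i\<in>{..<l}. \<forall>j\<in>{..<l}. i \<noteq> j \<longrightarrow> (\<forall>q\<in>W. ip q (U i q) (U j q) = 0)"
    "\<forall>q\<in>W. span ((\<lambda>i. U i q) ` {..<l}) = span ((\<lambda>i. E i q) ` {..<l})"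
    by (elim exE conjE)
  show ?thesis
    by (rule that[of W U]) (use W U E(2) in \<open>simp_all add: S_def\<close>)
qed

lemma Lperp_projection:
  fixes V :: "nat \<Rightarrow> 'n ambient"
  assumes V: "\<And>i. i < l \<Longrightarrow> V i \<noteq> 0" "\<And>i j. i < l \<Longrightarrow> j < l \<Longrightarrow> i \<noteq> j \<Longrightarrow> ip p (V i) (V j) = 0"
    "span (V ` {..<l}) = L p" and w: "w \<in> nsp p"
  defines "w' \<equiv> \<Sum>i<l. (ip p w (V i) / ip p (V i) (V i)) *\<^sub>R V i"
  shows "w - w' \<in> Lperp p" "w' \<in> L p"
proof -
  have VL: "V i \<in> L p" if "i < l" for i using V(3) span_base[of "V i" "V ` {..<l}"] that by blast
  then show w'L: "w' \<in> L p"
    unfolding w'_def by (intro subspace_sum[OF L_subspace] subspace_scale[OF L_subspace]) simp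
  have pos: "0 < ip p x x" if "x \<in> span (V ` {..<l})" "x \<noteq> 0" for x
    using that V(3) L_nsp nsp_wt by (intro ip_pos) blast+
  have ortho: "ip p (w - w') (V i) = 0" if "i < l" for i
    unfolding w'_def
    by (rule orthogonal_expansion(1)[where \<beta>="ip p" and I="{..<l}" and u=V])
      (use V that pos in \<open>simp_all add: linear_wmetric wmetric_commute\<close>)
  have "ip p (w - w') \<zeta> = 0" if "\<zeta> \<in> L p" for \<zeta>
    by (rule linear_eq_0_on_span[OF linear_wmetric(2), of "V ` {..<l}" \<epsilon> \<rho> "f p" "w - w'" \<zeta>])
      (use ortho that V(3) in auto)
  moreover have "w - w' \<in> nsp p"
    using w w'L L_nsp subspace_diff[OF nsp_subspace] by blast
  ultimately show "w - w' \<in> Lperp p" by (simp add: L_perp_def)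
qed

text \<open>The residual of the projection to L is orthogonal to w by assumption and to the
  projection, hence to itself.\<close>

lemma L_eq_perp_Lperp:
  assumes sub: "normal_subbundle A \<epsilon> \<rho> f (L_space A \<epsilon> \<rho> f) l"
    and w: "w \<in> nsp p" "\<And>\<nu>. \<nu> \<in> Lperp p \<Longrightarrow> ip p w \<nu> = 0"
  shows "w \<in> L p"
proof -
  obtain W and V :: "nat \<Rightarrow> 'a \<Rightarrow> 'n ambient" where V: "p \<in> W"
    "\<And>i q. i < l \<Longrightarrow> q \<in> W \<Longrightarrow> V i q \<noteq> 0"
    "\<And>i j q. i < l \<Longrightarrow> j < l \<Longrightarrow> i \<noteq> j \<Longrightarrow> q \<in> W \<Longrightarrow> ip q (V i q) (V j q) = 0"
    "\<And>q. q \<in> W \<Longrightarrow> span ((\<lambda>i. V i q) ` {..<l}) = L q"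
    by (rule adapted_frame[OF sub, of p]) (rule that)
  define w' where "w' = (\<Sum>i<l. (ip p w (V i p) / ip p (V i p) (V i p)) *\<^sub>R V i p)"
  have w': "w - w' \<in> Lperp p" "w' \<in> L p"
    unfolding w'_def using Lperp_projection[of l "\<lambda>i. V i p" p w] V w(1) by simp_all
  have "ip p (w - w') (w - w') = ip p w (w - w') - ip p w' (w - w')"
    by (rule wmetric_simps(2))
  also have "\<dots> = 0"
    unfolding wmetric_commute[of \<epsilon> \<rho> "f p" w' "w - w'"] using w(2)[OF w'(1)] Lperp_L[OF w'] by simp
  finally have "ip p (w - w') (w - w') = 0" .
  moreover have "w - w' \<in> wt p" using w'(1) Lperp_iff nsp_wt by blast
  ultimately have "w - w' = 0" using ip_pos by (metis less_irrefl)
  then show ?thesis using w'(2) by simp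
qed

text \<open>The projection to L along a smooth orthogonal frame is subtracted from a normal
  extension of \<nu>; it vanishes at p because \<nu> is orthogonal to the frame there.\<close>

lemma Lperp_extension:
  assumes sub: "normal_subbundle A \<epsilon> \<rho> f (L_space A \<epsilon> \<rho> f) l" and \<nu>: "\<nu> \<in> Lperp p"
  obtains W \<xi> where "open W" "p \<in> W" "nsec W \<xi>" "\<And>q. q \<in> W \<Longrightarrow> \<xi> q \<in> Lperp q" "\<xi> p = \<nu>"
proof -
  obtain W and V :: "nat \<Rightarrow> 'a \<Rightarrow> 'n ambient" where W: "open W" "p \<in> W" and V: "\<And>i. i < l \<Longrightarrow> nsec W (V i)"
    "\<And>i q. i < l \<Longrightarrow> q \<in> W \<Longrightarrow> V i q \<noteq> 0"
    "\<And>i j q. i < l \<Longrightarrow> j < l \<Longrightarrow> i \<noteq> j \<Longrightarrow> q \<in> W \<Longrightarrow> ip q (V i q) (V j q) = 0"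
    "\<And>q. q \<in> W \<Longrightarrow> span ((\<lambda>i. V i q) ` {..<l}) = L q"
    by (rule adapted_frame[OF sub, of p]) (rule that)
  obtain \<zeta> where \<zeta>: "nsec UNIV \<zeta>" "\<zeta> p = \<nu>"
    using normal_extension \<nu> Lperp_iff by blast
  have \<zeta>W: "nsec W \<zeta>" by (rule nsec_subset[OF \<zeta>(1)]) simp
  define \<xi> where "\<xi> q = \<zeta> q - (\<Sum>i<l. (ip q (\<zeta> q) (V i q) / ip q (V i q) (V i q)) *\<^sub>R V i q)" for q
  have Lp: "\<xi> q \<in> Lperp q" if "q \<in> W" for q
    unfolding \<xi>_def using Lperp_projection(1)[of l "\<lambda>i. V i q" q "\<zeta> q"] V nsec_nsp[OF \<zeta>W that] that by simp
  have nz: "ip q (V i q) (V i q) \<noteq> 0" if "q \<in> W" "i < l" for q i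
    using ip_pos[OF nsp_wt[OF nsec_nsp[OF V(1)[OF that(2)] that(1)]] V(2)[OF that(2,1)]] by simp
  have "msmooth A W \<xi>"
    unfolding \<xi>_def divide_inverse using nz
    by (intro msmooth_diff msmooth_sum msmooth_scaleR msmooth_mult msmooth_inverse msmooth_ip
        nsec_msmooth[OF \<zeta>W] nsec_msmooth[OF V(1)] W(1)) auto
  then have n: "nsec W \<xi>"
    using Lp Lperp_iff by (simp add: normal_section_def)
  have "ip p (\<zeta> p) (V i p) = 0" if "i < l" for i
    using Lperp_L[OF \<nu>] span_base[of "V i p" "(\<lambda>i. V i p) ` {..<l}"] that V(4)[OF W(2)] \<zeta>(2) by auto
  then have "\<xi> p = \<nu>" by (simp add: \<xi>_def \<zeta>(2))
  then show ?thesis using that[OF W n Lp] by blast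
qed

section \<open>The two implications\<close>

text \<open>Each value \<alpha>(v, w) extends to a section \<sigma> = \<alpha>(X, Y) of
  \<open>N\<^sub>1\<close>. Differentiating \<langle>\<xi>, \<sigma>\<rangle> = 0 moves the
  derivative to \<sigma>, where \<open>par\<close> applies.\<close>

lemma parallel_imp_nc_Lperp:
  assumes par: "\<And>W \<xi> p v. open W \<Longrightarrow> nsec W \<xi> \<Longrightarrow> (\<And>q. q \<in> W \<Longrightarrow> \<xi> q \<in> N1 q) \<Longrightarrow> p \<in> W \<Longrightarrow> nc \<xi> p v \<in> L p"
    and W: "open W" "p \<in> W" and \<xi>: "nsec W \<xi>" and Lp: "\<And>q. q \<in> W \<Longrightarrow> \<xi> q \<in> Lperp q"
  shows "nc \<xi> p u \<in> Lperp p"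
  unfolding Lperp_iff
proof (intro conjI allI)
  show "nc \<xi> p u \<in> nsp p"
    by (intro nc_nsp nsp_wt nsec_nsp[OF \<xi> W(2)])
  show "fst (nc \<xi> p u) = 0" by (rule fst_nc_Lperp[OF W \<xi> Lp])
  fix v w
  define X Y where "X = local_extension A p v" and "Y = local_extension A p w"
  define U where "U = W \<inter> fst (chart_at A p)"
  have U: "open U" "p \<in> U" "U \<subseteq> W" "U \<subseteq> fst (chart_at A p)"
    using W chart_at[of p] chart_open[OF chart_at(1)] by (auto simp: U_def)
  have XY: "vector_field A U X" "vector_field A U Y"
    unfolding X_def Y_def by (rule vector_field_subset[OF vector_field_local_extension U(4)])+
  define \<sigma> where "\<sigma> q = sff q (X q) (Y q)" for q
  have \<sigma>: "nsec U \<sigma>" unfolding \<sigma>_def by (rule nsec_sff[OF U(1) XY])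
  have "ip q (\<xi> q) (\<sigma> q) = 0" if "q \<in> U" for q
    using Lp[of q] U(3) that Lperp_iff by (auto simp: \<sigma>_def)
  from nc_skew[OF U(1,2) nsec_subset[OF \<xi> U(3)] \<sigma> this]
  have "ip p (nc \<xi> p u) (\<sigma> p) = - ip p (\<xi> p) (nc \<sigma> p u)" .
  also have "ip p (\<xi> p) (nc \<sigma> p u) = 0"
    using Lperp_L[OF Lp[OF W(2)] par[OF U(1) \<sigma> _ U(2)]] sff_N1 by (simp add: \<sigma>_def)
  finally show "ip p (nc \<xi> p u) (sff p v w) = 0"
    by (simp add: \<sigma>_def X_def Y_def)
qed

text \<open>The three properties are verified for the components of \<phi> in an orthonormal basis
  at p; its vectors are extended by the coordinate fields \<open>F i\<close>, which are orthonormal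
  at p but need not be elsewhere.\<close>

lemma nc_Lperp_perp_N1:
  assumes D: "levi_civita A g D"
    and curv: "\<And>W X Y Z \<xi> p. open W \<Longrightarrow> vector_field A W X \<Longrightarrow> vector_field A W Y \<Longrightarrow> vector_field A W Z \<Longrightarrow>
      nsec W \<xi> \<Longrightarrow> (\<And>q. q \<in> W \<Longrightarrow> \<xi> q \<in> Lperp q) \<Longrightarrow> p \<in> W \<Longrightarrow> normal_curvature_deriv A D \<epsilon> \<rho> f Z X Y \<xi> p = 0"
    and mean: "\<And>p v. nc (mean_curvature A g \<epsilon> \<rho> f) p v \<in> L p"
    and W: "open W" "p \<in> W" and \<xi>: "nsec W \<xi>" and Lp: "\<And>q. q \<in> W \<Longrightarrow> \<xi> q \<in> Lperp q"
  shows "ip p (nc \<xi> p x) (sff p y z) = 0"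
proof -
  obtain e where e: "orthonormal p e" using orthonormal_exists by blast
  define U where "U = W \<inter> fst (chart_at A p)"
  have U: "open U" "p \<in> U" "U \<subseteq> W" "U \<subseteq> fst (chart_at A p)"
    using W chart_at[of p] chart_open[OF chart_at(1)] by (auto simp: U_def)
  define F where "F i = local_extension A p (e i)" for i
  have F: "vector_field A U (F i)" and Fp [simp]: "F i p = e i" for i
    unfolding F_def using vector_field_subset[OF vector_field_local_extension U(4)] by simp_all
  have \<xi>U: "nsec U \<xi>" and LpU: "\<And>q. q \<in> U \<Longrightarrow> \<xi> q \<in> Lperp q"
    using nsec_subset[OF \<xi> U(3)] Lp U(3) by blast+
  define \<phi> where "\<phi> a b c = ip p (nc \<xi> p (e a)) (sff p (e b) (e c))" for a b c
  have "\<phi> a b c = 0" for a b c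
  proof (rule symmetric_components_zero)
    show "\<phi> a b c = \<phi> a c b" for a b c
      by (simp add: \<phi>_def sff_sym[of p "e b"])
    show "\<phi> a b c = \<phi> b a c" for a b c
      using sff_nc_symmetric[OF U(1,2) \<xi>U _ _ F[of a] F[of b], of "e c"] LpU U(2) Lperp_iff
      by (simp add: \<phi>_def)
    show "(\<Sum>b\<in>UNIV. \<phi> a b b) = 0" for a
    proof -
      define H where "H = mean_curvature A g \<epsilon> \<rho> f"
      have "ip q (\<xi> q) (H q) = 0" if "q \<in> U" for q
        using Lperp_L[OF LpU[OF that] N1_subset_L] mean_curvature_first_normal by (simp add: H_def)
      from nc_skew[OF U(1,2) \<xi>U nsec_subset[OF nsec_mean_curvature, folded H_def] this]
      have "ip p (nc \<xi> p (e a)) (H p) = - ip p (\<xi> p) (nc H p (e a))" by simp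
      also have "\<dots> = 0"
        using Lperp_L[OF LpU[OF U(2)] mean] by (simp add: H_def)
      finally show ?thesis
        by (simp add: H_def mean_curvature_eq[OF e] wmetric_simps linear_sum[OF linear_wmetric(2)] \<phi>_def)
    qed
    \<comment> \<open>With \<open>\<phi> a\<close> read as a symmetric matrix, the two sides are the
      entries (b, c) of the products of \<open>\<phi> a\<close> and \<open>\<phi> a'\<close> in the
      two orders. The Ricci equation for the derivative of \<xi> along \<open>F a\<close>, paired
      with the one along \<open>F a'\<close>, equates their difference to a curvature term that is 0
      by \<open>curv\<close>.\<close>
    show "(\<Sum>i\<in>UNIV. \<phi> a b i * \<phi> a' c i) = (\<Sum>i\<in>UNIV. \<phi> a c i * \<phi> a' b i)" for a a' b c
    proof -
      have n: "nsec U (\<lambda>q. nc \<xi> q (F i q))" for i by (rule nsec_nc[OF U(1) \<xi>U F])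
      have "normal_curvature A \<epsilon> \<rho> f (F c) (F b) (\<lambda>q. nc \<xi> q (F a q)) p = 0"
        using normal_curvature_deriv_Lperp[OF U(1,2) \<xi>U LpU F[of c] F[of b] F[of a] D]
          curv[OF U(1) F[of c] F[of b] F[of a] \<xi>U LpU U(2)] by simp
      then show ?thesis
        using ricci_equation[OF U(1,2) n[of a] n[of a'] F[of c] F[of b] e] by (simp add: \<phi>_def)
    qed
  qed
  then have basis: "ip p (nc \<xi> p (e a)) (sff p (e b) (e c)) = 0" for a b c by (simp add: \<phi>_def)
  have 1: "ip p (nc \<xi> p (e a)) (sff p (e b) z) = 0" for a b
    by (subst orthonormal_expand[OF e, of z])
      (simp add: linear_sum[OF sff_linear(2)] linear_cmul[OF sff_linear(2)] linear_sum[OF linear_wmetric(2)]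
        wmetric_simps basis)
  have 2: "ip p (nc \<xi> p (e a)) (sff p y z) = 0" for a
    by (subst orthonormal_expand[OF e, of y])
      (simp add: linear_sum[OF sff_linear(1)] linear_cmul[OF sff_linear(1)] linear_sum[OF linear_wmetric(2)]
        wmetric_simps 1)
  note l = nc_linear[OF W \<xi>]
  show ?thesis
    by (subst orthonormal_expand[OF e, of x])
      (simp add: linear_sum[OF l] linear_cmul[OF l] linear_sum[OF linear_wmetric(1)] wmetric_simps 2)
qed

text \<open>A test vector \<nu> of \<open>L\<^sup>\<bottom>\<close> is extended to a section of
  \<open>L\<^sup>\<bottom>\<close>; the derivative is then moved from \<zeta> to that section, where
  \<open>perp\<close> extends from the values of \<alpha> to their span by linearity.\<close>

lemma nc_N1_L:
  assumes sub: "normal_subbundle A \<epsilon> \<rho> f (L_space A \<epsilon> \<rho> f) l"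
    and perp: "\<And>W \<xi> p x y z. open W \<Longrightarrow> p \<in> W \<Longrightarrow> nsec W \<xi> \<Longrightarrow> (\<And>q. q \<in> W \<Longrightarrow> \<xi> q \<in> Lperp q) \<Longrightarrow>
      ip p (nc \<xi> p x) (sff p y z) = 0"
    and W: "open W" "p \<in> W" and \<zeta>: "nsec W \<zeta>" "\<And>q. q \<in> W \<Longrightarrow> \<zeta> q \<in> N1 q"
  shows "nc \<zeta> p v \<in> L p"
proof (rule L_eq_perp_Lperp[OF sub])
  show "nc \<zeta> p v \<in> nsp p" by (intro nc_nsp nsp_wt nsec_nsp[OF \<zeta>(1) W(2)])
  fix \<nu> assume "\<nu> \<in> Lperp p"
  then obtain V \<xi> where V: "open V" "p \<in> V" and \<xi>: "nsec V \<xi>" "\<And>q. q \<in> V \<Longrightarrow> \<xi> q \<in> Lperp q" "\<xi> p = \<nu>"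
    using Lperp_extension[OF sub] by metis
  have U: "open (W \<inter> V)" "p \<in> W \<inter> V" using W V by auto
  have "ip q (\<zeta> q) (\<xi> q) = 0" if "q \<in> W \<inter> V" for q
    using Lperp_L[OF \<xi>(2) N1_subset_L[OF \<zeta>(2)]] that by (simp add: wmetric_commute)
  from nc_skew[OF U nsec_subset[OF \<zeta>(1)] nsec_subset[OF \<xi>(1)] this]
  have "ip p (nc \<zeta> p v) \<nu> = - ip p (\<zeta> p) (nc \<xi> p v)" by (simp add: \<xi>(3))
  also have "ip p (\<zeta> p) (nc \<xi> p v) = ip p (nc \<xi> p v) (\<zeta> p)" by (rule wmetric_commute)
  also have "\<dots> = 0"
    by (rule linear_eq_0_on_span[OF linear_wmetric(2) _ \<zeta>(2)[OF W(2), unfolded first_normal_space_def]])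
      (use perp[OF V \<xi>(1,2)] in auto)
  finally show "ip p (nc \<zeta> p v) \<nu> = 0" by simp
qed

end

theorem theorem3p2:
  fixes A :: "('a::{t2_space,second_countable_topology}, 'm::finite) chart set"
    and g :: "'a \<Rightarrow> real ^ 'm \<Rightarrow> real ^ 'm \<Rightarrow> real"
    and D :: "('a \<Rightarrow> real ^ 'm) \<Rightarrow> ('a \<Rightarrow> real ^ 'm) \<Rightarrow> 'a \<Rightarrow> real ^ 'm"
    and \<epsilon> :: real and \<rho> h :: "real \<Rightarrow> real"
    and f :: "'a \<Rightarrow> 'n::finite ambient"
    and l :: nat
  assumes eps: "\<epsilon> = 1 \<or> \<epsilon> = -1"
    and rho_smooth: "smooth_on UNIV \<rho>" and rho_pos: "\<And>t. \<rho> t > 0"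
    and h_smooth: "smooth_on UNIV h"
    and h_unit: "\<And>t. \<epsilon> * (deriv \<rho> t)\<^sup>2 + (deriv h t)\<^sup>2 = 1" and h_pos: "\<And>t. deriv h t > 0"
    and nonconstant_curvature:
      "\<And>t. (deriv (deriv \<rho>) t * \<rho> t - (deriv \<rho> t)\<^sup>2 + \<epsilon>) / (\<rho> t)\<^sup>2 \<noteq> 0"
    and atlas: "smooth_atlas A"
    and metric: "riemannian_metric A g"
    and connection: "levi_civita A g D"
    and immersion: "isometric_immersion A g \<epsilon> \<rho> f"
    and subbundle: "normal_subbundle A \<epsilon> \<rho> f (L_space A \<epsilon> \<rho> f) l"
    and rank: "int l < int CARD('n) + 1 - int CARD('m)"
  shows "(\<forall>W \<xi>. open W \<and> normal_section A \<epsilon> \<rho> f W \<xi> \<and>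
             (\<forall>p\<in>W. \<xi> p \<in> first_normal_space A \<epsilon> \<rho> f p) \<longrightarrow>
             (\<forall>p\<in>W. \<forall>v. normal_conn A \<epsilon> \<rho> f \<xi> p v \<in> L_space A \<epsilon> \<rho> f p))
     \<longleftrightarrow>
         (\<forall>W X Y Z \<xi>. open W \<and> vector_field A W X \<and> vector_field A W Y \<and> vector_field A W Z \<and>
             normal_section A \<epsilon> \<rho> f W \<xi> \<and> (\<forall>p\<in>W. \<xi> p \<in> L_perp A \<epsilon> \<rho> f p) \<longrightarrow>
             (\<forall>p\<in>W. normal_curvature_deriv A D \<epsilon> \<rho> f Z X Y \<xi> p = 0))
       \<and> (\<forall>p v. normal_conn A \<epsilon> \<rho> f (mean_curvature A g \<epsilon> \<rho> f) p v \<in> L_space A \<epsilon> \<rho> f p)"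
    (is "?par \<longleftrightarrow> ?curv \<and> ?mean")
proof -
  interpret immersed_manifold A g \<epsilon> \<rho> f
    by unfold_locales (fact atlas eps rho_smooth rho_pos metric immersion)+
  show ?thesis
  proof (intro iffI conjI)
    assume par: ?par
    then have par': "nc \<xi> p v \<in> L p"
      if "open W" "nsec W \<xi>" "\<And>q. q \<in> W \<Longrightarrow> \<xi> q \<in> N1 q" "p \<in> W" for W \<xi> p v
      using that by blast
    \<comment> \<open>H is itself a global smooth section of \<open>N\<^sub>1\<close>.\<close>
    show ?mean
      using par'[OF open_UNIV nsec_mean_curvature mean_curvature_first_normal UNIV_I] by blast
    show ?curv
    proof (intro allI impI ballI, elim conjE)
      fix W X Y Z \<xi> p
      assume W: "open W" "p \<in> W" and vf: "vector_field A W X" "vector_field A W Y" "vector_field A W Z"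
        and \<xi>: "nsec W \<xi>" and "\<forall>p\<in>W. \<xi> p \<in> Lperp p"
      then have Lp: "\<And>q. q \<in> W \<Longrightarrow> \<xi> q \<in> Lperp q" by blast
      have "nc \<xi> p (Z p) \<in> Lperp p"
        by (rule parallel_imp_nc_Lperp[OF par' W \<xi> Lp])
      from normal_curvature_Lperp[OF W nsec_nc[OF W(1) \<xi> vf(3)] this vf(1,2)]
      show "normal_curvature_deriv A D \<epsilon> \<rho> f Z X Y \<xi> p = 0"
        by (simp add: normal_curvature_deriv_Lperp[OF W \<xi> Lp vf connection])
    qed
  next
    assume curv_mean: "?curv \<and> ?mean"
    have perp: "ip p (nc \<xi> p x) (sff p y z) = 0"
      if "open W" "p \<in> W" "nsec W \<xi>" "\<And>q. q \<in> W \<Longrightarrow> \<xi> q \<in> Lperp q" for W \<xi> p x y z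
      using curv_mean by (intro nc_Lperp_perp_N1[OF connection _ _ that]) blast+
    show ?par
    proof (intro allI impI ballI, elim conjE)
      fix W \<zeta> p v
      assume "open W" "p \<in> W" "nsec W \<zeta>" "\<forall>q\<in>W. \<zeta> q \<in> N1 q"
      then show "nc \<zeta> p v \<in> L p"
        using perp by (intro nc_N1_L[OF subbundle, of W]) blast+
    qed
  qed
qed

end
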